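(* Let $F\in\mathfrak N_n^+(\mathbb D)$ be such that $\det F\not\equiv0$. Suppose that the functions $\Theta_r,\Theta_l\in\mathfrak I_n(\mathbb D)$ and $E_r,E_l\in\mathfrak E_n(\mathbb D)$ satisfy $\Theta_r\cdot E_r=E_l\cdot\Theta_l=F$. Then the following statements are equivalent: (i) $\Theta_r\in\mathfrak I_{n,B,r}(\mathbb D)$. (ii) $\Theta_l\in\mathfrak I_{n,B,l}(\mathbb D)$. (iii) $\displaystyle\lim_{s\to1-0}\int_{\mathbb T}\ln|\det[F(st)]|\,m(dt)=\int_{\mathbb T}\ln|\det[\underline F(t)]|\,m(dt)$.
   Context: $\mathbb D$ is the open unit disc, $\mathbb T$ the unit circle, $m$ normalized Lebesgue measure on $\mathbb T$, $\mathfrak M_n$ the complex $n\times n$ matrices with the operator norm induced by the Euclidean norm. Smirnov class: $\mathfrak N_n^+(\mathbb D)$ is the set of holomorphic $F:\mathbb D\to\mathfrak M_n$ such that for each $\epsilon>0$ there is $\delta>0$ with $\int_\Delta \ln^+\|F(rt)\|\,m(dt)<\epsilon$ for all $r\in[0,1)$ and all Borel $\Delta\subseteq\mathbb T$ with $m(\Delta)<\delta$. Such $F$ has radial boundary values $\underline F(t)=\lim_{r\to1-0}F(rt)$ for $m$-a.e. $t$. Outer: a scalar function $e:\mathbb D\to\mathbb C$ is outer if $e(z)=C\exp\{\int_{\mathbb T}\frac{t+z}{t-z}\ln[w(t)]\,m(dt)\}$ with $|C|=1$ and $w:\mathbb T\to[0,\infty)$ such that $\ln w$ is $m$-integrable.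 $\mathfrak E_n(\mathbb D)$ is the set of $E\in\mathfrak N_n^+(\mathbb D)$ with $\det E$ outer. Inner: $\mathfrak I_n(\mathbb D)$ is the set of holomorphic $\Theta:\mathbb D\to\mathfrak M_n$ with $\|\Theta(z)\|\le1$ on $\mathbb D$ and $\underline\Theta(t)$ unitary for $m$-a.e. $t$. Blaschke-Potapov products: for $a\in\mathbb D$ let $b_a(z)=\frac{|a|}{a}\frac{a-z}{1-\overline a z}$ if $a\ne0$ and $b_0(z)=z$; for a non-zero orthogonal projection matrix $P$ let $B_{a,P}(z)=I_n+[b_a(z)-1]P$. A left (resp. right) Blaschke-Potapov product is a constant function with unitary value, or a function of the form $\big(B_{z_1,P_1}B_{z_2,P_2}\cdots\big)V$ (resp. $V\big(\cdots B_{z_2,P_2}B_{z_1,P_1}\big)$), a finite or infinite product with $V$ unitary, $z_k\in\mathbb D$, $P_k$ non-zero orthogonal projection matrices and $\sum_k(1-|z_k|)\,\mathrm{tr}\,P_k<\infty$ (under this condition the products converge on $\mathbb D$). The set of left (resp. right) Blaschke-Potapov products is $\mathfrak I_{n,B,l}(\mathbb D)$ (resp. $\mathfrak I_{n,B,r}(\mathbb D)$). *)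

theory Defs
  imports "HOL-Probability.Probability"
begin

text \<open>
  Functions on the open unit disc are total functions on \<^typ>\<open>complex\<close> of which only the values
  on \<^term>\<open>ball 0 1\<close> are used. The size of the matrices is \<^term>\<open>CARD('n)\<close>.
\<close>

definition circle_measure :: "complex measure" where
  "circle_measure =
     distr (uniform_measure lborel {0..2 * pi}) (restrict_space borel (sphere 0 1)) cis"

lemma space_circle_measure [simp]: "space circle_measure = sphere 0 1"
  by (simp add: circle_measure_def space_restrict_space)

lemma sets_circle_measure [simp]: "sets circle_measure = sets (restrict_space borel (sphere 0 1))"
  by (simp add: circle_measure_def)

lemma prob_space_circle_measure: "prob_space circle_measure"
proof -
  have "cis \<in> borel_measurable borel"
    by (intro borel_measurable_continuous_onI continuous_intros)
  hence "cis \<in> uniform_measure lborel {0..2 * pi} \<rightarrow>\<^sub>M restrict_space borel (sphere 0 1)"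
    by (auto intro!: measurable_restrict_space2)
  moreover have "prob_space (uniform_measure lborel {0..2 * pi})"
    by (intro prob_space_uniform_measure) auto
  ultimately show ?thesis
    unfolding circle_measure_def by (intro prob_space.prob_space_distr)
qed

definition conj_transpose :: "complex^'n^'m \<Rightarrow> complex^'m^'n" where
  "conj_transpose A = (\<chi> i j. cnj (A $ j $ i))"

definition unitary_matrix :: "complex^'n^'n \<Rightarrow> bool" where
  "unitary_matrix U \<longleftrightarrow> conj_transpose U ** U = mat 1 \<and> U ** conj_transpose U = mat 1"

definition orthogonal_projection_matrix :: "complex^'n^'n \<Rightarrow> bool" where
  "orthogonal_projection_matrix P \<longleftrightarrow> P ** P = P \<and> conj_transpose P = P"

text \<open>\<^typ>\<open>complex^'n\<close> carries the Euclidean norm. The norm that the library puts on matrices is the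
  Frobenius norm, hence the explicit \<^const>\<open>onorm\<close>.\<close>

definition opnorm :: "complex^'n^'n \<Rightarrow> real" where
  "opnorm A = onorm (\<lambda>v. A *v v)"

definition matrix_holomorphic_on :: "(complex \<Rightarrow> complex^'n^'n) \<Rightarrow> complex set \<Rightarrow> bool"
    (infixl "matrix'_holomorphic'_on" 50) where
  "F matrix_holomorphic_on S \<longleftrightarrow> (\<forall>i j. (\<lambda>z. F z $ i $ j) holomorphic_on S)"

definition boundary_value :: "(complex \<Rightarrow> complex^'n^'n) \<Rightarrow> complex \<Rightarrow> complex^'n^'n" where
  "boundary_value F t = Lim (at_left 1) (\<lambda>r. F (complex_of_real r * t))"

definition has_boundary_value :: "(complex \<Rightarrow> complex^'n^'n) \<Rightarrow> complex \<Rightarrow> bool" where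
  "has_boundary_value F t \<longleftrightarrow>
     ((\<lambda>r. F (complex_of_real r * t)) \<longlongrightarrow> boundary_value F t) (at_left 1)"

text \<open>The totalised logarithm satisfies \<^prop>\<open>ln 0 = (0::real)\<close>, so that \<open>ln_plus 0 = 0\<close>, as it should.\<close>

definition ln_plus :: "real \<Rightarrow> real" where
  "ln_plus x = max 0 (ln x)"

definition Smirnov_class :: "(complex \<Rightarrow> complex^'n^'n) set" where
  "Smirnov_class = {F. F matrix_holomorphic_on ball 0 1 \<and>
     (\<forall>\<epsilon>>0. \<exists>\<delta>>0. \<forall>r\<in>{0..<1}. \<forall>\<Delta>\<in>sets borel. \<Delta> \<subseteq> sphere 0 1 \<longrightarrow>
        measure circle_measure \<Delta> < \<delta> \<longrightarrow>
        (LINT t:\<Delta>|circle_measure. ln_plus (opnorm (F (complex_of_real r * t)))) < \<epsilon>)}"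

text \<open>Integrability of \<open>ln w\<close> with the convention \<open>ln 0 = -\<infinity>\<close> comprises positivity of \<open>w\<close>
  almost everywhere; this is stated separately because of \<^prop>\<open>ln 0 = (0::real)\<close>.\<close>

definition outer_function :: "(complex \<Rightarrow> complex) \<Rightarrow> bool" where
  "outer_function e \<longleftrightarrow> (\<exists>C w.
     norm C = 1 \<and>
     (\<forall>t\<in>sphere 0 1. 0 \<le> w t) \<and>
     (AE t in circle_measure. 0 < w t) \<and>
     integrable circle_measure (\<lambda>t. ln (w t :: real)) \<and>
     (\<forall>z\<in>ball 0 1. e z =
        C * exp (LINT t|circle_measure. (t + z) / (t - z) * complex_of_real (ln (w t)))))"

definition outer_class :: "(complex \<Rightarrow> complex^'n^'n) set" where
  "outer_class = {E \<in> Smirnov_class. outer_function (\<lambda>z. det (E z))}"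

definition inner_class :: "(complex \<Rightarrow> complex^'n^'n) set" where
  "inner_class = {\<Theta>. \<Theta> matrix_holomorphic_on ball 0 1 \<and>
     (\<forall>z\<in>ball 0 1. opnorm (\<Theta> z) \<le> 1) \<and>
     (AE t in circle_measure. has_boundary_value \<Theta> t \<and> unitary_matrix (boundary_value \<Theta> t))}"

definition blaschke_factor :: "complex \<Rightarrow> complex \<Rightarrow> complex" where
  "blaschke_factor a z =
     (if a = 0 then z else complex_of_real (norm a) / a * ((a - z) / (1 - cnj a * z)))"

text \<open>\<^term>\<open>mat c\<close> is the scalar matrix \<open>c I\<close>.\<close>

definition BP_factor :: "complex \<Rightarrow> complex^'n^'n \<Rightarrow> complex \<Rightarrow> complex^'n^'n" where
  "BP_factor a P z = mat 1 + mat (blaschke_factor a z - 1) ** P"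

text \<open>The products \<open>B\<^sub>0 B\<^sub>1 \<cdots> B\<^sub>N\<^sub>-\<^sub>1\<close> and \<open>B\<^sub>N\<^sub>-\<^sub>1 \<cdots> B\<^sub>1 B\<^sub>0\<close> of the factors \<open>B\<^sub>k\<close> belonging to
  \<open>a k\<close> and \<open>P k\<close>.\<close>

primrec left_BP_partial ::
  "(nat \<Rightarrow> complex) \<Rightarrow> (nat \<Rightarrow> complex^'n^'n) \<Rightarrow> nat \<Rightarrow> complex \<Rightarrow> complex^'n^'n" where
  "left_BP_partial a P 0 z = mat 1"
| "left_BP_partial a P (Suc N) z = left_BP_partial a P N z ** BP_factor (a N) (P N) z"

primrec right_BP_partial ::
  "(nat \<Rightarrow> complex) \<Rightarrow> (nat \<Rightarrow> complex^'n^'n) \<Rightarrow> nat \<Rightarrow> complex \<Rightarrow> complex^'n^'n" where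
  "right_BP_partial a P 0 z = mat 1"
| "right_BP_partial a P (Suc N) z = BP_factor (a N) (P N) z ** right_BP_partial a P N z"

definition BP_parameter :: "complex \<Rightarrow> complex^'n^'n \<Rightarrow> bool" where
  "BP_parameter a P \<longleftrightarrow> a \<in> ball 0 1 \<and> orthogonal_projection_matrix P \<and> P \<noteq> 0"

text \<open>The trace of an orthogonal projection matrix is real; \<^const>\<open>Re\<close> only adjusts the type.\<close>

definition BP_summable :: "(nat \<Rightarrow> complex) \<Rightarrow> (nat \<Rightarrow> complex^'n^'n) \<Rightarrow> bool" where
  "BP_summable a P \<longleftrightarrow> summable (\<lambda>k. (1 - norm (a k)) * Re (trace (P k)))"

text \<open>In the following two definitions the finite products with \<open>N = 0\<close> are the constant functions
  with unitary value.\<close>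

definition left_BP_products :: "(complex \<Rightarrow> complex^'n^'n) set" where
  "left_BP_products = {\<Theta>. \<exists>V a P. unitary_matrix V \<and>
     ((\<exists>N. (\<forall>k<N. BP_parameter (a k) (P k)) \<and>
           (\<forall>z\<in>ball 0 1. \<Theta> z = left_BP_partial a P N z ** V)) \<or>
      ((\<forall>k. BP_parameter (a k) (P k)) \<and> BP_summable a P \<and>
       (\<forall>z\<in>ball 0 1. \<exists>B. (\<lambda>N. left_BP_partial a P N z) \<longlonglongrightarrow> B \<and> \<Theta> z = B ** V)))}"

definition right_BP_products :: "(complex \<Rightarrow> complex^'n^'n) set" where
  "right_BP_products = {\<Theta>. \<exists>V a P. unitary_matrix V \<and>
     ((\<exists>N. (\<forall>k<N. BP_parameter (a k) (P k)) \<and>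
           (\<forall>z\<in>ball 0 1. \<Theta> z = V ** right_BP_partial a P N z)) \<or>
      ((\<forall>k. BP_parameter (a k) (P k)) \<and> BP_summable a P \<and>
       (\<forall>z\<in>ball 0 1. \<exists>B. (\<lambda>N. right_BP_partial a P N z) \<longlonglongrightarrow> B \<and> \<Theta> z = V ** B)))}"

end

theory Submission
  imports Defs "HOL-Complex_Analysis.Complex_Analysis"
begin

text \<open>
  Taking determinants in \<open>F = \<Theta>\<^sub>r E\<^sub>r = E\<^sub>l \<Theta>\<^sub>l\<close> reduces the theorem to a single contractive factor \<open>\<Theta>\<close>.
  Since \<open>det E\<close> is outer, the mean of \<open>ln \<bar>det E\<bar>\<close> over each circle of radius \<open>s < 1\<close> and over the unit circle
  equals \<open>ln \<bar>det E 0\<bar>\<close>, so (iii) says that the mean of \<open>ln \<bar>det \<Theta>\<bar>\<close> over the circle of radius \<open>s\<close> tends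
  to \<open>0\<close>. For this, \<open>F\<close> must have radial limits almost everywhere: its entries are quotients of bounded functions,
  to which Fatou's theorem applies.

  If \<open>\<Theta>\<close> is a Blaschke-Potapov product, \<open>det \<Theta>\<close> is a Blaschke product, and the mean is estimated factor
  by factor. Conversely, Blaschke-Potapov factors are split off at the zeros of \<open>det \<Theta>\<close>, nearest zeros first.
  The remaining contractive factors have determinants that are zero-free on larger and larger discs, so their
  values at \<open>0\<close> dominate the means and tend to modulus \<open>1\<close>; a contraction whose determinant has modulus \<open>1\<close>
  is unitary, and the remainders converge to a unitary constant. Transposition exchanges left and right products.
\<close>

text \<open>The obstacle on the analytic side is that \<open>Smirnov_class\<close> is defined by
  uniform integrability alone, so the radial limits in (iii) must be produced. They rest on one weak
  type estimate for the radial maximal function, which makes Taylor remainders of a bounded function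
  uniformly small along almost every radius.

  Most limits are controlled by values at 0. Means of the logarithm of the modulus over circles in a
  zero-free disc equal the value at 0, and by Parseval a function bounded by 1 with modulus close to
  1 at 0 is nearly constant. So for the remainders \<open>T N\<close> only
  \<open>det (T N 0)\<close> has to be watched. For Blaschke factors a lower bound of the mean is
  enough: the upper bound 0 is free, since contractions have determinants of modulus at most 1.

  Since \<open>ln 0 = 0\<close> and a non-integrable function has integral 0, a logarithmic mean can
  be split only where the determinant is nonzero almost everywhere and the summands are integrable.
  Both come from peeling off finitely many factors, which leaves a remainder without zeros up to the
  given radius.\<close>

no_notation fps_nth (infixl "$" 75)

section \<open>Integrals over the unit circle\<close>

lemma cis_measurable_circle [measurable]:
  "cis \<in> borel \<rightarrow>\<^sub>M restrict_space borel (sphere 0 1)"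
proof -
  have "cis \<in> borel_measurable borel"
    by (intro borel_measurable_continuous_onI continuous_intros)
  thus ?thesis by (auto intro!: measurable_restrict_space2)
qed

lemma nn_integral_circle:
  assumes [measurable]: "f \<in> borel_measurable circle_measure"
  shows "(\<integral>\<^sup>+ t. f t \<partial>circle_measure) =
    (\<integral>\<^sup>+ x. f (cis x) * indicator {0..2 * pi} x \<partial>lborel) / ennreal (2 * pi)"
proof -
  have [measurable]: "f \<in> borel_measurable (restrict_space borel (sphere 0 1))"
    using assms by (simp add: measurable_def)
  show ?thesis
    unfolding circle_measure_def
    by (subst nn_integral_distr) (simp_all add: nn_integral_uniform_measure)
qed

lemma integral_circle:
  fixes f :: "complex \<Rightarrow> 'b::{banach, second_countable_topology}"
  assumes [measurable]: "f \<in> borel_measurable circle_measure"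
  shows "(LINT t|circle_measure. f t) = (LINT x:{0..2 * pi}|lborel. f (cis x)) /\<^sub>R (2 * pi)"
proof -
  have m: "f \<in> borel_measurable (restrict_space borel (sphere 0 1))"
    using assms by (simp add: measurable_def)
  have [measurable]: "(\<lambda>x. f (cis x)) \<in> borel_measurable borel"
    using measurable_compose[OF cis_measurable_circle m] .
  have *: "uniform_measure lborel {0..2 * pi} =
     density lborel (\<lambda>x. ennreal (indicator {0..2*pi} x / (2 * pi)))"
    unfolding uniform_measure_def
  proof (intro arg_cong[where f="density lborel"] ext)
    fix x :: real
    show "indicator {0..2 * pi} x / emeasure lborel {0..2 * pi} = ennreal (indicator {0..2*pi} x / (2 * pi))"
      using divide_ennreal[of 1 "2*pi"] by (cases "x \<in> {0..2 * pi}") auto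
  qed
  have "(LINT t|circle_measure. f t) = (LINT x|uniform_measure lborel {0..2 * pi}. f (cis x))"
    unfolding circle_measure_def by (subst integral_distr) (use m in auto)
  also have "\<dots> = (LINT x|lborel. (indicator {0..2*pi} x / (2 * pi)) *\<^sub>R f (cis x))"
    unfolding * by (rule integral_density) (auto simp: indicator_def)
  also have "\<dots> = (LINT x|lborel. (1/(2*pi)) *\<^sub>R (indicator {0..2*pi} x *\<^sub>R f (cis x)))"
    by (intro Bochner_Integration.integral_cong) auto
  also have "\<dots> = (1/(2*pi)) *\<^sub>R (LINT x|lborel. indicator {0..2*pi} x *\<^sub>R f (cis x))"
    by (rule integral_scaleR_right)
  finally show ?thesis
    unfolding set_lebesgue_integral_def by (simp only: inverse_eq_divide)
qed

lemma circle_borel_measurable_continuous: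
  fixes f :: "complex \<Rightarrow> 'b::topological_space"
  assumes "continuous_on (sphere 0 1) f"
  shows "f \<in> borel_measurable circle_measure"
  using borel_measurable_continuous_on_restrict[OF assms] by (simp add: measurable_def)

lemma circle_borel_measurableI:
  "f \<in> borel_measurable borel \<Longrightarrow> f \<in> borel_measurable circle_measure"
  using measurable_restrict_space1[of f borel borel "sphere 0 1"] by (simp add: measurable_def)

interpretation circle: prob_space circle_measure
  by (rule prob_space_circle_measure)

lemma circle_integrable_continuous:
  fixes f :: "complex \<Rightarrow> 'b::{banach, second_countable_topology}"
  assumes "continuous_on (sphere 0 1) f"
  shows "integrable circle_measure f"
proof -
  have "bounded (f ` sphere 0 1)"
    by (intro compact_imp_bounded compact_continuous_image assms) auto
  then obtain B where "\<And>x. x \<in> sphere 0 1 \<Longrightarrow> norm (f x) \<le> B"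
    unfolding bounded_iff by blast
  thus ?thesis
    by (intro circle.integrable_const_bound[where B=B] circle_borel_measurable_continuous assms) auto
qed

lemma integral_circle_continuous:
  fixes f :: "complex \<Rightarrow> 'b::euclidean_space"
  assumes "continuous_on (sphere 0 1) f"
  shows "((\<lambda>x. f (cis x)) has_integral (2 * pi) *\<^sub>R (LINT t|circle_measure. f t)) {0..2 * pi}"
proof -
  have c: "continuous_on {0..2*pi} (\<lambda>x. f (cis x))"
    by (intro continuous_on_compose2[OF assms] continuous_intros) auto
  have "(LINT t|circle_measure. f t) = (LINT x:{0..2 * pi}|lborel. f (cis x)) /\<^sub>R (2 * pi)"
    by (intro integral_circle circle_borel_measurable_continuous assms)
  also have "(LINT x:{0..2 * pi}|lborel. f (cis x)) = integral {0..2*pi} (\<lambda>x. f (cis x))"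
    by (intro set_borel_integral_eq_integral borel_integrable_atLeastAtMost' c)
  finally have "(2 * pi) *\<^sub>R (LINT t|circle_measure. f t) = integral {0..2*pi} (\<lambda>x. f (cis x))"
    by simp
  thus ?thesis using integrable_continuous_real[OF c] by (simp add: integrable_integral)
qed

text \<open>On the unit circle \<open>dw = \<i> w d\<theta>\<close>; dividing the contour integral
  by \<open>2 * pi * \<i>\<close> turns it into a mean against \<open>t / (t - z)\<close>.\<close>

theorem circle_cauchy:
  assumes "f holomorphic_on ball 0 R" "R > 1" "norm z < 1"
  shows "(LINT t|circle_measure. t / (t - z) * f t) = f z"
proof -
  have "continuous_on (ball 0 R) f" by (rule holomorphic_on_imp_continuous_on[OF assms(1)])
  hence c: "continuous_on (cball 0 1) f"
    by (rule continuous_on_subset) (use assms in auto)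
  have h: "f holomorphic_on ball 0 1"
    by (rule holomorphic_on_subset[OF assms(1)]) (use assms in auto)
  have "((\<lambda>u. f u / (u - z)) has_contour_integral 2 * complex_of_real pi * \<i> * f z) (circlepath 0 1)"
    by (rule Cauchy_integral_circlepath[OF c h]) (use assms in auto)
  hence "((\<lambda>t. cis t / (cis t - z) * f (cis t) * \<i>) has_integral 2 * complex_of_real pi * \<i> * f z) {0..2*pi}"
    unfolding circlepath_def
    by (subst (asm) has_contour_integral_part_circlepath_iff) (auto simp: mult_ac)
  hence "((\<lambda>t. cis t / (cis t - z) * f (cis t) * \<i> * (-\<i>)) has_integral
      2 * complex_of_real pi * \<i> * f z * (-\<i>)) {0..2*pi}"
    by (rule has_integral_mult_left)
  moreover have "2 * complex_of_real pi * \<i> * f z * (-\<i>) = 2 * complex_of_real pi * f z"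
    by (simp add: mult_ac)
  moreover have "(\<lambda>t. cis t / (cis t - z) * f (cis t) * \<i> * (-\<i>)) = (\<lambda>t. cis t / (cis t - z) * f (cis t))"
    by (simp add: mult.assoc)
  ultimately have "((\<lambda>t. cis t / (cis t - z) * f (cis t)) has_integral 2 * complex_of_real pi * f z) {0..2*pi}"
    by (simp only:)
  moreover have "((\<lambda>x. cis x / (cis x - z) * f (cis x)) has_integral
      (2 * pi) *\<^sub>R (LINT t|circle_measure. t / (t - z) * f t)) {0..2 * pi}"
    using assms(3)
    by (intro integral_circle_continuous continuous_on_subset[OF c] continuous_intros) auto
  ultimately have "(2 * pi) *\<^sub>R (LINT t|circle_measure. t / (t - z) * f t) = 2 * complex_of_real pi * f z"
    using has_integral_unique by blast
  thus ?thesis by (simp add: scaleR_conv_of_real)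
qed

theorem circle_mean_value:
  assumes "f holomorphic_on ball 0 R" "R > 1"
  shows "(LINT t|circle_measure. f t) = f 0"
proof -
  have "(LINT t|circle_measure. f t) = (LINT t|circle_measure. t / (t - 0) * f t)"
    by (rule Bochner_Integration.integral_cong) auto
  thus ?thesis using circle_cauchy[OF assms, of 0] by simp
qed

text \<open>The circle formulas are stated for functions holomorphic beyond the unit circle;
  dilation is how functions on the open disc are brought into that form.\<close>

lemma holomorphic_dilate:
  assumes "f holomorphic_on ball 0 1" "0 \<le> s" "s < 1"
  obtains R where "R > 1" "(\<lambda>z. f (complex_of_real s * z)) holomorphic_on ball 0 R"
proof (cases "s = 0")
  case True
  thus ?thesis using that[of 2] by simp
next
  case False
  show ?thesis
  proof (rule that[of "1/s"])
    show "1 / s > 1" using False assms by simp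
    show "(\<lambda>z. f (complex_of_real s * z)) holomorphic_on ball 0 (1/s)"
      using False assms
      by (intro holomorphic_on_compose_gen[OF _ assms(1), unfolded o_def] holomorphic_intros)
        (auto simp: norm_mult field_simps)
  qed
qed

text \<open>Without zeros the logarithm of the modulus is the real part of a holomorphic logarithm,
  to which the mean value property applies.\<close>

lemma ln_norm_mean_value:
  assumes "f holomorphic_on ball 0 R" "R > 1" "\<And>z. z \<in> ball 0 R \<Longrightarrow> f z \<noteq> 0"
  shows "(LINT t|circle_measure. ln (norm (f t))) = ln (norm (f 0))"
proof -
  obtain g where g: "g holomorphic_on ball 0 R" "\<And>z. z \<in> ball 0 R \<Longrightarrow> exp (g z) = f z"
    using holomorphic_logarithm_exists[of "ball 0 R" f 0] assms by auto
  have R: "ln (norm (f z)) = Re (g z)" if "z \<in> ball 0 R" for z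
    using g(2)[OF that, symmetric] by simp
  have "(LINT t|circle_measure. ln (norm (f t))) = (LINT t|circle_measure. Re (g t))"
    by (intro Bochner_Integration.integral_cong) (use R assms(2) in auto)
  also have "\<dots> = Re (LINT t|circle_measure. g t)"
  proof (rule integral_Re)
    have "continuous_on (ball 0 R) g" by (rule holomorphic_on_imp_continuous_on[OF g(1)])
    thus "integrable circle_measure g"
      by (intro circle_integrable_continuous) (rule continuous_on_subset, use assms(2) in auto)
  qed
  also have "\<dots> = Re (g 0)" by (simp add: circle_mean_value[OF g(1) assms(2)])
  finally show ?thesis using R[of 0] assms(2) by auto
qed

lemma continuous_on_dilate:
  assumes "f holomorphic_on ball 0 1" "0 \<le> s" "s < 1"
  shows "continuous_on (sphere 0 1) (\<lambda>t. f (complex_of_real s * t))"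
proof -
  obtain R where R: "R > 1" "(\<lambda>z. f (complex_of_real s * z)) holomorphic_on ball 0 R"
    using holomorphic_dilate[OF assms] .
  from holomorphic_on_imp_continuous_on[OF this(2)] show ?thesis
    by (rule continuous_on_subset) (use R(1) in auto)
qed

lemma ln_norm_mean_value_dilate:
  assumes f: "f holomorphic_on ball 0 1" "0 \<le> s" "s < 1" and nz: "\<And>z. norm z \<le> s \<Longrightarrow> f z \<noteq> 0"
  shows "(LINT t|circle_measure. ln (norm (f (complex_of_real s * t)))) = ln (norm (f 0))"
    "integrable circle_measure (\<lambda>t. ln (norm (f (complex_of_real s * t))))"
proof -
  have nz1: "f (complex_of_real s * t) \<noteq> 0" if "t \<in> cball 0 1" for t
    using that f by (intro nz) (auto simp: norm_mult intro: mult_left_le)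
  obtain R where R: "R > 1" "(\<lambda>z. f (complex_of_real s * z)) holomorphic_on ball 0 R"
    using holomorphic_dilate[OF f] .
  \<comment> \<open>Zeros are excluded only on a closed disc, while a holomorphic logarithm is
    wanted on an open disc containing it; compactness supplies the margin. A point \<open>z\<close>
    outside the closed disc is compared with \<open>z / norm z\<close>.\<close>
  have "\<exists>R'>1. \<forall>z\<in>ball 0 R'. z \<in> ball 0 R \<and> f (complex_of_real s * z) \<noteq> 0"
  proof -
    define U where "U = {z \<in> ball 0 R. f (complex_of_real s * z) \<in> -{0}}"
    have "U = ball 0 R \<inter> (\<lambda>z. f (complex_of_real s * z)) -` (-{0})"
      unfolding U_def by auto
    moreover have o: "open (- {0::complex})" by (rule open_Compl) simp
    ultimately have "open U"
      by (simp only:) (rule continuous_open_preimage[OF holomorphic_on_imp_continuous_on[OF R(2)] open_ball o])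
    moreover have "cball 0 1 \<subseteq> U" unfolding U_def using nz1 R(1) by auto
    ultimately obtain e where "e > 0" "(\<Union>x\<in>cball 0 1. ball x e) \<subseteq> U"
      using compact_subset_open_imp_ball_epsilon_subset[of "cball (0::complex) 1" U] by auto
    have "z \<in> U" if "norm z < 1 + e" for z
    proof (cases "norm z \<le> 1")
      case True thus ?thesis using \<open>cball 0 1 \<subseteq> U\<close> by auto
    next
      case False
      hence "z \<in> ball (z / norm z) e"
      proof -
        have "z / norm z - z = (1 / norm z - 1) *\<^sub>R z"
          by (simp add: scaleR_conv_of_real algebra_simps)
        hence "dist (z / norm z) z = \<bar>1/norm z - 1\<bar> * norm z" by (simp add: dist_norm)
        also have "\<dots> = norm z - 1" using False by (auto simp: abs_if field_simps)
        finally show ?thesis using that by simp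
      qed
      moreover have "z / norm z \<in> cball 0 1" using False by (simp add: norm_divide)
      ultimately show ?thesis using \<open>(\<Union>x\<in>cball 0 1. ball x e) \<subseteq> U\<close> by blast
    qed
    thus ?thesis using \<open>e > 0\<close> unfolding U_def by (intro exI[of _ "1+e"]) auto
  qed
  then obtain R' where R': "R' > 1" "ball 0 R' \<subseteq> ball (0::complex) R"
    "\<And>z. z \<in> ball 0 R' \<Longrightarrow> f (complex_of_real s * z) \<noteq> 0" by (auto simp: subset_eq)
  have "(LINT t|circle_measure. ln (norm (f (complex_of_real s * t)))) = ln (norm (f (complex_of_real s * 0)))"
    by (rule ln_norm_mean_value[where R=R']) (use R' holomorphic_on_subset[OF R(2) R'(2)] in auto)
  thus "(LINT t|circle_measure. ln (norm (f (complex_of_real s * t)))) = ln (norm (f 0))" by simp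
  show "integrable circle_measure (\<lambda>t. ln (norm (f (complex_of_real s * t))))"
    using nz1 by (intro circle_integrable_continuous continuous_intros continuous_on_dilate f) auto
qed

section \<open>The Poisson kernel and the radial maximal function\<close>

text \<open>The Hardy-Littlewood weak type bound. The Vitali covering lemma selects disjoint
  intervals whose fivefold enlargements still cover \<open>E\<close>, hence the factor 5; the bound
  \<open>B\<close> on the radii is what the covering lemma asks for and keeps all intervals inside
  \<open>{a - B..b + B}\<close>.\<close>

lemma weak_type_intervals:
  fixes u :: "real \<Rightarrow> real"
  assumes [measurable]: "u \<in> borel_measurable borel" and pos: "\<And>x. 0 \<le> u x"
    and E [measurable]: "E \<in> sets borel" and sub: "E \<subseteq> {a..b}" and B: "B \<ge> 0" and "L > 0"
    and h: "\<And>x. x \<in> E \<Longrightarrow> \<exists>h>0. h \<le> B \<and> ennreal (L * (2 * h)) \<le> (\<integral>\<^sup>+ y\<in>{x - h..x + h}. u y \<partial>lborel)"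
  shows "ennreal L * emeasure lborel E \<le> 5 * (\<integral>\<^sup>+ y\<in>{a - B..b + B}. u y \<partial>lborel)"
proof -
  from h obtain r where r: "\<And>x. x \<in> E \<Longrightarrow> 0 < r x \<and> r x \<le> B \<and>
      ennreal (L * (2 * r x)) \<le> (\<integral>\<^sup>+ y\<in>{x - r x..x + r x}. u y \<partial>lborel)"
    by metis
  have Ecov: "E \<subseteq> (\<Union>i\<in>E. cball i (r i))" using r by force
  have r0: "\<And>i. i \<in> E \<Longrightarrow> 0 < r i \<and> r i \<le> B" using r by blast
  obtain C where C: "countable C" "C \<subseteq> E"
     "pairwise (\<lambda>i j. disjnt (cball i (r i)) (cball j (r j))) C"
     "E \<subseteq> (\<Union>i\<in>C. cball i (5 * r i))"
    by (rule Vitali_covering_lemma_cballs[OF Ecov r0])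
  define U where "U = (\<integral>\<^sup>+ y\<in>{a - B..b + B}. u y \<partial>lborel)"
  have fin: "ennreal L * emeasure lborel (\<Union>i\<in>D. cball i (5 * r i)) \<le> 5 * U"
    if D: "finite D" "D \<subseteq> C" for D
  proof -
    have rD: "\<And>i. i \<in> D \<Longrightarrow> 0 < r i \<and> r i \<le> B" using r0 D C by blast
    have "ennreal L * emeasure lborel (\<Union>i\<in>D. cball i (5 * r i))
        \<le> ennreal L * (\<Sum>i\<in>D. emeasure lborel (cball i (5 * r i)))"
      using D by (intro mult_left_mono emeasure_subadditive_finite) auto
    also have "\<dots> = (\<Sum>i\<in>D. ennreal L * ennreal (10 * r i))"
      unfolding sum_distrib_left
    proof (intro sum.cong refl)
      fix i assume "i \<in> D"
      hence "i - 5 * r i \<le> i + 5 * r i" using rD[of i] by simp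
      thus "ennreal L * emeasure lborel (cball i (5 * r i)) = ennreal L * ennreal (10 * r i)"
        by (simp add: cball_eq_atLeastAtMost)
    qed
    also have "\<dots> = (\<Sum>i\<in>D. 5 * ennreal (L * (2 * r i)))"
    proof (intro sum.cong refl)
      fix i assume "i \<in> D"
      hence "0 < r i" using rD by blast
      hence "ennreal L * ennreal (10 * r i) = ennreal (5 * (L * (2 * r i)))"
        using \<open>L > 0\<close> by (subst ennreal_mult[symmetric]) (auto simp: algebra_simps)
      also have "\<dots> = ennreal 5 * ennreal (L * (2 * r i))"
        using \<open>L > 0\<close> \<open>0 < r i\<close> by (intro ennreal_mult) auto
      finally show "ennreal L * ennreal (10 * r i) = 5 * ennreal (L * (2 * r i))" by simp
    qed
    also have "\<dots> \<le> (\<Sum>i\<in>D. 5 * (\<integral>\<^sup>+ y\<in>{i - r i..i + r i}. u y \<partial>lborel))"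
      using r D C by (intro sum_mono mult_left_mono) auto
    also have "\<dots> = 5 * (\<Sum>i\<in>D. emeasure (density lborel (\<lambda>y. ennreal (u y))) (cball i (r i)))"
      by (simp add: sum_distrib_left emeasure_density cball_eq_atLeastAtMost)
    also have "(\<Sum>i\<in>D. emeasure (density lborel (\<lambda>y. ennreal (u y))) (cball i (r i)))
        = emeasure (density lborel (\<lambda>y. ennreal (u y))) (\<Union>i\<in>D. cball i (r i))"
    proof (rule sum_emeasure)
      show "disjoint_family_on (\<lambda>i. cball i (r i)) D"
        using C(3) D by (auto simp: disjoint_family_on_def pairwise_def disjnt_def subset_eq)
    qed (use D in auto)
    also have "\<dots> \<le> emeasure (density lborel (\<lambda>y. ennreal (u y))) {a - B..b + B}"
    proof (rule emeasure_mono)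
      have "cball i (r i) \<subseteq> {a - B..b + B}" if "i \<in> D" for i
        using rD[OF that] sub D C that by (force simp: cball_eq_atLeastAtMost)
      thus "(\<Union>i\<in>D. cball i (r i)) \<subseteq> {a - B..b + B}" by blast
    qed auto
    also have "\<dots> = U" by (simp add: U_def emeasure_density)
    finally show ?thesis by (simp add: mult_left_mono)
  qed
  show ?thesis
  proof (cases "C = {}")
    case True
    thus ?thesis using C(4) by simp
  next
    case False
    \<comment> \<open>Finite unions exhausting the countable cover, so that the finite estimate
      passes to the limit by continuity from below.\<close>
    define A where "A n = (\<Union>i\<in>from_nat_into C ` {..n}. cball i (5 * r i))" for n
    have inc: "incseq A" unfolding A_def incseq_def by (intro allI impI UN_mono image_mono) auto
    have rng: "range A \<subseteq> sets lborel" unfolding A_def by auto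
    have "range (from_nat_into C) = C" by (rule range_from_nat_into[OF False C(1)])
    have "(\<Union>i\<in>C. cball i (5 * r i)) \<subseteq> (\<Union>n. A n)"
    proof (rule UN_least)
      fix i assume "i \<in> C"
      then obtain n where "i = from_nat_into C n" using \<open>range (from_nat_into C) = C\<close> by blast
      hence "cball i (5 * r i) \<subseteq> A n" unfolding A_def by blast
      thus "cball i (5 * r i) \<subseteq> (\<Union>n. A n)" by blast
    qed
    hence "ennreal L * emeasure lborel E \<le> ennreal L * emeasure lborel (\<Union>n. A n)"
      using C(4) rng by (intro mult_left_mono emeasure_mono) auto
    also have "\<dots> = ennreal L * (SUP n. emeasure lborel (A n))"
      by (simp only: SUP_emeasure_incseq[OF rng inc])
    also have "\<dots> = (SUP n. ennreal L * emeasure lborel (A n))"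
      by (rule SUP_mult_left_ennreal)
    also have "\<dots> \<le> 5 * U"
    proof (rule SUP_least)
      fix n show "ennreal L * emeasure lborel (A n) \<le> 5 * U"
        unfolding A_def using from_nat_into[OF False] by (intro fin) auto
    qed
    finally show ?thesis unfolding U_def .
  qed
qed

section \<open>Poisson kernel and Poisson formula\<close>

definition poisson_kernel :: "complex \<Rightarrow> complex \<Rightarrow> real" where
  "poisson_kernel z t = (1 - (norm z)\<^sup>2) / (norm (t - z))\<^sup>2"

lemma poisson_kernel_nonneg: "norm z < 1 \<Longrightarrow> 0 \<le> poisson_kernel z t"
  by (simp add: poisson_kernel_def power_le_one)

text \<open>The first summand is the Cauchy kernel and reproduces a holomorphic function at
  \<open>z\<close>. The second is holomorphic in \<open>t\<close> near the closed disc and vanishes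
  at \<open>t = 0\<close>, so its product with a holomorphic function has mean 0.\<close>

lemma poisson_kernel_conv:
  assumes "norm z < 1" "norm t = 1"
  shows "complex_of_real (poisson_kernel z t) = t / (t - z) + cnj z * t / (1 - cnj z * t)"
proof -
  have tt: "t * cnj t = 1" using assms by (simp add: complex_norm_square[symmetric])
  have nz: "t - z \<noteq> 0" "t \<noteq> 0" using assms by auto
  have ct: "cnj t = 1 / t" using tt nz(2) by (simp add: field_simps)
  have nz': "1 - cnj z * t \<noteq> 0"
  proof
    assume "1 - cnj z * t = 0"
    hence "norm (cnj z * t) = 1" by (metis eq_iff_diff_eq_0 norm_one)
    thus False using assms by (simp add: norm_mult)
  qed
  have "complex_of_real ((norm (t - z))\<^sup>2) = (t - z) * cnj (t - z)" by (rule complex_norm_square)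
  also have "cnj (t - z) = (1 - cnj z * t) * cnj t"
    by (simp add: left_diff_distrib mult.assoc tt)
  finally have d: "complex_of_real ((norm (t - z))\<^sup>2) = (t - z) * (1 - cnj z * t) * cnj t"
    by (simp only: mult.assoc)
  have "complex_of_real (poisson_kernel z t) = (1 - z * cnj z) / ((t - z) * (1 - cnj z * t) * cnj t)"
    unfolding poisson_kernel_def of_real_divide d of_real_diff of_real_1
    unfolding complex_norm_square ..
  also have "\<dots> = (1 - z * cnj z) * t / ((t - z) * (1 - cnj z * t))"
    using \<open>t \<noteq> 0\<close> unfolding ct by simp
  also have "\<dots> = t / (t - z) + cnj z * t / (1 - cnj z * t)"
    using nz nz' by (simp add: divide_simps) (simp add: algebra_simps)
  finally show ?thesis .
qed

lemma one_minus_cnj_mult_nonzero: "norm z < 1 \<Longrightarrow> norm t \<le> 1 \<Longrightarrow> 1 - cnj z * t \<noteq> 0"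
proof
  assume "norm z < 1" "norm t \<le> 1" "1 - cnj z * t = 0"
  hence "norm (cnj z * t) = 1" by (metis eq_iff_diff_eq_0 norm_one)
  moreover have "norm (cnj z * t) \<le> norm z * 1"
    unfolding norm_mult by (intro mult_mono) (use \<open>norm t \<le> 1\<close> in auto)
  ultimately show False using \<open>norm z < 1\<close> by simp
qed

lemma continuous_on_poisson_kernel [continuous_intros]:
  "norm z < 1 \<Longrightarrow> continuous_on (sphere 0 1) (poisson_kernel z)"
  unfolding poisson_kernel_def by (intro continuous_intros) auto

theorem poisson_formula:
  assumes g: "g holomorphic_on ball 0 R" "R > 1" and z: "norm z < 1"
  shows "(LINT t|circle_measure. complex_of_real (poisson_kernel z t) * g t) = g z"
proof -
  \<comment> \<open>\<open>1 / norm z\<close> is the modulus of the pole of the second summand of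
    the kernel.\<close>
  define R' where "R' = (if z = 0 then R else min R (1 / norm z))"
  have R': "R' > 1" "R' \<le> R" "\<And>t. norm t < R' \<Longrightarrow> 1 - cnj z * t \<noteq> 0"
  proof -
    show "R' > 1" "R' \<le> R" using z g by (auto simp: R'_def)
    fix t :: complex assume t: "norm t < R'"
    show "1 - cnj z * t \<noteq> 0"
    proof
      assume "1 - cnj z * t = 0"
      hence "norm (cnj z * t) = 1" by (metis eq_iff_diff_eq_0 norm_one)
      hence "norm z * norm t = 1" by (simp add: norm_mult)
      moreover have "norm z * norm t < 1"
        using t by (cases "z = 0") (auto simp: R'_def field_simps)
      ultimately show False by simp
    qed
  qed
  have c: "continuous_on (sphere 0 1) g"
    by (rule continuous_on_subset[OF holomorphic_on_imp_continuous_on[OF g(1)]]) (use g in auto)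
  have 1: "integrable circle_measure (\<lambda>t. t / (t - z) * g t)"
    using z by (intro circle_integrable_continuous continuous_intros c) auto
  have 2: "integrable circle_measure (\<lambda>t. cnj z * t / (1 - cnj z * t) * g t)"
    using one_minus_cnj_mult_nonzero[OF z] by (intro circle_integrable_continuous continuous_intros c) auto
  have "(LINT t|circle_measure. complex_of_real (poisson_kernel z t) * g t)
      = (LINT t|circle_measure. t / (t - z) * g t + cnj z * t / (1 - cnj z * t) * g t)"
    by (intro Bochner_Integration.integral_cong)
      (auto simp: poisson_kernel_conv[OF z] distrib_right)
  also have "\<dots> = (LINT t|circle_measure. t / (t - z) * g t) +
      (LINT t|circle_measure. cnj z * t / (1 - cnj z * t) * g t)"
    using 1 2 by (rule Bochner_Integration.integral_add)
  also have "(LINT t|circle_measure. t / (t - z) * g t) = g z"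
    by (rule circle_cauchy[OF g z])
  also have "(LINT t|circle_measure. cnj z * t / (1 - cnj z * t) * g t) = cnj z * 0 / (1 - cnj z * 0) * g 0"
    by (rule circle_mean_value[of _ R'])
      (use R' in \<open>auto intro!: holomorphic_intros holomorphic_on_subset[OF g(1)]\<close>)
  finally show ?thesis by simp
qed

corollary integral_poisson_kernel:
  assumes "norm z < 1"
  shows "(LINT t|circle_measure. poisson_kernel z t) = 1"
proof -
  have "(LINT t|circle_measure. complex_of_real (poisson_kernel z t) * 1) = 1"
    by (rule poisson_formula[of _ 2]) (use assms in auto)
  thus ?thesis by (simp add: integral_complex_of_real)
qed

lemma poisson_norm_bound:
  assumes g: "g holomorphic_on ball 0 R" "R > 1" and z: "norm z < 1"
  shows "norm (g z) \<le> (LINT t|circle_measure. poisson_kernel z t * norm (g t))"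
proof -
  have "norm (g z) = norm (LINT t|circle_measure. complex_of_real (poisson_kernel z t) * g t)"
    by (simp add: poisson_formula[OF assms])
  also have "\<dots> \<le> (LINT t|circle_measure. norm (complex_of_real (poisson_kernel z t) * g t))"
    by (rule integral_norm_bound)
  also have "\<dots> = (LINT t|circle_measure. poisson_kernel z t * norm (g t))"
    using poisson_kernel_nonneg[OF z] by (simp add: norm_mult)
  finally show ?thesis .
qed

text \<open>Folds a full period onto \<open>{0..pi}\<close>, the interval on which the Poisson
  kernel is monotone.\<close>

lemma has_integral_reflect_circle:
  fixes u :: "real \<Rightarrow> real"
  assumes c: "continuous_on UNIV u" and per: "\<And>x. u (x + 2 * pi) = u x"
    and I: "(u has_integral I) {0..2 * pi}"
  shows "((\<lambda>x. u x + u (- x)) has_integral I) {0..pi}"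
proof -
  have int: "u integrable_on {a..b}" for a b
    by (rule integrable_continuous_real[OF continuous_on_subset[OF c]]) simp
  define J where "J = integral {0..pi} u"
  define K where "K = integral {pi..2*pi} u"
  have J: "(u has_integral J) {0..pi}" and K: "(u has_integral K) {pi..2*pi}"
    unfolding J_def K_def using int by (auto intro: integrable_integral)
  have "(u has_integral J + K) {0..2*pi}"
    by (rule has_integral_combine[OF _ _ J K]) auto
  hence "I = J + K" using I has_integral_unique by blast
  have "((\<lambda>x. u (1 *\<^sub>R x + 2 * pi)) has_integral K /\<^sub>R 1 ^ DIM(real)) (cbox ((pi - 2*pi) /\<^sub>R 1) ((2*pi - 2 * pi) /\<^sub>R 1))"
    by (rule has_integral_affinity') (use K in auto)
  hence "(u has_integral K) {-pi..-0}" by (simp add: per)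
  hence "((\<lambda>x. u (- x)) has_integral K) {0..pi}"
    using has_integral_reflect_real[of "\<lambda>x. u (- x)" K pi 0] by simp
  from has_integral_add[OF J this] show ?thesis using \<open>I = J + K\<close> by simp
qed

lemma norm_cis_diff_real: "(norm (cis y - complex_of_real r))\<^sup>2 = 1 - 2 * r * cos y + r\<^sup>2"
proof -
  have "(norm (cis y - complex_of_real r))\<^sup>2 = (cos y - r)\<^sup>2 + (sin y)\<^sup>2"
    by (simp add: cmod_power2)
  also have "\<dots> = ((sin y)\<^sup>2 + (cos y)\<^sup>2) - 2 * r * cos y + r\<^sup>2"
    by (simp add: power2_eq_square algebra_simps)
  finally show ?thesis by simp
qed

text \<open>If \<open>V\<close> denotes the primitive of the even part, the auxiliary function
  \<open>P y * (2 * L * y - V y)\<close> increases from \<open>0\<close>, because the Poisson kernel \<open>P\<close> decreases on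
  \<open>[0, \<pi>]\<close>; this replaces the layer-cake representation of \<open>P\<close>.\<close>

lemma poisson_le_maximal:
  fixes u :: "real \<Rightarrow> real"
  assumes c: "continuous_on UNIV u" and per: "\<And>x. u (x + 2 * pi) = u x"
    and r: "0 \<le> r" "r < 1"
    and max: "\<And>h. 0 < h \<Longrightarrow> h \<le> pi \<Longrightarrow> integral {0..h} (\<lambda>x. u x + u (- x)) \<le> 2 * h * L"
    and I: "((\<lambda>y. poisson_kernel (complex_of_real r) (cis y) * u y) has_integral I) {0..2 * pi}"
  shows "I \<le> 2 * pi * L"
proof -
  define p where "p y = 1 - 2 * r * cos y + r\<^sup>2" for y
  define P where "P y = (1 - r\<^sup>2) / p y" for y
  have r2: "r\<^sup>2 < 1" using r by (simp add: power_less_one_iff)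
  have p0: "p y > 0" for y
  proof -
    have "r * cos y \<le> r * 1" using r by (intro mult_left_mono) auto
    hence "p y \<ge> (1 - r)\<^sup>2" by (simp add: p_def power2_eq_square algebra_simps)
    moreover have "(1 - r)\<^sup>2 > 0" using r by simp
    ultimately show ?thesis by linarith
  qed
  have P: "poisson_kernel (complex_of_real r) (cis y) = P y" for y
    by (simp add: poisson_kernel_def P_def p_def norm_cis_diff_real)
  have Pe: "P (- y) = P y" "P (y + 2 * pi) = P y" for y by (simp_all add: P_def p_def)
  have Pc: "continuous_on A P" for A
    unfolding P_def using p0 by (auto intro!: continuous_intros simp: p_def less_imp_neq[symmetric])
  have cu: "continuous_on A u" for A by (rule continuous_on_subset[OF c]) simp
  define w where "w x = u x + u (- x)" for x
  have w_eq: "w = (\<lambda>x. u x + u (- x))" by (simp add: w_def fun_eq_iff)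
  have wc: "continuous_on A w" for A
    unfolding w_def by (intro continuous_intros continuous_on_compose2[OF c]) auto
  have "((\<lambda>x. P x * u x + P (- x) * u (- x)) has_integral I) {0..pi}"
    by (rule has_integral_reflect_circle) (use I in \<open>auto simp: P per Pe intro!: continuous_intros Pc cu\<close>)
  hence Iw: "((\<lambda>x. P x * w x) has_integral I) {0..pi}" by (simp add: Pe w_def algebra_simps)
  have one: "((\<lambda>x. 2 * P x) has_integral 2 * pi) {0..pi}"
  proof -
    have "((\<lambda>x. poisson_kernel (complex_of_real r) (cis x)) has_integral
        (2 * pi) *\<^sub>R (LINT t|circle_measure. poisson_kernel (complex_of_real r) t)) {0..2 * pi}"
      by (rule integral_circle_continuous) (use r in \<open>auto intro!: continuous_intros\<close>)
    hence "(P has_integral 2 * pi) {0..2 * pi}"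
      using r by (simp add: integral_poisson_kernel P)
    hence "((\<lambda>x. P x + P (- x)) has_integral 2 * pi) {0..pi}"
      by (intro has_integral_reflect_circle) (auto intro!: Pc Pe simp: Pe)
    thus ?thesis by (simp add: Pe)
  qed
  define V where "V y = integral {0..y} w" for y
  define P' where "P' y = - ((1 - r\<^sup>2) * (2 * r * sin y) / (p y * p y))" for y
  have dP: "(P has_real_derivative P' y) (at y within A)" for y A
  proof -
    have "(p has_real_derivative 2 * r * sin y) (at y within A)"
      unfolding p_def by (auto intro!: derivative_eq_intros)
    moreover have "P = (\<lambda>y. (1 - r\<^sup>2) / p y)" by (simp add: P_def fun_eq_iff)
    ultimately show ?thesis
      using DERIV_divide[OF DERIV_const, of p "2 * r * sin y" y A "1 - r\<^sup>2"] p0[of y]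
      by (simp add: P'_def)
  qed
  have dV: "(V has_real_derivative w y) (at y within {0..pi})" if "y \<in> {0..pi}" for y
    unfolding V_def by (rule integral_has_real_derivative[OF wc that])
  have dQ: "((\<lambda>y. P y * (2 * L * y - V y)) has_vector_derivative
      P' y * (2 * L * y - V y) + P y * (2 * L - w y)) (at y within {0..pi})" if "y \<in> {0..pi}" for y
    unfolding has_real_derivative_iff_has_vector_derivative[symmetric]
    by (rule derivative_eq_intros dP dV[OF that] refl)+ (simp add: algebra_simps)
  have VL: "V y \<le> 2 * L * y" if "y \<in> {0..pi}" for y
    using max[of y] that by (cases "y = 0") (auto simp: V_def w_eq mult_ac)
  \<comment> \<open>The integral of the derivative is the value of the auxiliary function at
    \<open>pi\<close>, which is nonnegative. The summand with \<open>P'\<close> is nonpositive, so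
    the derivative is at most \<open>L * (2 * P y) - P y * w y\<close>, whose integral is
    \<open>2 * pi * L - I\<close>.\<close>
  have "((\<lambda>y. P' y * (2 * L * y - V y) + P y * (2 * L - w y)) has_integral
      P pi * (2 * L * pi - V pi) - P 0 * (2 * L * 0 - V 0)) {0..pi}"
    by (rule fundamental_theorem_of_calculus[OF _ dQ]) auto
  moreover have "((\<lambda>x. L * (2 * P x) - P x * w x) has_integral L * (2 * pi) - I) {0..pi}"
    by (intro has_integral_diff Iw has_integral_mult_right one)
  moreover have "P' y * (2 * L * y - V y) + P y * (2 * L - w y) \<le> L * (2 * P y) - P y * w y"
    if "y \<in> {0..pi}" for y
  proof -
    have "P' y \<le> 0"
      using r r2 that less_imp_le[OF p0] unfolding P'_def by (auto intro!: divide_nonneg_nonneg mult_nonneg_nonneg sin_ge_zero)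
    hence "P' y * (2 * L * y - V y) \<le> 0" using VL[OF that] by (intro mult_nonpos_nonneg) auto
    thus ?thesis by (simp add: algebra_simps)
  qed
  ultimately have "P pi * (2 * L * pi - V pi) - P 0 * (2 * L * 0 - V 0) \<le> L * (2 * pi) - I"
    by (rule has_integral_le)
  moreover have "V 0 = 0" by (simp add: V_def)
  moreover have "P pi * (2 * L * pi - V pi) \<ge> 0"
    using VL[of pi] r2 p0[of pi] by (intro mult_nonneg_nonneg) (auto simp: P_def)
  ultimately show ?thesis by (simp add: mult_ac)
qed

lemma nn_integral_Icc:
  fixes u :: "real \<Rightarrow> real"
  assumes "continuous_on {a..b} u" "\<And>x. 0 \<le> u x"
  shows "(\<integral>\<^sup>+ x\<in>{a..b}. u x \<partial>lborel) = ennreal (integral {a..b} u)"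
proof -
  have s: "set_integrable lborel {a..b} u" by (rule borel_integrable_atLeastAtMost'[OF assms(1)])
  have "(\<integral>\<^sup>+ x\<in>{a..b}. u x \<partial>lborel) = (\<integral>\<^sup>+ x. ennreal (indicator {a..b} x *\<^sub>R u x) \<partial>lborel)"
    by (intro nn_integral_cong) (auto split: split_indicator)
  also have "\<dots> = ennreal (LINT x:{a..b}|lborel. u x)"
    unfolding set_lebesgue_integral_def
    by (rule nn_integral_eq_integral) (use s assms in \<open>auto simp: set_integrable_def\<close>)
  also have "(LINT x:{a..b}|lborel. u x) = integral {a..b} u"
    by (rule set_borel_integral_eq_integral[OF s])
  finally show ?thesis .
qed

text \<open>If every average of the boundary modulus around a point were at most \<open>L\<close>,
  then so would be the Poisson integrals along the radius of that point, and these dominate the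
  modulus of \<open>g\<close>. So each point of \<open>E\<close> has an interval with large average
  and the covering estimate applies. The constant is 5 from the covering times 3 periods.\<close>

theorem radial_maximal_inequality:
  assumes g: "g holomorphic_on ball 0 R" "R > 1" and "L > 0"
  defines "E \<equiv> {t \<in> sphere 0 1. \<exists>r\<in>{0..<1}. L < norm (g (complex_of_real r * t))}"
  shows "E \<in> sets circle_measure"
    and "ennreal L * emeasure circle_measure E \<le> ennreal (15 * (LINT t|circle_measure. norm (g t)))"
proof -
  have gc: "continuous_on (ball 0 R) g" by (rule holomorphic_on_imp_continuous_on[OF g(1)])
  have inb: "complex_of_real r * t \<in> ball 0 R" if "t \<in> ball 0 R" "r \<in> {0..<1}" for r t
  proof -
    have "\<bar>r\<bar> * norm t \<le> 1 * norm t" using that by (intro mult_right_mono) auto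
    thus ?thesis using that by (simp add: norm_mult)
  qed
  \<comment> \<open>A union of open sets over all radii is open, so the uncountable union causes no
    measurability problem.\<close>
  define W where "W = (\<Union>r\<in>{0..<1}. ball 0 R \<inter> (\<lambda>t. norm (g (complex_of_real r * t))) -` {L<..})"
  have "open W"
    unfolding W_def
    by (intro open_UN ballI continuous_open_preimage continuous_intros continuous_on_compose2[OF gc])
      (use inb in auto)
  moreover have "E = W \<inter> sphere 0 1" using g(2) by (auto simp: E_def W_def)
  ultimately show E: "E \<in> sets circle_measure"
    by (auto simp: sets_restrict_space)
  define u where "u x = norm (g (cis x))" for x
  have uc: "continuous_on A u" for A
    unfolding u_def using g(2) by (intro continuous_intros continuous_on_compose2[OF gc]) auto
  have um [measurable]: "u \<in> borel_measurable borel" by (rule borel_measurable_continuous_onI[OF uc])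
  have u0: "u x \<ge> 0" for x by (simp add: u_def)
  have per: "u (x + 2 * pi) = u x" for x by (simp add: u_def cis_mult[symmetric])
  define E' where "E' = {x \<in> {0..2 * pi}. cis x \<in> E}"
  have E'm: "E' \<in> sets borel"
  proof -
    have "cis -` E \<inter> space borel \<in> sets borel"
      by (rule measurable_sets[OF cis_measurable_circle]) (use E in simp)
    moreover have "E' = (cis -` E \<inter> space borel) \<inter> {0..2*pi}" by (auto simp: E'_def)
    ultimately show ?thesis by auto
  qed
  have "ennreal L * emeasure lborel E' \<le> 5 * (\<integral>\<^sup>+ y\<in>{0 - pi..2 * pi + pi}. u y \<partial>lborel)"
  proof (rule weak_type_intervals[OF um u0 E'm])
    show "E' \<subseteq> {0..2*pi}" by (auto simp: E'_def)
    fix \<theta> assume "\<theta> \<in> E'"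
    then obtain r where r: "0 \<le> r" "r < 1" "L < norm (g (complex_of_real r * cis \<theta>))"
      by (auto simp: E'_def E_def)
    show "\<exists>h>0. h \<le> pi \<and> ennreal (L * (2 * h)) \<le> (\<integral>\<^sup>+ y\<in>{\<theta> - h..\<theta> + h}. u y \<partial>lborel)"
    proof (rule ccontr)
      assume neg: "\<not> ?thesis"
      have small: "integral {\<theta> - h..\<theta> + h} u \<le> L * (2 * h)" if "0 < h" "h \<le> pi" for h
      proof -
        have "(\<integral>\<^sup>+ y\<in>{\<theta> - h..\<theta> + h}. u y \<partial>lborel) \<le> ennreal (L * (2 * h))"
          using neg that by (meson linear)
        hence "ennreal (integral {\<theta> - h..\<theta> + h} u) \<le> ennreal (L * (2 * h))"
          by (simp add: nn_integral_Icc[OF uc u0])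
        thus ?thesis using \<open>L > 0\<close> that by simp
      qed
      define v where "v = (\<lambda>x. u (x + \<theta>))"
      have vc: "continuous_on A v" for A
        unfolding v_def by (intro continuous_on_compose2[OF uc[of UNIV]] continuous_intros) auto
      have max: "integral {0..h} (\<lambda>x. v x + v (- x)) \<le> 2 * h * L" if "0 < h" "h \<le> pi" for h
      proof -
        have int: "v integrable_on {a..b}" for a b by (rule integrable_continuous_real[OF vc])
        define J where "J = integral {0..h} v"
        define K where "K = integral {-h..0} v"
        have J: "(v has_integral J) {0..h}" and K: "(v has_integral K) {-h..0}"
          unfolding J_def K_def using int by (auto intro: integrable_integral)
        have "(v has_integral K + J) {-h..h}"
          by (rule has_integral_combine[OF _ _ K J]) (use that in auto)
        moreover have "(u has_integral integral {\<theta> - h..\<theta> + h} u) (cbox (\<theta> - h) (\<theta> + h))"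
          by (simp add: integrable_integral integrable_continuous_real uc)
        hence "((\<lambda>x. u (1 *\<^sub>R x + \<theta>)) has_integral integral {\<theta> - h..\<theta> + h} u /\<^sub>R 1 ^ DIM(real))
            (cbox ((\<theta> - h - \<theta>) /\<^sub>R 1) ((\<theta> + h - \<theta>) /\<^sub>R 1))"
          by (rule has_integral_affinity') auto
        hence "(v has_integral integral {\<theta> - h..\<theta> + h} u) {-h..h}" by (simp add: v_def)
        ultimately have "K + J = integral {\<theta> - h..\<theta> + h} u" by (rule has_integral_unique)
        moreover have "((\<lambda>x. v (- x)) has_integral K) {0..h}"
          using K has_integral_reflect_real[of "\<lambda>x. v (- x)" K h 0] by simp
        from has_integral_add[OF J this] have "integral {0..h} (\<lambda>x. v x + v (- x)) = J + K"
          by (rule integral_unique)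
        ultimately show ?thesis using small[OF that] by (simp add: mult_ac)
      qed
      \<comment> \<open>The rotation moves the point under consideration to 1, where
        \<open>poisson_le_maximal\<close> is formulated.\<close>
      define G where "G z = g (cis \<theta> * z)" for z
      have G: "G holomorphic_on ball 0 R"
        unfolding G_def
        by (intro holomorphic_on_compose_gen[OF _ g(1), unfolded o_def] holomorphic_intros) (auto simp: norm_mult)
      have Gc: "continuous_on (sphere 0 1) G"
        by (rule continuous_on_subset[OF holomorphic_on_imp_continuous_on[OF G]]) (use g in auto)
      have "((\<lambda>y. poisson_kernel (complex_of_real r) (cis y) * norm (G (cis y))) has_integral
         (2 * pi) *\<^sub>R (LINT t|circle_measure. poisson_kernel (complex_of_real r) t * norm (G t))) {0..2 * pi}"
        by (rule integral_circle_continuous) (use r in \<open>auto intro!: continuous_intros Gc\<close>)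
      moreover have "norm (G (cis y)) = v y" for y by (simp add: G_def v_def u_def cis_mult add.commute)
      ultimately have "(2 * pi) *\<^sub>R (LINT t|circle_measure. poisson_kernel (complex_of_real r) t * norm (G t))
          \<le> 2 * pi * L"
        by (intro poisson_le_maximal[OF vc _ r(1,2) max])
          (simp_all add: v_def per add.commute add.left_commute add.assoc[symmetric])
      hence "(LINT t|circle_measure. poisson_kernel (complex_of_real r) t * norm (G t)) \<le> L" by simp
      moreover have "norm (G (complex_of_real r)) \<le> (LINT t|circle_measure. poisson_kernel (complex_of_real r) t * norm (G t))"
        by (rule poisson_norm_bound[OF G g(2)]) (use r in auto)
      ultimately show False using r(3) by (simp add: G_def mult.commute)
    qed
  qed (use \<open>L > 0\<close> in auto)
  \<comment> \<open>Intervals of radius at most \<open>pi\<close> around points of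
    \<open>{0..2 * pi}\<close> reach from \<open>- pi\<close> to \<open>3 * pi\<close>; three
    periods cover this range.\<close>
  also have "(\<integral>\<^sup>+ y\<in>{0 - pi..2 * pi + pi}. u y \<partial>lborel)
      \<le> (\<integral>\<^sup>+ y. ennreal (u y) * indicator {-2*pi..0} y + (ennreal (u y) * indicator {0..2*pi} y
         + ennreal (u y) * indicator {2*pi..4*pi} y) \<partial>lborel)"
    by (intro nn_integral_mono) (auto split: split_indicator)
  also have "\<dots> = (\<integral>\<^sup>+ y\<in>{-2*pi..0}. u y \<partial>lborel) + ((\<integral>\<^sup>+ y\<in>{0..2*pi}. u y \<partial>lborel) +
      (\<integral>\<^sup>+ y\<in>{2*pi..4*pi}. u y \<partial>lborel))"
    by (subst nn_integral_add; (subst nn_integral_add)?) auto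
  also have "(\<integral>\<^sup>+ y\<in>{-2*pi..0}. u y \<partial>lborel) = (\<integral>\<^sup>+ y\<in>{0..2*pi}. u y \<partial>lborel)"
    by (subst nn_integral_real_affine[where c=1 and t="-2*pi"])
      (auto intro!: nn_integral_cong simp: per[of "_ - 2*pi", simplified, symmetric] split: split_indicator)
  also have "(\<integral>\<^sup>+ y\<in>{2*pi..4*pi}. u y \<partial>lborel) = (\<integral>\<^sup>+ y\<in>{0..2*pi}. u y \<partial>lborel)"
    by (subst nn_integral_real_affine[where c=1 and t="2*pi"])
      (auto intro!: nn_integral_cong simp: per add.commute[of "2*pi"] split: split_indicator)
  also have "(\<integral>\<^sup>+ y\<in>{0..2*pi}. u y \<partial>lborel) = ennreal (2 * pi * (LINT t|circle_measure. norm (g t)))"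
  proof -
    have "((\<lambda>x. norm (g (cis x))) has_integral (2 * pi) *\<^sub>R (LINT t|circle_measure. norm (g t))) {0..2 * pi}"
      by (intro integral_circle_continuous continuous_intros continuous_on_subset[OF gc]) (use g in auto)
    hence "integral {0..2*pi} u = 2 * pi * (LINT t|circle_measure. norm (g t))"
      unfolding u_def by (simp add: integral_unique)
    thus ?thesis by (simp add: nn_integral_Icc[OF uc u0])
  qed
  finally have main: "ennreal L * emeasure lborel E' \<le>
      5 * (ennreal (2 * pi * (LINT t|circle_measure. norm (g t))) +
       (ennreal (2 * pi * (LINT t|circle_measure. norm (g t))) + ennreal (2 * pi * (LINT t|circle_measure. norm (g t)))))"
    by (simp add: mult_left_mono)
  have "emeasure circle_measure E = (\<integral>\<^sup>+ t. indicator E t \<partial>circle_measure)" using E by simp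
  also have "\<dots> = (\<integral>\<^sup>+ x. indicator E (cis x) * indicator {0..2 * pi} x \<partial>lborel) / ennreal (2 * pi)"
    by (intro nn_integral_circle borel_measurable_indicator E)
  also have "(\<integral>\<^sup>+ x. indicator E (cis x) * indicator {0..2 * pi} x \<partial>lborel) = (\<integral>\<^sup>+ x. indicator E' x \<partial>lborel)"
    by (intro nn_integral_cong) (auto simp: E'_def split: split_indicator)
  also have "\<dots> = emeasure lborel E'" using E'm by simp
  finally have "ennreal L * emeasure circle_measure E = ennreal L * emeasure lborel E' / ennreal (2 * pi)"
    by (simp add: ennreal_times_divide)
  also have "\<dots> \<le> (5 * (ennreal (2 * pi * (LINT t|circle_measure. norm (g t))) +
       (ennreal (2 * pi * (LINT t|circle_measure. norm (g t))) + ennreal (2 * pi * (LINT t|circle_measure. norm (g t))))))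
       / ennreal (2 * pi)"
    by (rule divide_right_mono_ennreal[OF main])
  also have "\<dots> = ennreal (5 * (3 * (2 * pi * (LINT t|circle_measure. norm (g t))))) / ennreal (2 * pi)"
  proof -
    have "5 * (ennreal X + (ennreal X + ennreal X)) = ennreal (5 * (3 * X))" if "X \<ge> 0" for X
    proof -
      have "ennreal X + (ennreal X + ennreal X) = ennreal (X + (X + X))"
        using that by (simp only: ennreal_plus add_nonneg_nonneg)
      moreover have "ennreal 5 * ennreal (3 * X) = ennreal (5 * (3 * X))"
        using that by (intro ennreal_mult[symmetric]) auto
      ultimately show ?thesis by simp
    qed
    thus ?thesis by simp
  qed
  also have "\<dots> = ennreal (15 * (LINT t|circle_measure. norm (g t)))"
    by (subst divide_ennreal) auto
  finally show "ennreal L * emeasure circle_measure E \<le> ennreal (15 * (LINT t|circle_measure. norm (g t)))" .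
qed

section \<open>Fatou's theorem\<close>

lemma circle_integral_power_cnj_power:
  "(LINT t|circle_measure. t ^ n * cnj t ^ m) = (if n = m then 1 else 0)"
proof -
  have le: "(LINT t|circle_measure. t ^ n * cnj t ^ m) = (if n = m then 1 else 0)" if "m \<le> n" for n m
  proof -
    have "(LINT t|circle_measure. t ^ n * cnj t ^ m) = (LINT t|circle_measure. t ^ (n - m))"
    proof (rule Bochner_Integration.integral_cong)
      fix t assume "t \<in> space circle_measure"
      hence "t * cnj t = 1" by (simp add: complex_norm_square[symmetric])
      moreover have "t ^ n * cnj t ^ m = t ^ (n - m) * (t * cnj t) ^ m"
        using that by (simp add: power_mult_distrib power_add[symmetric] mult.assoc[symmetric])
      ultimately show "t ^ n * cnj t ^ m = t ^ (n - m)" by simp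
    qed simp
    also have "\<dots> = 0 ^ (n - m)"
      by (rule circle_mean_value[of _ 2]) (auto intro!: holomorphic_intros)
    finally show ?thesis using that by simp
  qed
  show ?thesis
  proof (cases "m \<le> n")
    case True thus ?thesis by (rule le)
  next
    case False
    have "(LINT t|circle_measure. t ^ n * cnj t ^ m) = (LINT t|circle_measure. cnj (t ^ m * cnj t ^ n))"
      by (intro Bochner_Integration.integral_cong) (auto simp: mult.commute)
    also have "\<dots> = cnj (LINT t|circle_measure. t ^ m * cnj t ^ n)" by (rule Bochner_Integration.integral_cnj)
    also have "\<dots> = 0" using le[of n m] False by simp
    finally show ?thesis using False by simp
  qed
qed

lemma circle_parseval_finite:
  assumes "finite A"
  shows "(LINT t|circle_measure. (norm (\<Sum>n\<in>A. c n * t ^ n))\<^sup>2) = (\<Sum>n\<in>A. (norm (c n))\<^sup>2)"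
proof -
  have "complex_of_real (LINT t|circle_measure. (norm (\<Sum>n\<in>A. c n * t ^ n))\<^sup>2)
      = (LINT t|circle_measure. complex_of_real ((norm (\<Sum>n\<in>A. c n * t ^ n))\<^sup>2))"
    by (rule integral_complex_of_real[symmetric])
  also have "\<dots> = (LINT t|circle_measure. (\<Sum>n\<in>A. \<Sum>m\<in>A. c n * cnj (c m) * (t ^ n * cnj t ^ m)))"
  proof (rule Bochner_Integration.integral_cong[OF refl])
    fix t
    have "complex_of_real ((norm (\<Sum>n\<in>A. c n * t ^ n))\<^sup>2)
        = (\<Sum>n\<in>A. c n * t ^ n) * cnj (\<Sum>n\<in>A. c n * t ^ n)"
      by (rule complex_norm_square)
    thus "complex_of_real ((norm (\<Sum>n\<in>A. c n * t ^ n))\<^sup>2)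
        = (\<Sum>n\<in>A. \<Sum>m\<in>A. c n * cnj (c m) * (t ^ n * cnj t ^ m))"
      by (simp add: sum_product mult_ac)
  qed
  also have "\<dots> = (\<Sum>n\<in>A. \<Sum>m\<in>A. (LINT t|circle_measure. c n * cnj (c m) * (t ^ n * cnj t ^ m)))"
    by (subst Bochner_Integration.integral_sum; (intro sum.cong refl Bochner_Integration.integral_sum)?)
      (intro circle_integrable_continuous continuous_intros)+
  also have "\<dots> = (\<Sum>n\<in>A. \<Sum>m\<in>A. if m = n then c n * cnj (c m) else 0)"
    by (intro sum.cong refl) (simp add: circle_integral_power_cnj_power)
  also have "\<dots> = (\<Sum>n\<in>A. c n * cnj (c n))" using assms by simp
  also have "\<dots> = complex_of_real (\<Sum>n\<in>A. (norm (c n))\<^sup>2)"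
    by (simp only: complex_norm_square of_real_sum)
  finally show ?thesis by (simp only: of_real_eq_iff)
qed

theorem circle_parseval:
  fixes f :: "complex \<Rightarrow> complex"
  assumes f: "\<And>z. z \<in> ball 0 1 \<Longrightarrow> (\<lambda>n. c n * z ^ n) sums f z" and s: "0 \<le> s" "s < 1"
  shows "(\<lambda>n. (norm (c n))\<^sup>2 * s ^ (2 * n)) sums (LINT t|circle_measure. (norm (f (complex_of_real s * t)))\<^sup>2)"
proof -
  have sums: "(\<lambda>n. c n * complex_of_real s ^ n * t ^ n) sums f (complex_of_real s * t)" if "norm t = 1" for t
    using f[of "complex_of_real s * t"] s that by (simp add: norm_mult power_mult_distrib mult.assoc)
  \<comment> \<open>Convergence at the intermediate radius \<open>(1 + s) / 2\<close> gives absolute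
    convergence at \<open>s\<close>, and thereby the uniform bound \<open>B\<close> for dominated
    convergence.\<close>
  have summ: "summable (\<lambda>n. norm (c n) * s ^ n)"
  proof -
    have "summable (\<lambda>n. norm (c n * complex_of_real s ^ n))"
    proof (rule powser_insidea)
      show "summable (\<lambda>n. c n * complex_of_real ((1 + s) / 2) ^ n)"
        using f[of "complex_of_real ((1 + s) / 2)"] s by (intro sums_summable) (auto simp: norm_divide simp flip: of_real_add)
      show "norm (complex_of_real s) < norm (complex_of_real ((1 + s) / 2))"
        using s by (simp add: norm_divide flip: of_real_add)
    qed
    thus ?thesis using s by (simp add: norm_mult norm_power)
  qed
  define B where "B = (\<Sum>n. norm (c n) * s ^ n)"
  have part: "(LINT t|circle_measure. (norm (\<Sum>n<N. c n * complex_of_real s ^ n * t ^ n))\<^sup>2) =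
      (\<Sum>n<N. (norm (c n))\<^sup>2 * s ^ (2 * n))" for N
    using s by (subst circle_parseval_finite)
      (auto simp: norm_mult norm_power power_mult_distrib power_mult[symmetric] mult.commute)
  have bd: "norm (\<Sum>n<N. c n * complex_of_real s ^ n * t ^ n) \<le> B" if "norm t = 1" for N t
  proof -
    have "norm (\<Sum>n<N. c n * complex_of_real s ^ n * t ^ n) \<le> (\<Sum>n<N. norm (c n) * s ^ n)"
      using that s by (intro order_trans[OF norm_sum] sum_mono) (simp add: norm_mult norm_power)
    also have "\<dots> \<le> B" unfolding B_def using s by (intro sum_le_suminf summ) auto
    finally show ?thesis .
  qed
  have meas: "(\<lambda>t. (norm (\<Sum>n<N. c n * complex_of_real s ^ n * t ^ n))\<^sup>2) \<in> borel_measurable circle_measure" for N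
    by (intro circle_borel_measurable_continuous continuous_intros)
  have lim: "(\<lambda>N. (norm (\<Sum>n<N. c n * complex_of_real s ^ n * t ^ n))\<^sup>2)
      \<longlonglongrightarrow> (norm (f (complex_of_real s * t)))\<^sup>2" if "norm t = 1" for t
    using sums[OF that] unfolding sums_def by (intro tendsto_intros)
  have "(\<lambda>N. LINT t|circle_measure. (norm (\<Sum>n<N. c n * complex_of_real s ^ n * t ^ n))\<^sup>2)
      \<longlonglongrightarrow> (LINT t|circle_measure. (norm (f (complex_of_real s * t)))\<^sup>2)"
  proof (rule integral_dominated_convergence[where w="\<lambda>_. B\<^sup>2"])
    show "(\<lambda>t. (norm (f (complex_of_real s * t)))\<^sup>2) \<in> borel_measurable circle_measure"
      by (rule borel_measurable_LIMSEQ_real[OF lim meas]) auto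
    show "AE t in circle_measure. (\<lambda>N. (norm (\<Sum>n<N. c n * complex_of_real s ^ n * t ^ n))\<^sup>2)
      \<longlonglongrightarrow> (norm (f (complex_of_real s * t)))\<^sup>2"
      using lim by (intro AE_I2) auto
    show "AE t in circle_measure. norm ((norm (\<Sum>n<N. c n * complex_of_real s ^ n * t ^ n))\<^sup>2) \<le> B\<^sup>2" for N
      using bd by (intro AE_I2) (auto intro!: power_mono)
  qed (use meas in auto)
  thus ?thesis unfolding part sums_def .
qed

text \<open>By Parseval the weighted sum is a mean of squares bounded by 1 on each circle of radius
  \<open>s < 1\<close>; the weights disappear as \<open>s\<close> tends to 1.\<close>

lemma taylor_coefficients_square_summable:
  fixes f :: "complex \<Rightarrow> complex"
  assumes f: "\<And>z. z \<in> ball 0 1 \<Longrightarrow> (\<lambda>n. c n * z ^ n) sums f z"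
    and bd: "\<And>z. z \<in> ball 0 1 \<Longrightarrow> norm (f z) \<le> 1"
  shows "finite A \<Longrightarrow> (\<Sum>n\<in>A. (norm (c n))\<^sup>2) \<le> 1"
    and "summable (\<lambda>n. (norm (c n))\<^sup>2)"
proof -
  have fin: "(\<Sum>n\<in>A. (norm (c n))\<^sup>2) \<le> 1" if "finite A" for A
  proof (rule tendsto_upperbound)
    show "((\<lambda>s. \<Sum>n\<in>A. (norm (c n))\<^sup>2 * s ^ (2 * n)) \<longlongrightarrow> (\<Sum>n\<in>A. (norm (c n))\<^sup>2)) (at_left 1)"
      by (rule tendsto_eq_intros refl | simp)+
    have "\<forall>\<^sub>F s in at_left 1. (s::real) \<in> {0<..<1}" by (rule eventually_at_leftI[of 0]) auto
    thus "\<forall>\<^sub>F s in at_left 1. (\<Sum>n\<in>A. (norm (c n))\<^sup>2 * s ^ (2 * n)) \<le> 1"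
    proof eventually_elim
      fix s :: real assume s: "s \<in> {0<..<1}"
      have S: "(\<lambda>n. (norm (c n))\<^sup>2 * s ^ (2 * n)) sums (LINT t|circle_measure. (norm (f (complex_of_real s * t)))\<^sup>2)"
        by (rule circle_parseval[OF f]) (use s in auto)
      have "(\<Sum>n\<in>A. (norm (c n))\<^sup>2 * s ^ (2 * n)) \<le> (LINT t|circle_measure. (norm (f (complex_of_real s * t)))\<^sup>2)"
        using sum_le_suminf[OF sums_summable[OF S] \<open>finite A\<close>] sums_unique[OF S] s by simp
      also have "\<dots> \<le> (LINT t|circle_measure. 1)"
      proof (rule integral_mono')
        fix t assume "t \<in> space circle_measure"
        hence "norm (f (complex_of_real s * t)) \<le> 1" using s by (intro bd) (auto simp: norm_mult)
        thus "(norm (f (complex_of_real s * t)))\<^sup>2 \<le> 1" by (simp add: power_le_one)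
      qed auto
      finally show "(\<Sum>n\<in>A. (norm (c n))\<^sup>2 * s ^ (2 * n)) \<le> 1"
        using circle.prob_space by simp
    qed
  qed auto
  show "(\<Sum>n\<in>A. (norm (c n))\<^sup>2) \<le> 1" if "finite A" by (rule fin[OF that])
  show "summable (\<lambda>n. (norm (c n))\<^sup>2)"
    by (rule summableI_nonneg_bounded[of _ 1]) (use fin in auto)
qed

text \<open>The squares of all Taylor coefficients sum to at most 1, so a value at 0 of modulus
  close to 1 leaves little for any other coefficient. This is the rigidity that later forces the
  diagonal entries of the remainders to become constant.\<close>

lemma norm_diff_le_of_bounded:
  assumes "f holomorphic_on ball 0 1" "\<And>z. z \<in> ball 0 1 \<Longrightarrow> norm (f z) \<le> 1" and z: "norm z < 1"
  shows "norm (f z - f 0) \<le> sqrt (1 - (norm (f 0))\<^sup>2) / (1 - norm z)"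
proof -
  define c where "c n = (deriv ^^ n) f 0 / fact n" for n
  have c: "(\<lambda>n. c n * w ^ n) sums f w" if "w \<in> ball 0 1" for w
    using holomorphic_power_series[OF assms(1) that] by (simp add: c_def)
  have c0: "c 0 = f 0" by (simp add: c_def)
  have cn: "norm (c (Suc n)) \<le> sqrt (1 - (norm (f 0))\<^sup>2)" for n
    using taylor_coefficients_square_summable(1)[OF c assms(2), of "{0, Suc n}"] c0
    by (auto intro!: real_le_rsqrt)
  have S: "(\<lambda>n. c (Suc n) * z ^ Suc n) sums (f z - f 0)"
    using c[of z] z c0 by (subst sums_Suc_iff) auto
  have g: "summable (\<lambda>n. sqrt (1 - (norm (f 0))\<^sup>2) * norm z ^ n)"
    using z by (intro summable_mult summable_geometric) auto
  have le: "norm (c (Suc n) * z ^ Suc n) \<le> sqrt (1 - (norm (f 0))\<^sup>2) * norm z ^ n" for n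
  proof -
    have "norm z ^ Suc n \<le> norm z ^ n" using z by (intro power_decreasing) auto
    moreover have "(norm (f 0))\<^sup>2 \<le> 1" using assms(2)[of 0] by (simp add: power_le_one)
    ultimately show ?thesis unfolding norm_mult norm_power by (intro mult_mono cn) auto
  qed
  have "norm (f z - f 0) = norm (\<Sum>n. c (Suc n) * z ^ Suc n)" using sums_unique[OF S] by simp
  also have "\<dots> \<le> (\<Sum>n. sqrt (1 - (norm (f 0))\<^sup>2) * norm z ^ n)"
    by (rule norm_suminf_le[OF le g])
  also have "\<dots> = sqrt (1 - (norm (f 0))\<^sup>2) / (1 - norm z)"
    using z by (subst suminf_mult) (auto simp: suminf_geometric)
  finally show ?thesis .
qed

text \<open>The exceptional sets of the dilated functions increase to that of \<open>f\<close>, and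
  their bounds are uniform: the mean of the modulus is at most the root of the mean square, which
  Parseval bounds by the coefficients.\<close>

lemma disc_radial_maximal_inequality:
  assumes f: "f holomorphic_on ball 0 1"
    and c: "\<And>z. z \<in> ball 0 1 \<Longrightarrow> (\<lambda>n. c n * z ^ n) sums f z"
    and sm: "summable (\<lambda>n. (norm (c n))\<^sup>2)" and "L > 0"
  shows "{t \<in> sphere 0 1. \<exists>r\<in>{0..<1}. L < norm (f (complex_of_real r * t))} \<in> sets circle_measure" (is "?E \<in> _")
    and "ennreal L * emeasure circle_measure {t \<in> sphere 0 1. \<exists>r\<in>{0..<1}. L < norm (f (complex_of_real r * t))}
      \<le> ennreal (15 * sqrt (\<Sum>n. (norm (c n))\<^sup>2))"
proof -
  define s where "s k = 1 - 1 / (real k + 2)" for k :: nat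
  have s: "0 < s k" "s k < 1" for k by (auto simp: s_def field_simps)
  have smono: "s k \<le> s l" if "k \<le> l" for k l using that by (auto simp: s_def intro!: divide_left_mono)
  have slim: "s \<longlonglongrightarrow> 1" unfolding s_def by real_asymp
  define g where "g k z = f (complex_of_real (s k) * z)" for k z
  have "\<exists>R>1. g k holomorphic_on ball 0 R" for k
    using holomorphic_dilate[OF f, of "s k"] s[of k] unfolding g_def by (metis less_imp_le)
  then obtain R where R: "\<And>k. R k > 1" "\<And>k. g k holomorphic_on ball 0 (R k)" by metis
  define A where "A k = {t \<in> sphere 0 1. \<exists>r\<in>{0..<1}. L < norm (g k (complex_of_real r * t))}" for k
  have Am: "A k \<in> sets circle_measure" for k
    unfolding A_def by (rule radial_maximal_inequality(1)[OF R(2,1) \<open>L > 0\<close>])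
  have Aeq: "A k = {t \<in> sphere 0 1. \<exists>r\<in>{0..<s k}. L < norm (f (complex_of_real r * t))}" for k
  proof (intro set_eqI iffI)
    fix t assume "t \<in> A k"
    then obtain r where r: "r \<in> {0..<1}" "L < norm (f (complex_of_real (s k * r) * t))" "norm t = 1"
      by (auto simp: A_def g_def mult.assoc)
    moreover have "s k * r \<in> {0..<s k}" using r s[of k] by auto
    ultimately show "t \<in> {t \<in> sphere 0 1. \<exists>r\<in>{0..<s k}. L < norm (f (complex_of_real r * t))}"
      by (auto simp del: of_real_mult)
  next
    fix t assume "t \<in> {t \<in> sphere 0 1. \<exists>r\<in>{0..<s k}. L < norm (f (complex_of_real r * t))}"
    then obtain r where r: "r \<in> {0..<s k}" "L < norm (f (complex_of_real r * t))" "norm t = 1" by auto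
    moreover have "complex_of_real (s k) * (complex_of_real (r / s k) * t) = complex_of_real r * t"
      using s[of k] by simp
    ultimately have "r / s k \<in> {0..<1}" "L < norm (g k (complex_of_real (r / s k) * t))"
      using s[of k] unfolding g_def by (auto simp: field_simps)
    thus "t \<in> A k" using r(3) unfolding A_def by (auto simp del: of_real_divide)
  qed
  have inc: "incseq A"
    unfolding incseq_def Aeq using smono by (force intro: less_le_trans)
  have EA: "?E = (\<Union>k. A k)"
  proof (intro set_eqI iffI)
    fix t assume "t \<in> ?E"
    then obtain r where r: "0 \<le> r" "r < 1" "L < norm (f (complex_of_real r * t))" "norm t = 1" by auto
    from order_tendstoD(1)[OF slim r(2)] obtain k where "r < s k"
      by (auto simp: eventually_sequentially)
    thus "t \<in> (\<Union>k. A k)" using r unfolding Aeq by (auto intro!: exI[of _ k] bexI[of _ r])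
  next
    fix t assume "t \<in> (\<Union>k. A k)"
    thus "t \<in> ?E" unfolding Aeq using s by (force intro: less_trans)
  qed
  show "?E \<in> sets circle_measure" unfolding EA using Am by (intro sets.countable_UN) auto
  have bound: "ennreal L * emeasure circle_measure (A k) \<le> ennreal (15 * sqrt (\<Sum>n. (norm (c n))\<^sup>2))" for k
  proof -
    have cont: "continuous_on (sphere 0 1) (g k)"
      by (rule continuous_on_subset[OF holomorphic_on_imp_continuous_on[OF R(2)]]) (use R(1)[of k] in auto)
    have i1: "integrable circle_measure (\<lambda>t. norm (g k t))"
      and i2: "integrable circle_measure (\<lambda>t. (norm (g k t))\<^sup>2)"
      by (intro circle_integrable_continuous continuous_intros cont)+
    have P: "(\<lambda>n. (norm (c n))\<^sup>2 * s k ^ (2 * n)) sums (LINT t|circle_measure. (norm (g k t))\<^sup>2)"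
      unfolding g_def by (rule circle_parseval[OF c]) (use s[of k] in auto)
    have "(LINT t|circle_measure. (norm (g k t))\<^sup>2) \<le> (\<Sum>n. (norm (c n))\<^sup>2)"
      using s[of k] by (intro sums_le[OF _ P summable_sums[OF sm]]) (auto intro!: mult_left_le power_le_one)
    \<comment> \<open>The nonnegativity of the variance serves as the Cauchy-Schwarz
      inequality.\<close>
    moreover have "(LINT t|circle_measure. norm (g k t))\<^sup>2 \<le> (LINT t|circle_measure. (norm (g k t))\<^sup>2)"
      using circle.variance_positive[of "\<lambda>t. norm (g k t)"] circle.variance_eq[OF i1 i2] by simp
    ultimately have "(LINT t|circle_measure. norm (g k t)) \<le> sqrt (\<Sum>n. (norm (c n))\<^sup>2)"
      by (intro real_le_rsqrt) simp
    hence "ennreal (15 * (LINT t|circle_measure. norm (g k t))) \<le> ennreal (15 * sqrt (\<Sum>n. (norm (c n))\<^sup>2))"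
      by (intro ennreal_leI) simp
    thus ?thesis
      using radial_maximal_inequality(2)[OF R(2)[of k] R(1) \<open>L > 0\<close>] unfolding A_def by (rule order_trans[rotated])
  qed
  have "ennreal L * emeasure circle_measure (\<Union>k. A k) = ennreal L * (SUP k. emeasure circle_measure (A k))"
    using Am by (subst SUP_emeasure_incseq[OF _ inc]) auto
  also have "\<dots> = (SUP k. ennreal L * emeasure circle_measure (A k))" by (rule SUP_mult_left_ennreal)
  also have "\<dots> \<le> ennreal (15 * sqrt (\<Sum>n. (norm (c n))\<^sup>2))" by (rule SUP_least) (rule bound)
  finally show "ennreal L * emeasure circle_measure ?E \<le> ennreal (15 * sqrt (\<Sum>n. (norm (c n))\<^sup>2))"
    unfolding EA .
qed

text \<open>Taylor polynomials are continuous up to the circle. If along the radius of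
  \<open>t\<close> the remainder \<open>f - S N\<close> is uniformly small for suitable
  \<open>N\<close>, then \<open>f\<close> is Cauchy there; the maximal inequality shows that almost
  every \<open>t\<close> has this property.\<close>

theorem fatou_radial_limits:
  assumes f: "f holomorphic_on ball 0 1" and bd: "\<And>z. z \<in> ball 0 1 \<Longrightarrow> norm (f z) \<le> 1"
  shows "AE t in circle_measure. \<exists>l. ((\<lambda>r. f (complex_of_real r * t)) \<longlongrightarrow> l) (at_left 1)"
proof -
  define c where "c n = (deriv ^^ n) f 0 / fact n" for n
  have c: "(\<lambda>n. c n * w ^ n) sums f w" if "w \<in> ball 0 1" for w
    using holomorphic_power_series[OF f that] by (simp add: c_def)
  have sm: "summable (\<lambda>n. (norm (c n))\<^sup>2)"
    by (rule taylor_coefficients_square_summable(2)[OF c bd])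
  define S where "S N z = (\<Sum>n<N. c n * z ^ n)" for N z
  define E where "E L N = {t \<in> sphere 0 1. \<exists>r\<in>{0..<1}. L < norm (f (complex_of_real r * t) - S N (complex_of_real r * t))}" for L N
  have Em: "E L N \<in> sets circle_measure"
    and Eb: "ennreal L * emeasure circle_measure (E L N) \<le> ennreal (15 * sqrt (\<Sum>n. (norm (c (n + N)))\<^sup>2))"
    if "L > 0" for L N
  proof -
    define d where "d n = (if n < N then 0 else c n)" for n
    have d: "(\<lambda>n. d n * z ^ n) sums (f z - S N z)" if "z \<in> ball 0 1" for z
    proof -
      have "(\<lambda>n. if n \<in> {..<N} then c n * z ^ n else 0) sums S N z"
        unfolding S_def by (rule sums_If_finite_set) simp
      from sums_diff[OF c[OF that] this] show ?thesis
        by (rule sums_cong[THEN iffD1, rotated]) (simp add: d_def)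
    qed
    have h: "(\<lambda>z. f z - S N z) holomorphic_on ball 0 1"
      unfolding S_def by (intro holomorphic_intros f)
    have sd: "summable (\<lambda>n. (norm (d n))\<^sup>2)"
      by (rule summable_comparison_test'[OF sm]) (simp add: d_def)
    have "(\<Sum>n. (norm (d n))\<^sup>2) = (\<Sum>n. (norm (c (n + N)))\<^sup>2)"
      using suminf_split_initial_segment[OF sd, of N] by (simp add: d_def)
    thus "E L N \<in> sets circle_measure"
      "ennreal L * emeasure circle_measure (E L N) \<le> ennreal (15 * sqrt (\<Sum>n. (norm (c (n + N)))\<^sup>2))"
      using disc_radial_maximal_inequality[OF h d sd that] unfolding E_def by auto
  qed
  \<comment> \<open>A bad point lies in \<open>E L N\<close> for every \<open>N\<close>, and the
    measures of these sets are bounded by the tails of a convergent series.\<close>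
  have null: "AE t in circle_measure. \<exists>N. t \<notin> E L N" if L: "L > 0" for L
  proof -
    have m: "(\<Inter>N. E L N) \<in> sets circle_measure" using Em[OF L] by (intro sets.countable_INT) auto
    have "ennreal L * emeasure circle_measure (\<Inter>N. E L N) \<le> ennreal (15 * sqrt (\<Sum>n. (norm (c (n + N)))\<^sup>2))" for N
      by (rule order_trans[OF mult_left_mono[OF emeasure_mono] Eb[OF L]]) (use Em[OF L] in auto)
    moreover have "(\<lambda>N. ennreal (15 * sqrt (\<Sum>n. (norm (c (n + N)))\<^sup>2))) \<longlonglongrightarrow> ennreal (15 * sqrt 0)"
      by (intro tendsto_intros tendsto_ennrealI suminf_exist_split2 sm)
    ultimately have "ennreal L * emeasure circle_measure (\<Inter>N. E L N) \<le> ennreal (15 * sqrt 0)"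
      by (intro LIMSEQ_le_const) auto
    hence "emeasure circle_measure (\<Inter>N. E L N) = 0" using L by simp
    from AE_I[OF _ this m, of "\<lambda>t. \<exists>N. t \<notin> E L N"] show ?thesis by blast
  qed
  have "AE t in circle_measure. \<forall>j. \<exists>N. t \<notin> E (1 / real (Suc j)) N"
    by (subst AE_all_countable) (use null in auto)
  moreover have "AE t in circle_measure. t \<in> sphere 0 1" by (rule AE_I2) simp
  ultimately show ?thesis
  proof eventually_elim
    fix t assume t: "\<forall>j. \<exists>N. t \<notin> E (1 / real (Suc j)) N" "t \<in> sphere 0 1"
    define F where "F = filtermap (\<lambda>r. f (complex_of_real r * t)) (at_left 1)"
    have "cauchy_filter F"
      unfolding F_def cauchy_filter_metric_filtermap
    proof (intro allI impI)
      fix e :: real assume "e > 0"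
      then obtain j where j: "1 / real (Suc j) < e / 4" using nat_approx_posE[of "e/4"] by auto
      obtain N where N: "t \<notin> E (1 / real (Suc j)) N" using t by blast
      have cl: "norm (f (complex_of_real r * t) - S N (complex_of_real r * t)) < e / 4" if "r \<in> {0..<1}" for r
        using N that t(2) j unfolding E_def by (force simp: not_less)
      have "((\<lambda>r. S N (complex_of_real r * t)) \<longlongrightarrow> S N (complex_of_real 1 * t)) (at_left 1)"
        unfolding S_def by (intro tendsto_intros)
      hence ev: "\<forall>\<^sub>F r in at_left 1. dist (S N (complex_of_real r * t)) (S N (complex_of_real 1 * t)) < e / 4"
        by (rule tendstoD) (use \<open>e > 0\<close> in auto)
      have ev2: "\<forall>\<^sub>F r in at_left 1. (r::real) \<in> {0..<1}" by (rule eventually_at_leftI[of 0]) auto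
      define P where "P r \<longleftrightarrow> dist (S N (complex_of_real r * t)) (S N (complex_of_real 1 * t)) < e / 4 \<and> r \<in> {0..<1}" for r
      have "dist (f (complex_of_real r * t)) (f (complex_of_real r' * t)) < e" if "P r" "P r'" for r r'
      proof -
        have "dist (S N (complex_of_real r * t)) (S N (complex_of_real r' * t)) < e / 2"
          by (rule dist_triangle_half_l[where y="S N (complex_of_real 1 * t)"]) (use that in \<open>auto simp: P_def dist_commute\<close>)
        moreover have "dist (f (complex_of_real r * t)) (S N (complex_of_real r * t)) < e / 4"
          "dist (f (complex_of_real r' * t)) (S N (complex_of_real r' * t)) < e / 4"
          using cl that by (auto simp: P_def dist_norm)
        moreover have "dist (S N (complex_of_real r * t)) (f (complex_of_real r' * t)) \<le>
            dist (S N (complex_of_real r * t)) (S N (complex_of_real r' * t)) +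
            dist (f (complex_of_real r' * t)) (S N (complex_of_real r' * t))"
          by (rule dist_triangle2)
        ultimately show ?thesis
          using dist_triangle[of "f (complex_of_real r * t)" "f (complex_of_real r' * t)" "S N (complex_of_real r * t)"]
          by linarith
      qed
      moreover have "eventually P (at_left 1)" unfolding P_def using ev ev2 by (rule eventually_conj)
      ultimately show "\<exists>P. eventually P (at_left 1) \<and>
          (\<forall>x y. P x \<and> P y \<longrightarrow> dist (f (complex_of_real x * t)) (f (complex_of_real y * t)) < e)"
        by blast
    qed
    moreover have "F \<noteq> bot" by (simp add: F_def filtermap_bot_iff trivial_limit_at_left_real)
    ultimately obtain l where "F \<le> nhds l"
      using complete_uniform[of "UNIV :: complex set"] complete_UNIV by auto
    thus "\<exists>l. ((\<lambda>r. f (complex_of_real r * t)) \<longlongrightarrow> l) (at_left 1)"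
      unfolding F_def filterlim_def by blast
  qed
qed

section \<open>Functions of bounded characteristic\<close>

text \<open>Together with \<open>Re_mult_Re\<close> this closes the real parts of polynomials under
  multiplication. On the circle \<open>t * cnj t = 1\<close> cancels the common factor of the two
  higher parts, and conjugating a term does not change its real part, so no conjugated powers
  survive the recursion.\<close>

lemma Re_poly_mult_circle:
  "\<exists>r. \<forall>t\<in>sphere 0 1. Re (poly p t * cnj (poly q t)) = Re (poly r t)"
proof (induction p arbitrary: q)
  case 0
  show ?case by (rule exI[of _ 0]) simp
next
  case (pCons a p)
  obtain b q' where q: "q = pCons b q'" by (cases q)
  obtain r where r: "\<And>t. t \<in> sphere 0 1 \<Longrightarrow> Re (poly p t * cnj (poly q' t)) = Re (poly r t)"
    using pCons.IH by blast
  show ?case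
  proof (intro exI ballI)
    fix t :: complex assume t: "t \<in> sphere 0 1"
    hence "t * cnj t = 1" by (simp add: complex_norm_square[symmetric])
    hence tt: "t * (cnj t * z) = z" for z by (simp add: mult.assoc[symmetric])
    have "Re (a * cnj (poly q t)) = Re (cnj a * poly q t)" by simp
    moreover have "poly (pCons a p) t * cnj (poly q t) =
        a * cnj (poly q t) + cnj b * t * poly p t + poly p t * cnj (poly q' t)"
      by (simp add: q algebra_simps tt)
    ultimately show "Re (poly (pCons a p) t * cnj (poly q t)) =
        Re (poly (smult (cnj a) q + smult (cnj b) (pCons 0 p) + r) t)"
      using r[OF t] by (simp add: algebra_simps)
  qed
qed

lemma Re_mult_Re: "Re x * Re y = (Re (x * y) + Re (x * cnj y)) / 2"
  by (simp add: algebra_simps)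

text \<open>Stone-Weierstrass for trigonometric polynomials, written as real parts of polynomials so
  that the approximant comes with a holomorphic extension to the disc.\<close>

lemma circle_Re_poly_dense:
  fixes u :: "complex \<Rightarrow> real"
  assumes "continuous_on (sphere 0 1) u" "e > 0"
  obtains p where "\<And>t. t \<in> sphere 0 1 \<Longrightarrow> \<bar>u t - Re (poly p t)\<bar> < e"
proof -
  define P where "P = (\<lambda>f::complex\<Rightarrow>real. \<exists>p. \<forall>t\<in>sphere 0 1. f t = Re (poly p t))"
  have "\<exists>g. P g \<and> (\<forall>t\<in>sphere 0 1. \<bar>u t - g t\<bar> < e)"
  proof (rule Stone_Weierstrass_HOL)
    show "P (\<lambda>x. c)" for c
      unfolding P_def by (rule exI[of _ "[:complex_of_real c:]"]) simp
    show "continuous_on (sphere 0 1) f" if Pf: "P f" for f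
    proof -
      obtain p where p: "\<forall>t\<in>sphere 0 1. f t = Re (poly p t)" using Pf unfolding P_def by blast
      have "continuous_on (sphere 0 1) (\<lambda>t. Re (poly p t))" by (intro continuous_intros)
      thus ?thesis using p by (subst continuous_on_cong[OF refl]) auto
    qed
    show "P (\<lambda>x. f x + g x)" if Pf: "P f \<and> P g" for f g
    proof -
      obtain p q where "\<forall>t\<in>sphere 0 1. f t = Re (poly p t)" "\<forall>t\<in>sphere 0 1. g t = Re (poly q t)"
        using Pf unfolding P_def by blast
      thus ?thesis unfolding P_def by (intro exI[of _ "p + q"]) simp
    qed
    show "P (\<lambda>x. f x * g x)" if Pf: "P f \<and> P g" for f g
    proof -
      obtain p q where pq: "\<forall>t\<in>sphere 0 1. f t = Re (poly p t)" "\<forall>t\<in>sphere 0 1. g t = Re (poly q t)"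
        using Pf unfolding P_def by blast
      obtain r where "\<forall>t\<in>sphere 0 1. Re (poly p t * cnj (poly q t)) = Re (poly r t)"
        using Re_poly_mult_circle by blast
      hence "f t * g t = Re (poly (smult (1/2) (p * q + r)) t)" if "t \<in> sphere 0 1" for t
        using pq that Re_mult_Re[of "poly p t" "poly q t"] by (simp del: times_complex.sel)
      thus ?thesis unfolding P_def by blast
    qed
    show "\<exists>f. P f \<and> f x \<noteq> f y" if "x \<in> sphere 0 1 \<and> y \<in> sphere 0 1 \<and> x \<noteq> y" for x y
    proof (cases "Re x = Re y")
      case True
      hence "Im x \<noteq> Im y" using that complex_eq_iff by blast
      moreover have "P Im" unfolding P_def by (rule exI[of _ "[:0, -\<i>:]"]) simp
      ultimately show ?thesis by blast
    next
      case False
      moreover have "P Re" unfolding P_def by (rule exI[of _ "[:0, 1:]"]) simp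
      ultimately show ?thesis by blast
    qed
  qed (use assms in auto)
  then obtain g where g: "P g" "\<And>t. t \<in> sphere 0 1 \<Longrightarrow> \<bar>u t - g t\<bar> < e" by blast
  then obtain p where p: "\<forall>t\<in>sphere 0 1. g t = Re (poly p t)" unfolding P_def by blast
  show ?thesis by (rule that[of p]) (use g p in auto)
qed

lemma ln_plus_altdef: "0 \<le> x \<Longrightarrow> ln_plus x = ln (max 1 x)"
  by (cases "x = 0"; cases "x \<ge> 1") (auto simp: ln_plus_def max_def intro: antisym)

lemma ln_plus_mono: "0 \<le> x \<Longrightarrow> x \<le> y \<Longrightarrow> ln_plus x \<le> ln_plus y"
  by (simp add: ln_plus_altdef)

lemma continuous_on_ln_plus [continuous_intros]:
  assumes "continuous_on A f" "\<And>x. x \<in> A \<Longrightarrow> 0 \<le> f x"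
  shows "continuous_on A (\<lambda>x. ln_plus (f x))"
proof -
  have "continuous_on A (\<lambda>x. ln (max 1 (f x)))"
    using assms(1) by (intro continuous_intros) (auto simp: max_def)
  thus ?thesis using assms(2) by (simp add: ln_plus_altdef cong: continuous_on_cong)
qed

lemma ball_max_modulus:
  assumes "g holomorphic_on ball 0 R" "R > 1" "\<And>t. norm t = 1 \<Longrightarrow> norm (g t) \<le> B" "norm z < 1"
  shows "norm (g z) \<le> B"
proof (rule maximum_modulus_frontier[where S="ball 0 1" and f=g and \<xi>=z])
  show "g holomorphic_on interior (ball 0 1)"
    using assms(2) by (auto intro: holomorphic_on_subset[OF assms(1)])
  show "continuous_on (closure (ball 0 1)) g"
    using assms(2) by (auto intro: continuous_on_subset[OF holomorphic_on_imp_continuous_on[OF assms(1)]])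
qed (use assms in auto)

text \<open>The denominator is a limit of functions \<open>exp (- p)\<close>, where \<open>Re p\<close> is a polynomial
  approximation from above of \<open>ln_plus \<bar>f\<bar>\<close> on a circle of radius close to \<open>1\<close>.\<close>

theorem bounded_characteristic_quotient:
  assumes f: "f holomorphic_on ball 0 1"
    and C: "\<And>r. r \<in> {0..<1} \<Longrightarrow> (LINT t|circle_measure. ln_plus (norm (f (complex_of_real r * t)))) \<le> C"
  obtains g h where "g holomorphic_on ball 0 1" "h holomorphic_on ball 0 1"
    "\<And>z. z \<in> ball 0 1 \<Longrightarrow> norm (g z) \<le> 1" "\<And>z. z \<in> ball 0 1 \<Longrightarrow> norm (h z) \<le> 1"
    "\<And>z. z \<in> ball 0 1 \<Longrightarrow> h z \<noteq> 0" "\<And>z. z \<in> ball 0 1 \<Longrightarrow> f z * h z = g z"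
proof -
  define s where "s k = 1 - 1 / (real k + 2)" for k :: nat
  have s: "0 < s k" "s k < 1" for k by (auto simp: s_def field_simps)
  have slim: "s \<longlonglongrightarrow> 1" unfolding s_def by real_asymp
  define u where "u k t = ln_plus (norm (f (complex_of_real (s k) * t)))" for k t
  have uc: "continuous_on (sphere 0 1) (u k)" for k
    unfolding u_def using s[of k] by (intro continuous_intros continuous_on_dilate f) auto
  have u0: "u k t \<ge> 0" for k t by (simp add: u_def ln_plus_def)
  \<comment> \<open>The target is shifted by 1 so that \<open>Re (poly p t)\<close> lies between
    \<open>u k t\<close> and \<open>u k t + 2\<close>: the lower bound gives
    \<open>norm (h k t) \<le> exp (- u k t)\<close>, the upper one keeps \<open>h k 0\<close> away
    from 0.\<close>
  have "\<exists>p. \<forall>t\<in>sphere 0 1. \<bar>u k t + 1 - Re (poly p t)\<bar> < 1" for k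
  proof -
    have c: "continuous_on (sphere 0 1) (\<lambda>t. u k t + 1)" by (intro continuous_intros uc)
    obtain p where "\<And>t. t \<in> sphere 0 1 \<Longrightarrow> \<bar>u k t + 1 - Re (poly p t)\<bar> < 1"
      by (rule circle_Re_poly_dense[OF c zero_less_one]) blast
    thus ?thesis by blast
  qed
  then obtain p where p: "\<And>k t. t \<in> sphere 0 1 \<Longrightarrow> \<bar>u k t + 1 - Re (poly (p k) t)\<bar> < 1" by metis
  define h where "h k z = exp (- poly (p k) z)" for k z
  have hh: "h k holomorphic_on A" for k A unfolding h_def by (intro holomorphic_intros)
  have hn: "norm (h k t) \<le> exp (- u k t)" if "norm t = 1" for k t
    using p[of t k] that by (simp add: h_def)
  have h1: "norm (h k z) \<le> 1" if "norm z < 1" for k z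
  proof (rule ball_max_modulus[where R=2 and g="h k", OF hh _ _ that])
    fix t :: complex assume "norm t = 1"
    from order_trans[OF hn[OF this]] show "norm (h k t) \<le> 1" using u0[of k t] by simp
  qed auto
  have fh: "norm (f (complex_of_real (s k) * z) * h k z) \<le> 1" if "norm z < 1" for k z
  proof -
    obtain R where R: "R > 1" "(\<lambda>z. f (complex_of_real (s k) * z)) holomorphic_on ball 0 R"
      using holomorphic_dilate[OF f, of "s k"] s[of k] by (metis less_imp_le)
    show ?thesis
    proof (rule ball_max_modulus[OF _ R(1) _ that])
      show "(\<lambda>z. f (complex_of_real (s k) * z) * h k z) holomorphic_on ball 0 R"
        by (intro holomorphic_intros R hh)
      fix t :: complex assume t: "norm t = 1"
      have "norm (f (complex_of_real (s k) * t)) \<le> exp (u k t)"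
        by (simp add: u_def ln_plus_altdef)
      hence "norm (f (complex_of_real (s k) * t) * h k t) \<le> exp (u k t) * exp (- u k t)"
        unfolding norm_mult by (intro mult_mono hn t) auto
      thus "norm (f (complex_of_real (s k) * t) * h k t) \<le> 1" by (simp add: exp_minus)
    qed
  qed
  have h0: "norm (h k 0) \<ge> exp (- (C + 2))" for k
  proof -
    have "Re (poly (p k) 0) = Re (LINT t|circle_measure. poly (p k) t)"
      by (subst circle_mean_value[of _ 2]) (auto intro!: holomorphic_intros)
    also have "\<dots> = (LINT t|circle_measure. Re (poly (p k) t))"
      by (intro integral_Re[symmetric] circle_integrable_continuous continuous_intros)
    also have "\<dots> \<le> (LINT t|circle_measure. u k t + 2)"
    proof (rule integral_mono)
      show "Re (poly (p k) t) \<le> u k t + 2" if "t \<in> space circle_measure" for t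
        using p[of t k] that by auto
    qed (intro circle_integrable_continuous continuous_intros uc)+
    also have "\<dots> = (LINT t|circle_measure. u k t) + 2"
      using circle.prob_space
      by (subst Bochner_Integration.integral_add) (auto intro!: circle_integrable_continuous uc)
    also have "\<dots> \<le> C + 2" using C[of "s k"] s[of k] by (simp add: u_def)
    finally show ?thesis by (simp add: h_def)
  qed
  define H where "H = {h. h holomorphic_on ball 0 1 \<and> (\<forall>z\<in>ball 0 1. norm (h z) \<le> (1::real))}"
  obtain g r where gr: "g holomorphic_on ball 0 1" "strict_mono (r :: nat \<Rightarrow> nat)"
    "\<And>x. x \<in> ball 0 1 \<Longrightarrow> (\<lambda>n. h (r n) x) \<longlonglongrightarrow> g x"
    "\<And>K. \<lbrakk>compact K; K \<subseteq> ball 0 1\<rbrakk> \<Longrightarrow> uniform_limit K (h \<circ> r) g sequentially"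
  proof (rule Montel[of "ball 0 1" H h])
    show "range h \<subseteq> H" unfolding H_def using hh h1 by auto
    show "\<exists>B. \<forall>h\<in>H. \<forall>z\<in>K. norm (h z) \<le> B" if "K \<subseteq> ball 0 1" for K
      using that unfolding H_def by (intro exI[of _ 1]) auto
  qed (auto simp: H_def)
  have g1: "norm (g z) \<le> 1" if "z \<in> ball 0 1" for z
    by (rule Lim_bounded[OF tendsto_norm[OF gr(3)[OF that]], of 0]) (use h1 that in auto)
  have g0: "g 0 \<noteq> 0"
  proof -
    have "exp (- (C + 2)) \<le> norm (g 0)"
      by (rule LIMSEQ_le_const[OF tendsto_norm[OF gr(3)]]) (use h0 in auto)
    thus ?thesis by auto
  qed
  \<comment> \<open>Each \<open>h k\<close> is an exponential. By Hurwitz a locally uniform limit of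
    zero-free functions is zero-free or constant, and a constant limit is nonzero because of the
    bound at 0.\<close>
  have gnz: "g z \<noteq> 0" if z: "z \<in> ball 0 1" for z
  proof (cases "g constant_on ball 0 1")
    case True
    hence "g z = g 0" using z unfolding constant_on_def by auto
    thus ?thesis using g0 by simp
  next
    case False
    show ?thesis
      by (rule Hurwitz_no_zeros[of "ball 0 1" "h \<circ> r", OF _ _ _ gr(1) gr(4) False _ z])
        (use hh in \<open>auto simp: h_def\<close>)
  qed
  have fg: "norm (f z * g z) \<le> 1" if z: "z \<in> ball 0 1" for z
  proof -
    have "isCont f z"
      using holomorphic_on_imp_continuous_on[OF f] z by (simp add: continuous_on_eq_continuous_at)
    moreover have "(\<lambda>n. complex_of_real (s (r n)) * z) \<longlonglongrightarrow> z"
    proof -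
      have "(\<lambda>n. complex_of_real (s (r n)) * z) \<longlonglongrightarrow> complex_of_real 1 * z"
        by (intro tendsto_intros LIMSEQ_subseq_LIMSEQ[OF slim gr(2), unfolded o_def])
      thus ?thesis by simp
    qed
    ultimately have "(\<lambda>n. f (complex_of_real (s (r n)) * z)) \<longlonglongrightarrow> f z"
      by (rule isCont_tendsto_compose)
    from tendsto_norm[OF tendsto_mult[OF this gr(3)[OF z]]] show ?thesis
      by (rule Lim_bounded[of _ _ 0]) (use fh z in auto)
  qed
  show ?thesis
    by (rule that[of "\<lambda>z. f z * g z" g]) (use f gr(1) fg g1 gnz in \<open>auto intro!: holomorphic_intros\<close>)
qed

text \<open>The functions \<open>- ln (norm h)\<close> are nonnegative with the same finite mean on
  every circle. A radial limit 0 would make their limit infinite, which Fatou's lemma permits on a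
  null set only.\<close>

lemma AE_radial_limit_nonzero:
  assumes h: "h holomorphic_on ball 0 1" and h1: "\<And>z. z \<in> ball 0 1 \<Longrightarrow> norm (h z) \<le> 1"
    and nz: "\<And>z. z \<in> ball 0 1 \<Longrightarrow> h z \<noteq> 0"
  shows "AE t in circle_measure. \<not> ((\<lambda>r. h (complex_of_real r * t)) \<longlongrightarrow> 0) (at_left 1)"
proof -
  define s where "s k = 1 - 1 / (real k + 2)" for k :: nat
  have s: "0 < s k" "s k < 1" for k by (auto simp: s_def field_simps)
  have slim: "filterlim s (at_left 1) sequentially" unfolding s_def by real_asymp
  define u where "u k t = - ln (norm (h (complex_of_real (s k) * t)))" for k t
  have inb: "complex_of_real (s k) * t \<in> ball 0 1" if "norm t = 1" for k t
    using s[of k] that by (simp add: norm_mult)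
  have um: "u k \<in> borel_measurable circle_measure" for k
    unfolding u_def using s[of k] nz[OF inb]
    by (intro circle_borel_measurable_continuous continuous_intros continuous_on_dilate h) auto
  have "(\<integral>\<^sup>+ t. ennreal (u k t) \<partial>circle_measure) = ennreal (- ln (norm (h 0)))" for k
  proof -
    have 1: "(LINT t|circle_measure. u k t) = - ln (norm (h 0))" "integrable circle_measure (u k)"
      unfolding u_def using ln_norm_mean_value_dilate[OF h, of "s k"] s[of k] nz by auto
    show ?thesis
      unfolding 1(1)[symmetric] using 1(2)
    proof (rule nn_integral_eq_integral)
      show "AE t in circle_measure. 0 \<le> u k t"
        using h1[OF inb] nz[OF inb] by (intro AE_I2) (simp add: u_def)
    qed
  qed
  hence "(\<integral>\<^sup>+ t. liminf (\<lambda>k. ennreal (u k t)) \<partial>circle_measure) \<le> ennreal (- ln (norm (h 0)))"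
    using nn_integral_liminf[of "\<lambda>k t. ennreal (u k t)" circle_measure] um by (simp add: Liminf_const)
  hence "(\<integral>\<^sup>+ t. liminf (\<lambda>k. ennreal (u k t)) \<partial>circle_measure) \<noteq> \<infinity>"
    by (auto simp: top_unique)
  hence "AE t in circle_measure. liminf (\<lambda>k. ennreal (u k t)) \<noteq> \<infinity>"
    using um by (intro nn_integral_PInf_AE) auto
  moreover have "AE t in circle_measure. t \<in> sphere 0 1" by (rule AE_I2) simp
  ultimately show ?thesis
  proof eventually_elim
    fix t assume t: "liminf (\<lambda>k. ennreal (u k t)) \<noteq> \<infinity>" "t \<in> sphere 0 1"
    show "\<not> ((\<lambda>r. h (complex_of_real r * t)) \<longlongrightarrow> 0) (at_left 1)"
    proof
      assume "((\<lambda>r. h (complex_of_real r * t)) \<longlongrightarrow> 0) (at_left 1)"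
      from filterlim_compose[OF this slim] have "(\<lambda>k. norm (h (complex_of_real (s k) * t))) \<longlonglongrightarrow> 0"
        by (rule tendsto_norm_zero)
      hence "filterlim (\<lambda>k. norm (h (complex_of_real (s k) * t))) (at_right 0) sequentially"
        using nz[OF inb] t(2) by (intro tendsto_imp_filterlim_at_right) auto
      hence "filterlim (\<lambda>k. ln (norm (h (complex_of_real (s k) * t)))) at_bot sequentially"
        by (rule filterlim_compose[OF ln_at_0])
      hence "filterlim (\<lambda>k. u k t) at_top sequentially"
        unfolding u_def by (simp add: filterlim_uminus_at_top)
      hence "(\<lambda>k. ennreal (u k t)) \<longlonglongrightarrow> top" by (simp add: ennreal_tendsto_top_eq_at_top)
      hence "liminf (\<lambda>k. ennreal (u k t)) = top" by (intro lim_imp_Liminf) auto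
      thus False using t(1) by simp
    qed
  qed
qed

theorem nevanlinna_radial_limits:
  assumes f: "f holomorphic_on ball 0 1"
    and C: "\<And>r. r \<in> {0..<1} \<Longrightarrow> (LINT t|circle_measure. ln_plus (norm (f (complex_of_real r * t)))) \<le> C"
  shows "AE t in circle_measure. \<exists>l. ((\<lambda>r. f (complex_of_real r * t)) \<longlongrightarrow> l) (at_left 1)"
proof -
  obtain g h where gh: "g holomorphic_on ball 0 1" "h holomorphic_on ball 0 1"
    "\<And>z. z \<in> ball 0 1 \<Longrightarrow> norm (g z) \<le> 1" "\<And>z. z \<in> ball 0 1 \<Longrightarrow> norm (h z) \<le> 1"
    "\<And>z. z \<in> ball 0 1 \<Longrightarrow> h z \<noteq> 0" "\<And>z. z \<in> ball 0 1 \<Longrightarrow> f z * h z = g z"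
    by (rule bounded_characteristic_quotient[OF f], erule C) (rule that; assumption)
  have "AE t in circle_measure. \<exists>l. ((\<lambda>r. g (complex_of_real r * t)) \<longlongrightarrow> l) (at_left 1)"
    by (rule fatou_radial_limits[OF gh(1)]) (rule gh(3))
  moreover have "AE t in circle_measure. \<exists>l. ((\<lambda>r. h (complex_of_real r * t)) \<longlongrightarrow> l) (at_left 1)"
    by (rule fatou_radial_limits[OF gh(2)]) (rule gh(4))
  moreover have "AE t in circle_measure. \<not> ((\<lambda>r. h (complex_of_real r * t)) \<longlongrightarrow> 0) (at_left 1)"
    by (rule AE_radial_limit_nonzero[OF gh(2)]) (fact gh(4) gh(5))+
  moreover have "AE t in circle_measure. t \<in> sphere 0 1" by (rule AE_I2) simp
  ultimately show ?thesis
  proof eventually_elim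
    case (elim t)
    then obtain l m where l: "((\<lambda>r. g (complex_of_real r * t)) \<longlongrightarrow> l) (at_left 1)"
      and m: "((\<lambda>r. h (complex_of_real r * t)) \<longlongrightarrow> m) (at_left 1)" "m \<noteq> 0" by blast
    have "((\<lambda>r. g (complex_of_real r * t) / h (complex_of_real r * t)) \<longlongrightarrow> l / m) (at_left 1)"
      by (intro tendsto_divide l m)
    moreover have "\<forall>\<^sub>F r in at_left 1. (r::real) \<in> {0<..<1}" by (rule eventually_at_leftI[of 0]) auto
    hence "\<forall>\<^sub>F r in at_left 1. g (complex_of_real r * t) / h (complex_of_real r * t) = f (complex_of_real r * t)"
    proof eventually_elim
      fix r :: real assume "r \<in> {0<..<1}"
      hence "complex_of_real r * t \<in> ball 0 1" using elim(4) by (simp add: norm_mult)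
      from gh(5,6)[OF this] show "g (complex_of_real r * t) / h (complex_of_real r * t) = f (complex_of_real r * t)"
        by (simp add: field_simps)
    qed
    ultimately have "((\<lambda>r. f (complex_of_real r * t)) \<longlongrightarrow> l / m) (at_left 1)"
      by (rule Lim_transform_eventually)
    thus ?case by blast
  qed
qed

section \<open>Boundary values of Smirnov functions\<close>

lemma sets_circle_measureI: "A \<in> sets borel \<Longrightarrow> A \<subseteq> sphere 0 1 \<Longrightarrow> A \<in> sets circle_measure"
  by (simp add: sets_restrict_space_iff)

lemma norm_entry_le_opnorm: "norm (A $ i $ j) \<le> opnorm A" for A :: "complex^'n^'n"
proof -
  have "A $ i $ j = (A *v axis j 1) $ i" 
    by (simp add: matrix_vector_mult_def axis_def if_distrib[of "\<lambda>x. _ * x"] cong: if_cong)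
  hence "norm (A $ i $ j) \<le> norm (A *v axis j 1)" by (simp add: Finite_Cartesian_Product.norm_nth_le)
  also have "\<dots> \<le> onorm ((*v) A) * norm (axis j (1::complex))"
    by (rule onorm) (rule matrix_vector_mul_bounded_linear)
  finally show ?thesis by (simp add: opnorm_def)
qed

lemma norm_matrix_vector_le:
  "norm (A *v x) \<le> (\<Sum>i\<in>UNIV. \<Sum>j\<in>UNIV. norm (A $ i $ j)) * norm x" for A :: "complex^'n^'n"
proof -
  have "norm (A *v x) \<le> (\<Sum>i\<in>UNIV. norm ((A *v x) $ i))"
    unfolding norm_vec_def by (rule L2_set_le_sum) auto
  also have "\<dots> \<le> (\<Sum>i\<in>UNIV. \<Sum>j\<in>UNIV. norm (A $ i $ j) * norm x)"
    unfolding matrix_vector_mult_def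
    by (intro sum_mono, simp, intro order_trans[OF norm_sum] sum_mono)
      (auto simp: norm_mult intro!: mult_left_mono Finite_Cartesian_Product.norm_nth_le)
  finally show ?thesis by (simp add: sum_distrib_right)
qed

lemma opnorm_diff_le:
  "\<bar>opnorm A - opnorm B\<bar> \<le> (\<Sum>i\<in>UNIV. \<Sum>j\<in>UNIV. norm (A $ i $ j - B $ i $ j))" for A B :: "complex^'n^'n"
proof -
  have le: "opnorm A \<le> opnorm B + (\<Sum>i\<in>UNIV. \<Sum>j\<in>UNIV. norm (A $ i $ j - B $ i $ j))" for A B :: "complex^'n^'n"
  proof -
    have "opnorm A = onorm (\<lambda>v. B *v v + (A - B) *v v)"
      by (simp add: opnorm_def matrix_vector_mult_diff_rdistrib)
    also have "\<dots> \<le> opnorm B + onorm ((*v) (A - B))"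
      unfolding opnorm_def by (rule onorm_triangle) simp_all
    also have "onorm ((*v) (A - B)) \<le> (\<Sum>i\<in>UNIV. \<Sum>j\<in>UNIV. norm ((A - B) $ i $ j))"
      by (rule onorm_le) (rule norm_matrix_vector_le)
    finally show ?thesis by simp
  qed
  from le[of A B] le[of B A] show ?thesis by (simp add: norm_minus_commute abs_le_iff)
qed

lemma continuous_on_opnorm:
  fixes G :: "'a::topological_space \<Rightarrow> complex^'n^'n"
  assumes "\<And>i j. continuous_on S (\<lambda>t. G t $ i $ j)"
  shows "continuous_on S (\<lambda>t. opnorm (G t))"
  unfolding continuous_on_def
proof
  fix x assume "x \<in> S"
  have "((\<lambda>t. \<Sum>i\<in>UNIV. \<Sum>j\<in>UNIV. norm (G t $ i $ j - G x $ i $ j)) \<longlongrightarrow>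
      (\<Sum>i\<in>UNIV. \<Sum>j\<in>UNIV. norm (G x $ i $ j - G x $ i $ j))) (at x within S)"
    using assms \<open>x \<in> S\<close>
    by (intro tendsto_sum tendsto_norm tendsto_diff tendsto_const) (simp add: continuous_on_def)
  hence lim: "((\<lambda>t. \<Sum>i\<in>UNIV. \<Sum>j\<in>UNIV. norm (G t $ i $ j - G x $ i $ j)) \<longlongrightarrow> 0) (at x within S)"
    by simp
  have "\<forall>\<^sub>F t in at x within S. norm (opnorm (G t) - opnorm (G x)) \<le>
      (\<Sum>i\<in>UNIV. \<Sum>j\<in>UNIV. norm (G t $ i $ j - G x $ i $ j))"
    by (rule always_eventually, rule allI, simp only: real_norm_def, rule opnorm_diff_le)
  from Lim_null_comparison[OF this lim]
  have "((\<lambda>t. opnorm (G t) - opnorm (G x)) \<longlongrightarrow> 0) (at x within S)" .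
  thus "((\<lambda>t. opnorm (G t)) \<longlongrightarrow> opnorm (G x)) (at x within S)"
    by (rule Lim_null[THEN iffD2])
qed

lemma opnorm_nonneg: "opnorm A \<ge> 0" for A :: "complex^'n^'n"
  unfolding opnorm_def by (rule onorm_pos_le) simp

lemma circle_arc:
  assumes "0 \<le> a" "a \<le> b" "b \<le> 2 * pi"
  shows "cis ` {a..b} \<in> sets borel" "measure circle_measure (cis ` {a..b}) \<le> (b - a) / (2 * pi)"
proof -
  have "compact (cis ` {a..b})" by (intro compact_continuous_image continuous_intros) auto
  thus B: "cis ` {a..b} \<in> sets borel" by (rule borel_compact)
  have A: "cis ` {a..b} \<in> sets circle_measure" using B by (rule sets_circle_measureI) auto
  \<comment> \<open>The parameters 0 and \<open>2 * pi\<close> give the same point, so one of them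
    may be mapped into the arc without lying in \<open>{a..b}\<close>; these two points have measure
    0.\<close>
  have sub: "{x \<in> {0..2 * pi}. cis x \<in> cis ` {a..b}} \<subseteq> {a..b} \<union> {0, 2 * pi}"
  proof (rule subsetI, rule ccontr)
    fix x assume "x \<in> {x \<in> {0..2 * pi}. cis x \<in> cis ` {a..b}}"
      and n: "x \<notin> {a..b} \<union> {0, 2 * pi}"
    then obtain y where x: "0 \<le> x" "x \<le> 2 * pi" "cis x = cis y" "a \<le> y" "y \<le> b" by auto
    from x(3) obtain k :: int where k: "x = y + 2 * pi * k"
      using sin_cos_eq_iff[of x y] by (auto simp: cis.ctr)
    have "\<bar>2 * pi * k\<bar> < 2 * pi"
    proof -
      have "x \<noteq> 0" "x \<noteq> 2 * pi" using n by auto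
      thus ?thesis using k x assms by linarith
    qed
    hence "\<bar>real_of_int k\<bar> < 1" by (simp add: abs_mult)
    hence "k = 0" by linarith
    thus False using k n x by simp
  qed
  have "emeasure circle_measure (cis ` {a..b}) = (\<integral>\<^sup>+ t. indicator (cis ` {a..b}) t \<partial>circle_measure)"
    using A by simp
  also have "\<dots> = (\<integral>\<^sup>+ x. indicator (cis ` {a..b}) (cis x) * indicator {0..2 * pi} x \<partial>lborel) / ennreal (2 * pi)"
    by (intro nn_integral_circle borel_measurable_indicator A)
  also have "\<dots> \<le> (\<integral>\<^sup>+ x. indicator ({a..b} \<union> {0, 2 * pi}) x \<partial>lborel) / ennreal (2 * pi)"
  proof (intro divide_right_mono_ennreal nn_integral_mono)
    fix x show "indicator (cis ` {a..b}) (cis x) * indicator {0..2 * pi} x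
        \<le> (indicator ({a..b} \<union> {0, 2 * pi}) x :: ennreal)"
      using sub by (auto simp: indicator_def)
  qed
  also have "\<dots> = emeasure lborel ({a..b} \<union> {0, 2 * pi}) / ennreal (2 * pi)"
    by (subst nn_integral_indicator) auto
  also have "\<dots> \<le> (emeasure lborel {a..b} + emeasure lborel {0, 2 * pi}) / ennreal (2 * pi)"
    by (intro divide_right_mono_ennreal emeasure_subadditive) auto
  also have "\<dots> = ennreal ((b - a) / (2 * pi))"
    using assms by (subst divide_ennreal[symmetric]) (auto simp: emeasure_lborel_countable)
  finally show "measure circle_measure (cis ` {a..b}) \<le> (b - a) / (2 * pi)"
    using assms by (auto simp: circle.emeasure_eq_measure)
qed

lemma Smirnov_class_holomorphic:
  "F \<in> Smirnov_class \<Longrightarrow> (\<lambda>z. F z $ i $ j) holomorphic_on ball 0 1"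
  by (simp add: Smirnov_class_def matrix_holomorphic_on_def)

text \<open>Uniform integrability gives an absolute bound because the circle splits into finitely many arcs
  of small measure.\<close>

lemma Smirnov_class_bounded_characteristic:
  fixes F :: "complex \<Rightarrow> complex^'n^'n"
  assumes "F \<in> Smirnov_class"
  obtains C where "\<And>r. r \<in> {0..<1} \<Longrightarrow>
    (LINT t|circle_measure. ln_plus (opnorm (F (complex_of_real r * t)))) \<le> C"
proof -
  obtain \<delta> where \<delta>: "\<delta> > 0" "\<And>r \<Delta>. r \<in> {0..<1} \<Longrightarrow> \<Delta> \<in> sets borel \<Longrightarrow> \<Delta> \<subseteq> sphere 0 1 \<Longrightarrow>
      measure circle_measure \<Delta> < \<delta> \<Longrightarrow>
      (LINT t:\<Delta>|circle_measure. ln_plus (opnorm (F (complex_of_real r * t)))) < 1"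
    using assms unfolding Smirnov_class_def by (auto dest!: spec[of _ 1])
  obtain N :: nat where N: "1 / real (Suc N) < \<delta>" using nat_approx_posE[OF \<delta>(1)] by blast
  define M where "M = Suc N"
  have M: "M > 0" "1 / real M < \<delta>" using N by (auto simp: M_def)
  define A where "A k = cis ` {2 * pi * real k / real M..2 * pi * real (Suc k) / real M}" for k
  have A: "A k \<in> sets borel" "A k \<subseteq> sphere 0 1" "measure circle_measure (A k) < \<delta>" if "k < M" for k
  proof -
    have "real (Suc k) \<le> real M" using that by simp
    hence "2 * pi * (real (Suc k) / real M) \<le> 2 * pi * 1" using M by (intro mult_left_mono) auto
    hence "2 * pi * real (Suc k) / real M \<le> 2 * pi" by simp
    moreover have "2 * pi * real k / real M \<le> 2 * pi * real (Suc k) / real M"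
      by (intro divide_right_mono mult_left_mono) auto
    ultimately have "A k \<in> sets borel" "measure circle_measure (A k) \<le> (2 * pi * real (Suc k) / real M - 2 * pi * real k / real M) / (2 * pi)"
      unfolding A_def using circle_arc[of "2 * pi * real k / real M" "2 * pi * real (Suc k) / real M"] by auto
    moreover have "(2 * pi * real (Suc k) / real M - 2 * pi * real k / real M) / (2 * pi) = 1 / real M"
      using M by (simp add: field_simps)
    ultimately show "A k \<in> sets borel" "measure circle_measure (A k) < \<delta>" using M by auto
    show "A k \<subseteq> sphere 0 1" by (auto simp: A_def)
  qed
  have cover: "\<exists>k<M. t \<in> A k" if t: "t \<in> sphere 0 1" for t
  proof -
    define x where "x = Arg2pi t"
    have x: "0 \<le> x" "x < 2 * pi" "t = cis x"
      using Arg2pi[of t] t by (auto simp: x_def cis_conv_exp mult.commute is_Arg_def)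
    define k where "k = nat \<lfloor>x * real M / (2 * pi)\<rfloor>"
    have fl: "real k \<le> x * real M / (2 * pi)" "x * real M / (2 * pi) < real k + 1"
      using x(1) M unfolding k_def by (auto simp: of_nat_nat)
    have "x * real M / (2 * pi) < real M" using x(2) M by (simp add: field_simps)
    hence "real k < real M" using fl by linarith
    moreover have "2 * pi * real k / real M \<le> x" "x \<le> 2 * pi * real (Suc k) / real M"
      using fl M by (auto simp: field_simps)
    ultimately show ?thesis using x(3) unfolding A_def by (intro exI[of _ k]) auto
  qed
  show ?thesis
  proof (rule that)
    fix r :: real assume r: "r \<in> {0..<1}"
    define u where "u t = ln_plus (opnorm (F (complex_of_real r * t)))" for t
    have uc: "continuous_on (sphere 0 1) u"
      unfolding u_def using r
      by (intro continuous_intros continuous_on_opnorm continuous_on_dilate Smirnov_class_holomorphic[OF assms] opnorm_nonneg) auto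
    have u0: "u t \<ge> 0" for t by (simp add: u_def ln_plus_def)
    have ui: "integrable circle_measure u" by (rule circle_integrable_continuous[OF uc])
    have Am: "A k \<in> sets circle_measure" if "k < M" for k
      by (rule sets_circle_measureI) (rule A[OF that])+
    have uk: "integrable circle_measure (\<lambda>t. indicator (A k) t *\<^sub>R u t)" if "k < M" for k
      by (rule integrable_mult_indicator[OF Am[OF that] ui])
    have "(LINT t|circle_measure. u t) \<le> (LINT t|circle_measure. (\<Sum>k<M. indicator (A k) t *\<^sub>R u t))"
    proof (rule integral_mono[OF ui])
      show "integrable circle_measure (\<lambda>t. \<Sum>k<M. indicator (A k) t *\<^sub>R u t)"
        by (intro Bochner_Integration.integrable_sum uk) auto
      fix t assume "t \<in> space circle_measure"
      then obtain k where "k < M" "t \<in> A k" using cover by auto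
      hence "u t = (\<Sum>k\<in>{k}. indicator (A k) t *\<^sub>R u t)" by simp
      also have "\<dots> \<le> (\<Sum>k<M. indicator (A k) t *\<^sub>R u t)"
        using \<open>k < M\<close> u0 by (intro sum_mono2) auto
      finally show "u t \<le> (\<Sum>k<M. indicator (A k) t *\<^sub>R u t)" .
    qed
    also have "\<dots> = (\<Sum>k<M. (LINT t:A k|circle_measure. u t))"
      unfolding set_lebesgue_integral_def by (intro Bochner_Integration.integral_sum uk) auto
    also have "\<dots> \<le> (\<Sum>k<M. 1)"
      using A \<delta>(2)[OF r] unfolding u_def by (intro sum_mono less_imp_le) auto
    finally show "(LINT t|circle_measure. ln_plus (opnorm (F (complex_of_real r * t)))) \<le> real M"
      by (simp add: u_def)
  qed
qed

theorem Smirnov_class_boundary_value: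
  fixes F :: "complex \<Rightarrow> complex^'n^'n"
  assumes "F \<in> Smirnov_class"
  shows "AE t in circle_measure. has_boundary_value F t"
proof -
  obtain C where C: "\<And>r. r \<in> {0..<1} \<Longrightarrow>
    (LINT t|circle_measure. ln_plus (opnorm (F (complex_of_real r * t)))) \<le> C"
    using Smirnov_class_bounded_characteristic[OF assms] by blast
  have "AE t in circle_measure. \<exists>l. ((\<lambda>r. F (complex_of_real r * t) $ i $ j) \<longlongrightarrow> l) (at_left 1)" for i j
  proof (rule nevanlinna_radial_limits[OF Smirnov_class_holomorphic[OF assms]])
    fix r :: real assume r: "r \<in> {0..<1}"
    have "(LINT t|circle_measure. ln_plus (norm (F (complex_of_real r * t) $ i $ j)))
        \<le> (LINT t|circle_measure. ln_plus (opnorm (F (complex_of_real r * t))))"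
      using r by (intro integral_mono circle_integrable_continuous continuous_intros continuous_on_dilate
          continuous_on_opnorm Smirnov_class_holomorphic[OF assms] ln_plus_mono norm_entry_le_opnorm opnorm_nonneg) auto
    thus "(LINT t|circle_measure. ln_plus (norm (F (complex_of_real r * t) $ i $ j))) \<le> C"
      using C[OF r] by simp
  qed
  hence "AE t in circle_measure. \<forall>i j. \<exists>l. ((\<lambda>r. F (complex_of_real r * t) $ i $ j) \<longlongrightarrow> l) (at_left 1)"
    by (simp add: AE_all_countable)
  thus ?thesis
  proof eventually_elim
    fix t assume "\<forall>i j. \<exists>l. ((\<lambda>r. F (complex_of_real r * t) $ i $ j) \<longlongrightarrow> l) (at_left 1)"
    then obtain L where L: "\<And>i j. ((\<lambda>r. F (complex_of_real r * t) $ i $ j) \<longlongrightarrow> L i j) (at_left 1)"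
      by metis
    have "((\<lambda>r. F (complex_of_real r * t)) \<longlongrightarrow> (\<chi> i j. L i j)) (at_left 1)"
      by (intro vec_tendstoI) (simp add: L)
    hence "boundary_value F t = (\<chi> i j. L i j)" and "((\<lambda>r. F (complex_of_real r * t)) \<longlongrightarrow> (\<chi> i j. L i j)) (at_left 1)"
      unfolding boundary_value_def by (auto intro!: tendsto_Lim simp: trivial_limit_at_left_real)
    thus "has_boundary_value F t" unfolding has_boundary_value_def by simp
  qed
qed

lemma greaterThanLessThan_subset: "0 < a \<Longrightarrow> {a<..<b} \<subseteq> {0<..<b::real}"
  by auto

text \<open>The circle measure is not complete, so integrals over boundary values need genuine Borel
  measurability. Where the radial limit does not exist, \<^const>\<open>Lim\<close> returns one fixed junk value.\<close>

lemma boundary_value_measurable: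
  fixes F :: "complex \<Rightarrow> complex^'n^'n"
  assumes F: "\<And>i j. (\<lambda>z. F z $ i $ j) holomorphic_on ball 0 1"
  shows "boundary_value F \<in> borel_measurable circle_measure"
proof -
  define G where "G r t = F (complex_of_real r * t)" for r t
  have Fc: "continuous_on (ball 0 1) F"
  proof -
    have "continuous_on (ball 0 1) (\<lambda>z. \<chi> i j. F z $ i $ j)"
      by (intro continuous_on_vec_lambda holomorphic_on_imp_continuous_on F)
    thus ?thesis by simp
  qed
  have Gm [measurable]: "G r \<in> borel_measurable circle_measure" if "r \<in> {0<..<1}" for r
    unfolding G_def using that
    by (intro circle_borel_measurable_continuous continuous_on_compose2[OF Fc] continuous_intros)
      (auto simp: norm_mult)
  have Gc: "continuous_on {0<..<1} (\<lambda>r. G r t)" if "norm t = 1" for t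
    unfolding G_def using that
    by (intro continuous_on_compose2[OF Fc] continuous_intros) (auto simp: norm_mult)
  \<comment> \<open>Rational radii turn the Cauchy criterion for radial limits into countably many
    measurable conditions.\<close>
  define Q where "Q N = {q :: rat. of_rat q \<in> {1 - 1 / (real N + 2)<..<1}}" for N
  have Q: "of_rat q \<in> {0<..<1::real}" if "q \<in> Q N" for q N
  proof -
    have "1 / (real N + 2) < 1" by simp
    hence "0 < 1 - 1 / (real N + 2)" by linarith
    hence "{1 - 1 / (real N + 2)<..<1} \<subseteq> {0<..<1}" by (rule greaterThanLessThan_subset)
    thus ?thesis using that unfolding Q_def by blast
  qed
  define C where "C = {t \<in> space circle_measure. \<forall>j::nat. \<exists>N. \<forall>p\<in>Q N. \<forall>q\<in>Q N. dist (G (of_rat p) t) (G (of_rat q) t) \<le> 1 / (real j + 1)}"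
  have Cm: "C \<in> sets circle_measure"
  proof -
    have "Measurable.pred circle_measure (\<lambda>t. dist (G (of_rat p) t) (G (of_rat q) t) \<le> 1 / (real j + 1))"
      if "p \<in> Q N" "q \<in> Q N" for p q N j
      unfolding pred_def
      by (intro borel_measurable_le borel_measurable_dist Gm borel_measurable_const Q[OF that(1)] Q[OF that(2)])
    hence "Measurable.pred circle_measure
        (\<lambda>t. \<forall>j::nat. \<exists>N. \<forall>p\<in>Q N. \<forall>q\<in>Q N. dist (G (of_rat p) t) (G (of_rat q) t) \<le> 1 / (real j + 1))"
      by (intro pred_intros_countable pred_intros_countable_bounded)
    thus ?thesis unfolding C_def pred_def .
  qed
  have lim_iff: "(\<exists>l. ((\<lambda>r. G r t) \<longlongrightarrow> l) (at_left 1)) \<longleftrightarrow> t \<in> C" if t: "t \<in> sphere 0 1" for t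
  proof
    assume "\<exists>l. ((\<lambda>r. G r t) \<longlongrightarrow> l) (at_left 1)"
    then obtain l where l: "((\<lambda>r. G r t) \<longlongrightarrow> l) (at_left 1)" by blast
    show "t \<in> C" unfolding C_def
    proof (intro CollectI conjI allI)
      fix j :: nat
      define \<eta> where "\<eta> = 1 / (real j + 1)"
      have "\<forall>\<^sub>F r in at_left 1. dist (G r t) l < \<eta> / 2"
        by (rule tendstoD[OF l]) (simp add: \<eta>_def)
      then obtain b where b: "b < 1" "\<And>r. b < r \<Longrightarrow> r < 1 \<Longrightarrow> dist (G r t) l < \<eta> / 2"
        unfolding eventually_at_left_field by blast
      have "(\<lambda>N. 1 - 1 / (real N + 2)) \<longlonglongrightarrow> 1" by real_asymp
      from order_tendstoD(1)[OF this b(1)] obtain N where N: "b < 1 - 1 / (real N + 2)"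
        by (auto simp: eventually_sequentially)
      have "\<exists>N. \<forall>p\<in>Q N. \<forall>q\<in>Q N. dist (G (of_rat p) t) (G (of_rat q) t) \<le> \<eta>"
      proof (intro exI ballI)
        fix p q assume "p \<in> Q N" "q \<in> Q N"
        hence "dist (G (of_rat p) t) l < \<eta> / 2" "dist (G (of_rat q) t) l < \<eta> / 2"
          using b(2) N unfolding Q_def by auto
        moreover have "dist (G (of_rat p) t) (G (of_rat q) t) \<le> dist (G (of_rat p) t) l + dist (G (of_rat q) t) l" by (rule dist_triangle2)
        ultimately show "dist (G (of_rat p) t) (G (of_rat q) t) \<le> \<eta>" by linarith
      qed
      thus "\<exists>N. \<forall>p\<in>Q N. \<forall>q\<in>Q N. dist (G (of_rat p) t) (G (of_rat q) t) \<le> 1 / (real j + 1)"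
        unfolding \<eta>_def .
    qed (use t in simp)
  next
    assume tC: "t \<in> C"
    define S where "S = filtermap (\<lambda>r. G r t) (at_left 1)"
    have "cauchy_filter S" unfolding S_def cauchy_filter_metric_filtermap
    proof (intro allI impI)
      fix e :: real assume "e > 0"
      then obtain j where j: "1 / real (Suc j) < e / 3" using nat_approx_posE[of "e/3"] by auto
      obtain N where N: "\<And>p q. p \<in> Q N \<Longrightarrow> q \<in> Q N \<Longrightarrow> dist (G (of_rat p) t) (G (of_rat q) t) \<le> 1 / (real j + 1)"
        using tC unfolding C_def by blast
      define P where "P r \<longleftrightarrow> r \<in> {1 - 1 / (real N + 2)<..<1}" for r :: real
      \<comment> \<open>Continuity in the radius carries the criterion from rational radii back to
        all radii.\<close>
      have near: "\<exists>p\<in>Q N. dist (G (of_rat p) t) (G r t) < e / 3" if "P r" for r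
      proof -
        have "1 / (real N + 2) < 1" by simp
        hence "0 < 1 - 1 / (real N + 2)" by linarith
        hence "{1 - 1 / (real N + 2)<..<1} \<subseteq> {0<..<1}" by (rule greaterThanLessThan_subset)
        hence r01: "r \<in> {0<..<1}" using that unfolding P_def by blast
        have "isCont (\<lambda>r. G r t) r"
          using Gc[of t] t r01 by (simp add: continuous_on_eq_continuous_at)
        then obtain d where d: "d > 0" "\<And>x. dist x r < d \<Longrightarrow> dist (G x t) (G r t) < e / 3"
          using \<open>e > 0\<close> unfolding continuous_at_eps_delta dist_norm by (metis divide_pos_pos zero_less_numeral)
        obtain p where p: "r < of_rat p" "of_rat p < min (r + d) 1"
          using of_rat_dense[of r "min (r + d) 1"] r01 d(1) by auto
        hence "dist (G (of_rat p) t) (G r t) < e / 3" by (intro d(2)) (auto simp: dist_real_def)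
        moreover have "p \<in> Q N" using p that by (auto simp: Q_def P_def)
        ultimately show ?thesis by blast
      qed
      have "dist (G x t) (G y t) < e" if xy: "P x" "P y" for x y
      proof -
        obtain p q where pq: "p \<in> Q N" "q \<in> Q N" "dist (G (of_rat p) t) (G x t) < e / 3" "dist (G (of_rat q) t) (G y t) < e / 3"
          using near[OF xy(1)] near[OF xy(2)] by blast
        have "dist (G x t) (G y t) \<le> dist (G (of_rat p) t) (G x t) + dist (G (of_rat p) t) (G y t)" by (rule dist_triangle3)
        moreover have "dist (G (of_rat p) t) (G y t) \<le> dist (G (of_rat p) t) (G (of_rat q) t) + dist (G (of_rat q) t) (G y t)" by (rule dist_triangle)
        moreover have "dist (G (of_rat p) t) (G (of_rat q) t) < e / 3" using N[OF pq(1,2)] j by (simp add: add.commute)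
        ultimately show ?thesis using pq by linarith
      qed
      moreover have "eventually P (at_left 1)"
        unfolding P_def by (rule eventually_at_leftI[of "1 - 1 / (real N + 2)"]) auto
      ultimately show "\<exists>P. eventually P (at_left 1) \<and> (\<forall>x y. P x \<and> P y \<longrightarrow> dist (G x t) (G y t) < e)"
        by blast
    qed
    moreover have "S \<noteq> bot" by (simp add: S_def filtermap_bot_iff trivial_limit_at_left_real)
    ultimately obtain l where "S \<le> nhds l"
      using complete_uniform[of "UNIV :: (complex^'n^'n) set"] complete_UNIV by auto
    thus "\<exists>l. ((\<lambda>r. G r t) \<longlongrightarrow> l) (at_left 1)" unfolding S_def filterlim_def by blast
  qed
  define s where "s k = 1 - 1 / (real k + 2)" for k :: nat
  have s: "s k \<in> {0<..<1}" for k by (auto simp: s_def field_simps)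
  have slim: "filterlim s (at_left 1) sequentially" unfolding s_def by real_asymp
  have "boundary_value F t = (if t \<in> C then lim (\<lambda>k. G (s k) t) else (THE l. False))" if t: "t \<in> sphere 0 1" for t
  proof (cases "t \<in> C")
    case True
    then obtain l where l: "((\<lambda>r. G r t) \<longlongrightarrow> l) (at_left 1)" using lim_iff[OF t] by blast
    have "boundary_value F t = l"
      unfolding boundary_value_def using l unfolding G_def
      by (intro tendsto_Lim) (auto simp: trivial_limit_at_left_real)
    moreover have "lim (\<lambda>k. G (s k) t) = l" by (rule limI[OF filterlim_compose[OF l slim]])
    ultimately show ?thesis using True by simp
  next
    case False
    hence "\<not> ((\<lambda>r. G r t) \<longlongrightarrow> l) (at_left 1)" for l using lim_iff[OF t] by blast
    thus ?thesis using False unfolding boundary_value_def Topological_Spaces.Lim_def G_def by simp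
  qed
  moreover have "(\<lambda>t. if t \<in> C then lim (\<lambda>k. G (s k) t) else (THE l. False)) \<in> borel_measurable circle_measure"
    by (intro measurable_If_set borel_measurable_lim_metric Gm s borel_measurable_const sets.Int Cm sets.top)
  ultimately show ?thesis
    by (subst measurable_cong[where g="\<lambda>t. if t \<in> C then lim (\<lambda>k. G (s k) t) else (THE l. False)"]) auto
qed

section \<open>Boundary means of outer functions\<close>

definition poisson_integral :: "(complex \<Rightarrow> real) \<Rightarrow> complex \<Rightarrow> real" where
  "poisson_integral v z = (LINT s|circle_measure. poisson_kernel z s * v s)"

lemma poisson_kernel_integrable_mult:
  assumes v: "integrable circle_measure v" and z: "norm z < 1"
  shows "integrable circle_measure (\<lambda>s. poisson_kernel z s * v s)"
proof -
  have "bounded (poisson_kernel z ` sphere 0 1)"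
    by (intro compact_imp_bounded compact_continuous_image continuous_intros z) auto
  then obtain B where B: "\<And>s. s \<in> sphere 0 1 \<Longrightarrow> norm (poisson_kernel z s) \<le> B"
    unfolding bounded_iff by blast
  show ?thesis
  proof (rule Bochner_Integration.integrable_bound[of _ "\<lambda>s. B * v s"])
    show "(\<lambda>s. poisson_kernel z s * v s) \<in> borel_measurable circle_measure"
      by (rule borel_measurable_times[OF circle_borel_measurable_continuous[OF continuous_on_poisson_kernel[OF z]]
            borel_measurable_integrable[OF v]])
    show "AE s in circle_measure. norm (poisson_kernel z s * v s) \<le> norm (B * v s)"
    proof (rule AE_I2)
      fix s assume "s \<in> space circle_measure"
      hence "\<bar>poisson_kernel z s\<bar> \<le> B" using B[of s] by simp
      thus "norm (poisson_kernel z s * v s) \<le> norm (B * v s)"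
        by (auto simp: abs_mult intro!: mult_right_mono)
    qed
  qed (use v in auto)
qed

lemma poisson_integral_le_bound:
  assumes v: "integrable circle_measure v" and z: "norm z < 1"
    and K: "\<And>s. s \<in> sphere 0 1 \<Longrightarrow> \<bar>v s\<bar> \<le> K"
  shows "\<bar>poisson_integral v z\<bar> \<le> K"
proof -
  have "\<bar>poisson_integral v z\<bar> \<le> (LINT s|circle_measure. norm (poisson_kernel z s * v s))"
    unfolding poisson_integral_def by (simp add: integral_norm_bound[where 'a=real, unfolded real_norm_def])
  also have "\<dots> \<le> (LINT s|circle_measure. K * poisson_kernel z s)"
  proof (rule integral_mono)
    show "integrable circle_measure (\<lambda>s. norm (poisson_kernel z s * v s))"
      by (intro Bochner_Integration.integrable_norm poisson_kernel_integrable_mult v z)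
    show "integrable circle_measure (\<lambda>s. K * poisson_kernel z s)"
      by (intro circle_integrable_continuous continuous_intros z)
    show "norm (poisson_kernel z s * v s) \<le> K * poisson_kernel z s" if "s \<in> space circle_measure" for s
      using K[of s] that poisson_kernel_nonneg[OF z, of s]
      by (simp add: abs_mult mult.commute[of K] mult_left_mono)
  qed
  also have "\<dots> = K" by (simp add: integral_poisson_kernel[OF z])
  finally show ?thesis .
qed

text \<open>The two circle variables may be exchanged, so the kernel also has integral 1 in the
  variable that is not its usual integration variable.\<close>

lemma poisson_kernel_sym:
  assumes "norm s = 1" "norm t = 1"
  shows "poisson_kernel (complex_of_real r * t) s = poisson_kernel (complex_of_real r * s) t"
proof -
  have "(norm (s - complex_of_real r * t))\<^sup>2 = (norm (t - complex_of_real r * s))\<^sup>2"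
  proof -
    have "complex_of_real ((norm (s - complex_of_real r * t))\<^sup>2) = s * cnj s + complex_of_real r * complex_of_real r * (t * cnj t)
        - complex_of_real r * (s * cnj t + t * cnj s)"
      unfolding complex_norm_square by (simp add: algebra_simps)
    moreover have "complex_of_real ((norm (t - complex_of_real r * s))\<^sup>2) = t * cnj t + complex_of_real r * complex_of_real r * (s * cnj s)
        - complex_of_real r * (s * cnj t + t * cnj s)"
      unfolding complex_norm_square by (simp add: algebra_simps)
    moreover have "s * cnj s = 1" "t * cnj t = 1" using assms by (simp_all add: complex_norm_square[symmetric])
    ultimately show ?thesis by (metis of_real_eq_iff)
  qed
  thus ?thesis using assms by (simp add: poisson_kernel_def norm_mult)
qed

lemma id_circle_measurable [measurable]: "(\<lambda>t. t) \<in> circle_measure \<rightarrow>\<^sub>M borel"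
  by (rule circle_borel_measurableI) simp

lemma poisson_kernel_measurable [measurable (raw)]:
  assumes "f \<in> borel_measurable M" "g \<in> borel_measurable M"
  shows "(\<lambda>x. poisson_kernel (f x) (g x)) \<in> borel_measurable M"
  using assms unfolding poisson_kernel_def by measurable

lemma poisson_integral_measurable:
  assumes v: "integrable circle_measure v"
  shows "(\<lambda>t. poisson_integral v (complex_of_real r * t)) \<in> borel_measurable circle_measure"
proof -
  note [measurable] = borel_measurable_integrable[OF v]
  show ?thesis unfolding poisson_integral_def
    by (rule circle.borel_measurable_lebesgue_integral) measurable
qed

interpretation circle_pair: pair_prob_space circle_measure circle_measure ..

text \<open>Tonelli's theorem moves the integration over \<open>t\<close> inside, where the
  symmetric kernel integrates to 1.\<close>

lemma poisson_integral_contraction: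
  assumes v: "integrable circle_measure v" and r: "0 \<le> r" "r < 1"
  shows "(\<integral>\<^sup>+ t. ennreal \<bar>poisson_integral v (complex_of_real r * t)\<bar> \<partial>circle_measure)
    \<le> ennreal (LINT s|circle_measure. \<bar>v s\<bar>)"
proof -
  note [measurable] = borel_measurable_integrable[OF v]
  have rt: "norm (complex_of_real r * t) < 1" if "t \<in> space circle_measure" for t
    using r that by (simp add: norm_mult)
  have "(\<integral>\<^sup>+ t. ennreal \<bar>poisson_integral v (complex_of_real r * t)\<bar> \<partial>circle_measure)
      \<le> (\<integral>\<^sup>+ t. (\<integral>\<^sup>+ s. ennreal (poisson_kernel (complex_of_real r * t) s) * ennreal \<bar>v s\<bar> \<partial>circle_measure) \<partial>circle_measure)"
  proof (intro nn_integral_mono)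
    fix t assume t: "t \<in> space circle_measure"
    have "ennreal \<bar>poisson_integral v (complex_of_real r * t)\<bar> \<le>
        (\<integral>\<^sup>+ s. ennreal (norm (poisson_kernel (complex_of_real r * t) s * v s)) \<partial>circle_measure)"
      unfolding poisson_integral_def real_norm_def[symmetric]
      by (intro integral_norm_bound_ennreal poisson_kernel_integrable_mult v rt t)
    also have "\<dots> = (\<integral>\<^sup>+ s. ennreal (poisson_kernel (complex_of_real r * t) s) * ennreal \<bar>v s\<bar> \<partial>circle_measure)"
      using poisson_kernel_nonneg[OF rt[OF t]] by (intro nn_integral_cong) (simp add: abs_mult ennreal_mult)
    finally show "ennreal \<bar>poisson_integral v (complex_of_real r * t)\<bar> \<le>
        (\<integral>\<^sup>+ s. ennreal (poisson_kernel (complex_of_real r * t) s) * ennreal \<bar>v s\<bar> \<partial>circle_measure)" .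
  qed
  also have "\<dots> = (\<integral>\<^sup>+ s. (\<integral>\<^sup>+ t. ennreal (poisson_kernel (complex_of_real r * t) s) * ennreal \<bar>v s\<bar> \<partial>circle_measure) \<partial>circle_measure)"
    by (rule circle_pair.Fubini') measurable
  also have "\<dots> = (\<integral>\<^sup>+ s. ennreal \<bar>v s\<bar> \<partial>circle_measure)"
  proof (intro nn_integral_cong)
    fix s assume s: "s \<in> space circle_measure"
    have "(\<integral>\<^sup>+ t. ennreal (poisson_kernel (complex_of_real r * t) s) * ennreal \<bar>v s\<bar> \<partial>circle_measure)
        = (\<integral>\<^sup>+ t. ennreal (poisson_kernel (complex_of_real r * t) s) \<partial>circle_measure) * ennreal \<bar>v s\<bar>"
      by (rule nn_integral_multc) measurable
    also have "(\<integral>\<^sup>+ t. ennreal (poisson_kernel (complex_of_real r * t) s) \<partial>circle_measure)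
       = (\<integral>\<^sup>+ t. ennreal (poisson_kernel (complex_of_real r * s) t) \<partial>circle_measure)"
      using s by (intro nn_integral_cong) (simp add: poisson_kernel_sym)
    also have "\<dots> = ennreal (LINT t|circle_measure. poisson_kernel (complex_of_real r * s) t)"
      by (intro nn_integral_eq_integral circle_integrable_continuous continuous_intros AE_I2 poisson_kernel_nonneg rt s)
    also have "\<dots> = 1" by (simp add: integral_poisson_kernel[OF rt[OF s]])
    finally show "(\<integral>\<^sup>+ t. ennreal (poisson_kernel (complex_of_real r * t) s) * ennreal \<bar>v s\<bar> \<partial>circle_measure) = ennreal \<bar>v s\<bar>"
      by simp
  qed
  also have "\<dots> = ennreal (LINT s|circle_measure. \<bar>v s\<bar>)"
    using v by (intro nn_integral_eq_integral) auto
  finally show ?thesis .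
qed

lemma poisson_integral_L1:
  assumes v: "integrable circle_measure v" and r: "0 \<le> r" "r < 1"
  shows "integrable circle_measure (\<lambda>t. poisson_integral v (complex_of_real r * t))"
    and "(LINT t|circle_measure. \<bar>poisson_integral v (complex_of_real r * t)\<bar>) \<le> (LINT s|circle_measure. \<bar>v s\<bar>)"
proof -
  have lt: "(\<integral>\<^sup>+ t. ennreal (norm (poisson_integral v (complex_of_real r * t))) \<partial>circle_measure) < \<infinity>"
    using poisson_integral_contraction[OF assms] by (simp add: order_le_less_trans)
  show i: "integrable circle_measure (\<lambda>t. poisson_integral v (complex_of_real r * t))"
    by (rule integrableI_bounded[OF poisson_integral_measurable[OF v] lt])
  have "ennreal (LINT t|circle_measure. \<bar>poisson_integral v (complex_of_real r * t)\<bar>) =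
      (\<integral>\<^sup>+ t. ennreal \<bar>poisson_integral v (complex_of_real r * t)\<bar> \<partial>circle_measure)"
    using i by (intro nn_integral_eq_integral[symmetric]) auto
  also have "\<dots> \<le> ennreal (LINT s|circle_measure. \<bar>v s\<bar>)" by (rule poisson_integral_contraction[OF assms])
  finally show "(LINT t|circle_measure. \<bar>poisson_integral v (complex_of_real r * t)\<bar>) \<le> (LINT s|circle_measure. \<bar>v s\<bar>)"
    by (simp add: ennreal_le_iff)
qed

section \<open>Truncation and passage to the boundary\<close>

definition clamp_real :: "real \<Rightarrow> real \<Rightarrow> real" where "clamp_real K x = max (- K) (min K x)"

text \<open>\<open>clamp_real K x\<close> is the point of the interval from \<open>- K\<close> to
  \<open>K\<close> nearest to \<open>x\<close>; the third property compares it with another point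
  \<open>y\<close> of that interval.\<close>

lemma clamp_real_props:
  assumes "K \<ge> 0"
  shows "\<bar>clamp_real K x\<bar> \<le> K" "\<bar>x - clamp_real K x\<bar> \<le> \<bar>x\<bar>"
    "\<bar>y\<bar> \<le> K \<Longrightarrow> \<bar>x - clamp_real K x\<bar> \<le> \<bar>x - y\<bar>" "\<bar>x\<bar> \<le> K \<Longrightarrow> clamp_real K x = x"
  using assms by (auto simp: clamp_real_def max_def min_def)

lemma clamp_real_tendsto:
  "(f \<longlongrightarrow> l) F \<Longrightarrow> ((\<lambda>x. clamp_real K (f x)) \<longlongrightarrow> clamp_real K l) F"
  unfolding clamp_real_def by (intro tendsto_intros)

lemma clamp_real_measurable [measurable]: "clamp_real K \<in> borel_measurable borel"
  unfolding clamp_real_def by measurable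

text \<open>Truncating both the density and its Poisson integrals at a high level turns the almost everywhere
  convergence into convergence of the integrals, because the contraction property controls the excess.\<close>

theorem poisson_integral_boundary_mean:
  fixes s :: "nat \<Rightarrow> real"
  assumes v: "integrable circle_measure v" and s: "\<And>k. 0 \<le> s k" "\<And>k. s k < 1"
    and lim: "AE t in circle_measure. (\<lambda>k. poisson_integral v (complex_of_real (s k) * t)) \<longlonglongrightarrow> u t"
    and um [measurable]: "u \<in> borel_measurable circle_measure"
    and mean: "\<And>k. (LINT t|circle_measure. poisson_integral v (complex_of_real (s k) * t)) = c"
  shows "(LINT t|circle_measure. u t) = c"
proof -
  note [measurable] = borel_measurable_integrable[OF v]
  define U where "U k t = poisson_integral v (complex_of_real (s k) * t)" for k t
  have Um [measurable]: "U k \<in> borel_measurable circle_measure" for k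
    unfolding U_def by (rule poisson_integral_measurable[OF v])
  have Ui: "integrable circle_measure (U k)" for k
    unfolding U_def by (rule poisson_integral_L1(1)[OF v s])
  have L: "AE t in circle_measure. (\<lambda>k. U k t) \<longlonglongrightarrow> u t" using lim by (simp add: U_def)
  \<comment> \<open>Fatou's lemma for a continuous function \<open>\<phi>\<close> of the Poisson
    integrals; it is applied to the absolute value and to the truncation excess.\<close>
  have fatou: "(\<integral>\<^sup>+ t. ennreal (\<phi> (u t)) \<partial>circle_measure) \<le> ennreal B"
    if \<phi>: "\<And>f l. f \<longlonglongrightarrow> l \<Longrightarrow> (\<lambda>k::nat. \<phi> (f k)) \<longlonglongrightarrow> \<phi> l" and [measurable]: "\<phi> \<in> borel_measurable borel"
      and B: "\<And>k. (\<integral>\<^sup>+ t. ennreal (\<phi> (U k t)) \<partial>circle_measure) \<le> ennreal B" for \<phi> :: "real \<Rightarrow> real" and B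
  proof -
    have "(\<integral>\<^sup>+ t. ennreal (\<phi> (u t)) \<partial>circle_measure) = (\<integral>\<^sup>+ t. liminf (\<lambda>k. ennreal (\<phi> (U k t))) \<partial>circle_measure)"
    proof (rule nn_integral_cong_AE)
      show "AE t in circle_measure. ennreal (\<phi> (u t)) = liminf (\<lambda>k. ennreal (\<phi> (U k t)))"
        using L
      proof eventually_elim
        fix t assume "(\<lambda>k. U k t) \<longlonglongrightarrow> u t"
        from tendsto_ennrealI[OF \<phi>[OF this]] show "ennreal (\<phi> (u t)) = liminf (\<lambda>k. ennreal (\<phi> (U k t)))"
          by (intro lim_imp_Liminf[symmetric]) auto
      qed
    qed
    also have "\<dots> \<le> liminf (\<lambda>k. \<integral>\<^sup>+ t. ennreal (\<phi> (U k t)) \<partial>circle_measure)"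
      by (rule nn_integral_liminf) measurable
    also have "\<dots> \<le> liminf (\<lambda>k. ennreal B)" by (intro Liminf_mono always_eventually allI B)
    finally show ?thesis by (simp add: Liminf_const)
  qed
  have ui: "integrable circle_measure u"
  proof (rule integrableI_bounded)
    have "(\<integral>\<^sup>+ t. ennreal \<bar>u t\<bar> \<partial>circle_measure) \<le> ennreal (LINT s|circle_measure. \<bar>v s\<bar>)"
    proof (rule fatou)
      show "(\<integral>\<^sup>+ t. ennreal \<bar>U k t\<bar> \<partial>circle_measure) \<le> ennreal (LINT s|circle_measure. \<bar>v s\<bar>)" for k
        unfolding U_def by (rule poisson_integral_contraction[OF v s])
    qed (auto intro: tendsto_rabs)
    thus "(\<integral>\<^sup>+ t. ennreal (norm (u t)) \<partial>circle_measure) < \<infinity>" by (simp add: order_le_less_trans)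
  qed measurable
  have est: "\<bar>(LINT t|circle_measure. u t) - c\<bar> \<le> 2 * (LINT t|circle_measure. \<bar>v t - clamp_real K (v t)\<bar>)"
    if K: "K \<ge> 0" for K
  proof -
    define v1 where "v1 t = clamp_real K (v t)" for t
    define v2 where "v2 t = v t - v1 t" for t
    have v1: "integrable circle_measure v1"
      unfolding v1_def using clamp_real_props(1)[OF K] by (intro circle.integrable_const_bound[where B=K]) auto
    have v2: "integrable circle_measure v2" unfolding v2_def by (intro Bochner_Integration.integrable_diff v v1)
    define \<epsilon> where "\<epsilon> = (LINT t|circle_measure. \<bar>v2 t\<bar>)"
    have \<epsilon>0: "\<epsilon> \<ge> 0" unfolding \<epsilon>_def by simp
    have ci: "integrable circle_measure (\<lambda>t. clamp_real K (f t))" if [measurable]: "f \<in> borel_measurable circle_measure" for f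
      using clamp_real_props(1)[OF K] by (intro circle.integrable_const_bound[where B=K]) auto
    \<comment> \<open>The Poisson integral of the truncated part \<open>v1\<close> stays within the
      truncation level, so the distance of \<open>U k t\<close> from that interval is at most the
      Poisson integral of the excess \<open>v2\<close>.\<close>
    have pt: "\<bar>U k t - clamp_real K (U k t)\<bar> \<le> \<bar>poisson_integral v2 (complex_of_real (s k) * t)\<bar>"
      if "t \<in> sphere 0 1" for k t
    proof -
      have st: "norm (complex_of_real (s k) * t) < 1" using s[of k] that by (simp add: norm_mult)
      have "U k t - poisson_integral v1 (complex_of_real (s k) * t) = poisson_integral v2 (complex_of_real (s k) * t)"
        unfolding U_def poisson_integral_def v2_def right_diff_distrib
        by (intro Bochner_Integration.integral_diff[symmetric] poisson_kernel_integrable_mult v v1 st)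
      moreover have "\<bar>poisson_integral v1 (complex_of_real (s k) * t)\<bar> \<le> K"
        by (rule poisson_integral_le_bound[OF v1 st]) (simp add: v1_def clamp_real_props(1)[OF K])
      ultimately show ?thesis using clamp_real_props(3)[OF K] by metis
    qed
    have nn: "(\<integral>\<^sup>+ t. ennreal \<bar>U k t - clamp_real K (U k t)\<bar> \<partial>circle_measure) \<le> ennreal \<epsilon>" for k
    proof -
      have "(\<integral>\<^sup>+ t. ennreal \<bar>U k t - clamp_real K (U k t)\<bar> \<partial>circle_measure)
          \<le> (\<integral>\<^sup>+ t. ennreal \<bar>poisson_integral v2 (complex_of_real (s k) * t)\<bar> \<partial>circle_measure)"
        using pt by (intro nn_integral_mono ennreal_leI) auto
      also have "\<dots> \<le> ennreal \<epsilon>" unfolding \<epsilon>_def by (rule poisson_integral_contraction[OF v2 s])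
      finally show ?thesis .
    qed
    have diff: "\<bar>(LINT t|circle_measure. f t) - (LINT t|circle_measure. clamp_real K (f t))\<bar> \<le> \<epsilon>"
      if f: "integrable circle_measure f" and b: "(\<integral>\<^sup>+ t. ennreal \<bar>f t - clamp_real K (f t)\<bar> \<partial>circle_measure) \<le> ennreal \<epsilon>" for f
    proof -
      have d: "integrable circle_measure (\<lambda>t. f t - clamp_real K (f t))"
        by (intro Bochner_Integration.integrable_diff f ci borel_measurable_integrable)
      have "(LINT t|circle_measure. f t) - (LINT t|circle_measure. clamp_real K (f t)) =
          (LINT t|circle_measure. f t - clamp_real K (f t))"
        by (intro Bochner_Integration.integral_diff[symmetric] f ci borel_measurable_integrable)
      also have "\<bar>\<dots>\<bar> \<le> (LINT t|circle_measure. \<bar>f t - clamp_real K (f t)\<bar>)"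
        using integral_norm_bound[of circle_measure "\<lambda>t. f t - clamp_real K (f t)"] by simp
      also have "\<dots> \<le> \<epsilon>"
      proof -
        have "ennreal (LINT t|circle_measure. \<bar>f t - clamp_real K (f t)\<bar>) =
            (\<integral>\<^sup>+ t. ennreal \<bar>f t - clamp_real K (f t)\<bar> \<partial>circle_measure)"
          using d by (intro nn_integral_eq_integral[symmetric]) auto
        hence "ennreal (LINT t|circle_measure. \<bar>f t - clamp_real K (f t)\<bar>) \<le> ennreal \<epsilon>"
          using b by simp
        thus ?thesis using \<epsilon>0 by (simp only: ennreal_le_iff)
      qed
      finally show ?thesis .
    qed
    have "(\<integral>\<^sup>+ t. ennreal \<bar>u t - clamp_real K (u t)\<bar> \<partial>circle_measure) \<le> ennreal \<epsilon>"
      by (rule fatou[of "\<lambda>x. \<bar>x - clamp_real K x\<bar>"]) (auto intro!: tendsto_intros clamp_real_tendsto nn)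
    from diff[OF ui this] have 1: "\<bar>(LINT t|circle_measure. u t) - (LINT t|circle_measure. clamp_real K (u t))\<bar> \<le> \<epsilon>" .
    have "(\<lambda>k. LINT t|circle_measure. clamp_real K (U k t)) \<longlonglongrightarrow> (LINT t|circle_measure. clamp_real K (u t))"
    proof (rule integral_dominated_convergence[where w="\<lambda>_. K"])
      show "AE t in circle_measure. (\<lambda>k. clamp_real K (U k t)) \<longlonglongrightarrow> clamp_real K (u t)"
        using L by eventually_elim (rule clamp_real_tendsto)
      show "AE t in circle_measure. norm (clamp_real K (U k t)) \<le> K" for k
        using clamp_real_props(1)[OF K] by (intro AE_I2) simp
    qed auto
    hence "(\<lambda>k. \<bar>c - (LINT t|circle_measure. clamp_real K (U k t))\<bar>) \<longlonglongrightarrow> \<bar>c - (LINT t|circle_measure. clamp_real K (u t))\<bar>"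
      by (intro tendsto_intros)
    moreover have "\<bar>c - (LINT t|circle_measure. clamp_real K (U k t))\<bar> \<le> \<epsilon>" for k
      using diff[OF Ui nn[of k]] mean[of k] by (simp add: U_def)
    ultimately have "\<bar>c - (LINT t|circle_measure. clamp_real K (u t))\<bar> \<le> \<epsilon>"
      by (intro LIMSEQ_le_const2) auto
    with 1 have "\<bar>(LINT t|circle_measure. u t) - c\<bar> \<le> 2 * \<epsilon>" by linarith
    thus ?thesis by (simp add: \<epsilon>_def v2_def v1_def)
  qed
  \<comment> \<open>As the truncation level grows, the excess of the integrable density tends to 0
    in mean, and with it the error in \<open>est\<close>.\<close>
  have "(\<lambda>n. LINT t|circle_measure. \<bar>v t - clamp_real (real n) (v t)\<bar>) \<longlonglongrightarrow> (LINT t|circle_measure. 0)"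
  proof (rule integral_dominated_convergence[where w="\<lambda>t. \<bar>v t\<bar>"])
    show "AE t in circle_measure. (\<lambda>n. \<bar>v t - clamp_real (real n) (v t)\<bar>) \<longlonglongrightarrow> 0"
    proof (rule AE_I2)
      fix t
      obtain N :: nat where "\<bar>v t\<bar> \<le> real N" using real_arch_simple by blast
      hence "\<forall>\<^sub>F n in sequentially. \<bar>v t - clamp_real (real n) (v t)\<bar> = 0"
        by (intro eventually_sequentiallyI[of N]) (simp add: clamp_real_props(4))
      thus "(\<lambda>n. \<bar>v t - clamp_real (real n) (v t)\<bar>) \<longlonglongrightarrow> 0" by (rule tendsto_eventually)
    qed
    show "AE t in circle_measure. norm (\<bar>v t - clamp_real (real n) (v t)\<bar>) \<le> \<bar>v t\<bar>" for n
      using clamp_real_props(2)[of "real n"] by (intro AE_I2) simp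
  qed (use v in auto)
  hence "(\<lambda>n. 2 * (LINT t|circle_measure. \<bar>v t - clamp_real (real n) (v t)\<bar>)) \<longlonglongrightarrow> 2 * (LINT t|circle_measure. 0)"
    by (intro tendsto_intros)
  hence "\<bar>(LINT t|circle_measure. u t) - c\<bar> \<le> 2 * (LINT t|circle_measure. 0)"
    by (rule LIMSEQ_le_const) (use est in auto)
  thus ?thesis by simp
qed

text \<open>For \<open>t\<close> on the circle the real part of \<open>(t + z) / (t - z)\<close> is
  the Poisson kernel, and the exponential never vanishes.\<close>

lemma outer_function_ln_norm:
  assumes "outer_function e"
  obtains v where "integrable circle_measure v"
    "\<And>z. z \<in> ball 0 1 \<Longrightarrow> e z \<noteq> 0" "\<And>z. z \<in> ball 0 1 \<Longrightarrow> ln (norm (e z)) = poisson_integral v z"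
proof -
  obtain C w where Cw: "norm C = 1" "integrable circle_measure (\<lambda>t. ln (w t :: real))"
     "\<And>z. z \<in> ball 0 1 \<Longrightarrow> e z = C * exp (LINT t|circle_measure. (t + z) / (t - z) * complex_of_real (ln (w t)))"
    using assms unfolding outer_function_def by blast
  show ?thesis
  proof (rule that[OF Cw(2)])
    fix z :: complex assume z: "z \<in> ball 0 1"
    show "e z \<noteq> 0" using Cw(1) Cw(3)[OF z] by auto
    have R: "Re ((t + z) / (t - z) * complex_of_real (ln (w t))) = poisson_kernel z t * ln (w t)"
      if "t \<in> sphere 0 1" for t
    proof -
      have tz: "t - z \<noteq> 0" using that z by auto
      have "(t + z) / (t - z) = (t + z) * cnj (t - z) / complex_of_real ((norm (t - z))\<^sup>2)"
        using tz unfolding complex_norm_square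
        by (intro nonzero_mult_divide_mult_cancel_right[symmetric]) (simp del: complex_cnj_diff)
      hence "Re ((t + z) / (t - z)) = Re ((t + z) * cnj (t - z)) / (norm (t - z))\<^sup>2"
        by (simp only: Re_divide_of_real)
      also have "Re ((t + z) * cnj (t - z)) = (norm t)\<^sup>2 - (norm z)\<^sup>2"
        unfolding cmod_power2 by (simp add: algebra_simps power2_eq_square)
      finally have "Re ((t + z) / (t - z)) = poisson_kernel z t" using that by (simp add: poisson_kernel_def)
      moreover have "Re (x * complex_of_real y) = Re x * y" for x y by simp
      ultimately show ?thesis by metis
    qed
    have "bounded ((\<lambda>t. (t + z) / (t - z)) ` sphere 0 1)"
      using z by (intro compact_imp_bounded compact_continuous_image continuous_intros) auto
    then obtain B where B: "\<And>s. s \<in> sphere 0 1 \<Longrightarrow> norm ((s + z) / (s - z)) \<le> B"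
      unfolding bounded_iff by blast
    have int: "integrable circle_measure (\<lambda>t. (t + z) / (t - z) * complex_of_real (ln (w t)))"
    proof (rule Bochner_Integration.integrable_bound[of _ "\<lambda>s. B * ln (w s)"])
      have [measurable]: "(\<lambda>t. ln (w t)) \<in> borel_measurable circle_measure" using Cw(2) by auto
      show "(\<lambda>t. (t + z) / (t - z) * complex_of_real (ln (w t))) \<in> borel_measurable circle_measure"
        by measurable
      show "AE s in circle_measure. norm ((s + z) / (s - z) * complex_of_real (ln (w s))) \<le> norm (B * ln (w s))"
      proof (rule AE_I2)
        fix s assume "s \<in> space circle_measure"
        hence "norm ((s + z) / (s - z)) \<le> \<bar>B\<bar>" using B[of s] by simp
        thus "norm ((s + z) / (s - z) * complex_of_real (ln (w s))) \<le> norm (B * ln (w s))"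
          unfolding norm_mult norm_of_real by (intro mult_mono) auto
      qed
    qed (use Cw(2) in auto)
    have "ln (norm (e z)) = Re (LINT t|circle_measure. (t + z) / (t - z) * complex_of_real (ln (w t)))"
      using Cw(1) by (simp add: Cw(3)[OF z] norm_mult)
    also have "\<dots> = (LINT t|circle_measure. Re ((t + z) / (t - z) * complex_of_real (ln (w t))))"
      by (rule integral_Re[symmetric, OF int])
    also have "\<dots> = (LINT t|circle_measure. poisson_kernel z t * ln (w t))"
      by (rule Bochner_Integration.integral_cong) (use R in auto)
    finally show "ln (norm (e z)) = poisson_integral (\<lambda>t. ln (w t)) z" by (simp add: poisson_integral_def)
  qed
qed

text \<open>The boundary modulus enters through its radial limits \<open>m\<close>. Since
  \<open>e\<close> has no zeros, the logarithmic means over all smaller circles equal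
  \<open>ln (norm (e 0))\<close>, and \<open>poisson_integral_boundary_mean\<close> carries this
  value to the boundary.\<close>

theorem outer_function_boundary_mean:
  assumes e: "e holomorphic_on ball 0 1" "outer_function e"
    and lim: "AE t in circle_measure. ((\<lambda>r. norm (e (complex_of_real r * t))) \<longlongrightarrow> m t) (at_left 1)"
    and mm: "m \<in> borel_measurable circle_measure"
  shows "(LINT t|circle_measure. ln (m t)) = ln (norm (e 0))"
proof -
  obtain v where v: "integrable circle_measure v"
    "\<And>z. z \<in> ball 0 1 \<Longrightarrow> e z \<noteq> 0" "\<And>z. z \<in> ball 0 1 \<Longrightarrow> ln (norm (e z)) = poisson_integral v z"
    by (rule outer_function_ln_norm[OF e(2)]) blast
  define s where "s k = 1 - 1 / (real k + 2)" for k :: nat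
  have s: "0 \<le> s k" "s k < 1" for k by (auto simp: s_def field_simps)
  have slim: "filterlim s (at_left 1) sequentially" unfolding s_def by real_asymp
  have inb: "complex_of_real (s k) * t \<in> ball 0 1" if "t \<in> sphere 0 1" for k t
    using s[of k] that by (simp add: norm_mult)
  define U where "U k t = poisson_integral v (complex_of_real (s k) * t)" for k t
  have U: "U k t = ln (norm (e (complex_of_real (s k) * t)))" if "t \<in> sphere 0 1" for k t
    unfolding U_def using v(3)[OF inb[OF that]] by simp
  have Um: "U k \<in> borel_measurable circle_measure" for k
    unfolding U_def by (rule poisson_integral_measurable[OF v(1)])
  have "(\<integral>\<^sup>+ t. liminf (\<lambda>k. ennreal \<bar>U k t\<bar>) \<partial>circle_measure) \<le>
      liminf (\<lambda>k. \<integral>\<^sup>+ t. ennreal \<bar>U k t\<bar> \<partial>circle_measure)"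
    using Um by (intro nn_integral_liminf) auto
  also have "\<dots> \<le> liminf (\<lambda>k. ennreal (LINT s|circle_measure. \<bar>v s\<bar>))"
    unfolding U_def by (intro Liminf_mono always_eventually allI poisson_integral_contraction v s)
  finally have "(\<integral>\<^sup>+ t. liminf (\<lambda>k. ennreal \<bar>U k t\<bar>) \<partial>circle_measure) \<noteq> \<infinity>"
    by (auto simp: Liminf_const top_unique)
  hence fin: "AE t in circle_measure. liminf (\<lambda>k. ennreal \<bar>U k t\<bar>) \<noteq> \<infinity>"
    using Um by (intro nn_integral_PInf_AE) auto
  have "AE t in circle_measure. t \<in> sphere 0 1" by (rule AE_I2) simp
  with lim fin have ae: "AE t in circle_measure. (\<lambda>k. U k t) \<longlonglongrightarrow> ln (m t)"
  proof eventually_elim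
    case (elim t)
    have l: "(\<lambda>k. norm (e (complex_of_real (s k) * t))) \<longlonglongrightarrow> m t"
      by (rule filterlim_compose[OF elim(1) slim])
    \<comment> \<open>The totalised logarithm is not continuous at 0, so a vanishing limit must be
      ruled out: it would drive the absolute value of \<open>U k t\<close> to infinity, contrary to
      the finite limit inferior obtained from Fatou's lemma.\<close>
    have "m t \<noteq> 0"
    proof
      assume "m t = 0"
      hence "filterlim (\<lambda>k. norm (e (complex_of_real (s k) * t))) (at_right 0) sequentially"
        using l v(2)[OF inb[OF elim(3)]] by (intro tendsto_imp_filterlim_at_right) auto
      hence "filterlim (\<lambda>k. ln (norm (e (complex_of_real (s k) * t)))) at_bot sequentially"
        by (rule filterlim_compose[OF ln_at_0])
      hence "filterlim (\<lambda>k. - U k t) at_top sequentially"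
        unfolding U[OF elim(3)] by (simp add: filterlim_uminus_at_top)
      hence "filterlim (\<lambda>k. \<bar>U k t\<bar>) at_top sequentially"
        by (rule filterlim_at_top_mono) (auto intro!: always_eventually)
      hence "(\<lambda>k. ennreal \<bar>U k t\<bar>) \<longlonglongrightarrow> top" by (simp add: ennreal_tendsto_top_eq_at_top)
      hence "liminf (\<lambda>k. ennreal \<bar>U k t\<bar>) = top" by (intro lim_imp_Liminf) auto
      thus False using elim(2) by simp
    qed
    thus "(\<lambda>k. U k t) \<longlonglongrightarrow> ln (m t)" unfolding U[OF elim(3)] by (intro tendsto_ln l)
  qed
  show ?thesis
  proof (rule poisson_integral_boundary_mean[OF v(1) s])
    show "AE t in circle_measure. (\<lambda>k. poisson_integral v (complex_of_real (s k) * t)) \<longlonglongrightarrow> ln (m t)"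
      using ae by (simp add: U_def)
    show "(\<lambda>t. ln (m t)) \<in> borel_measurable circle_measure" using mm by measurable
    fix k
    have "(LINT t|circle_measure. poisson_integral v (complex_of_real (s k) * t)) =
        (LINT t|circle_measure. ln (norm (e (complex_of_real (s k) * t))))"
      by (intro Bochner_Integration.integral_cong) (use v(3)[OF inb] in auto)
    also have "\<dots> = ln (norm (e 0))"
      by (rule ln_norm_mean_value_dilate(1)[OF e(1) s]) (use v(2) s[of k] in \<open>auto intro: order_le_less_trans\<close>)
    finally show "(LINT t|circle_measure. poisson_integral v (complex_of_real (s k) * t)) = ln (norm (e 0))" .
  qed
qed

section \<open>Contractions and orthogonal projections\<close>

lemma opnorm_le_1_iff: "opnorm A \<le> 1 \<longleftrightarrow> (\<forall>x. norm (A *v x) \<le> norm x)" for A :: "complex^'n^'n"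
proof
  assume A: "opnorm A \<le> 1"
  show "\<forall>x. norm (A *v x) \<le> norm x"
  proof
    fix x
    have "norm (A *v x) \<le> opnorm A * norm x"
      unfolding opnorm_def by (rule onorm) simp
    also have "\<dots> \<le> 1 * norm x" using A by (intro mult_right_mono) auto
    finally show "norm (A *v x) \<le> norm x" by simp
  qed
next
  assume "\<forall>x. norm (A *v x) \<le> norm x"
  thus "opnorm A \<le> 1" unfolding opnorm_def by (intro onorm_le) simp
qed

lemma opnorm_mult_le_1:
  fixes A B :: "complex^'n^'n"
  assumes "opnorm A \<le> 1" "opnorm B \<le> 1"
  shows "opnorm (A ** B) \<le> 1"
  using assms unfolding opnorm_le_1_iff matrix_vector_mul_assoc[symmetric] by (meson order_trans)

section \<open>Powers and determinants of contractions\<close>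

definition matrix_power :: "complex^'n^'n \<Rightarrow> nat \<Rightarrow> complex^'n^'n" where
  "matrix_power A k = ((**) A ^^ k) (mat 1)"

lemma matrix_power_simps [simp]:
  "matrix_power A 0 = mat 1" "matrix_power A (Suc k) = A ** matrix_power A k"
  by (simp_all add: matrix_power_def)

lemma matrix_power_add: "matrix_power A (j + k) = matrix_power A j ** matrix_power A k"
  by (induction j) (simp_all add: matrix_mul_assoc)

lemma det_matrix_power: "det (matrix_power A k) = det A ^ k"
  by (induction k) (simp_all add: det_mul)

lemma opnorm_mat_1: "opnorm (mat 1 :: complex^'n^'n) \<le> 1"
  by (simp add: opnorm_le_1_iff)

lemma opnorm_matrix_power: "opnorm A \<le> 1 \<Longrightarrow> opnorm (matrix_power A k) \<le> 1"
  by (induction k) (simp_all add: opnorm_mat_1 opnorm_mult_le_1)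

text \<open>The powers of a contraction have bounded determinants.\<close>

lemma norm_det_contraction:
  fixes A :: "complex^'n^'n"
  assumes "opnorm A \<le> 1"
  shows "norm (det A) \<le> 1"
proof (rule ccontr)
  assume "\<not> norm (det A) \<le> 1"
  \<comment> \<open>The entries of a contraction have modulus at most 1, so \<open>c\<close>, the
    number of terms of the Leibniz expansion, bounds its determinant; the powers of a larger
    determinant would exceed it.\<close>
  moreover define c where "c = real (card {p. p permutes (UNIV :: 'n set)})"
  ultimately obtain k where k: "c < norm (det A) ^ k" using real_arch_pow[of "norm (det A)" c] by auto
  have "norm (det (matrix_power A k)) \<le> (\<Sum>p | p permutes (UNIV :: 'n set). 1)"
    unfolding det_def
  proof (intro order_trans[OF norm_sum] sum_mono)
    fix p :: "'n \<Rightarrow> 'n"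
    have "norm (matrix_power A k $ i $ p i) \<le> 1" for i
      using norm_entry_le_opnorm[of "matrix_power A k" i "p i"] opnorm_matrix_power[OF assms, of k] by linarith
    hence "(\<Prod>i\<in>UNIV. norm (matrix_power A k $ i $ p i)) \<le> 1" by (intro prod_le_1) auto
    thus "norm (of_int (sign p) * (\<Prod>i\<in>UNIV. matrix_power A k $ i $ p i)) \<le> 1"
      by (simp add: norm_mult prod_norm[symmetric] sign_def)
  qed
  thus False using k by (simp add: c_def det_matrix_power norm_power)
qed

text \<open>The library's \<open>inner\<close> on complex vectors is the real part of this Hermitian
  product; the complex adjoint calls for the full product.\<close>

definition cinner :: "complex^'n \<Rightarrow> complex^'n \<Rightarrow> complex" where
  "cinner x y = (\<Sum>k\<in>UNIV. x $ k * cnj (y $ k))"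

lemma Re_cinner: "Re (cinner x y) = inner x y"
  by (simp add: cinner_def inner_vec_def inner_complex_def)

lemma cinner_scale_right: "cinner x (c *s y) = cnj c * cinner x y"
  by (simp add: cinner_def sum_distrib_left mult_ac)

lemma cinner_scale_left: "cinner (c *s x) y = c * cinner x y"
  by (simp add: cinner_def sum_distrib_left mult_ac)

lemma Im_cinner: "Im (cinner x y) = inner x (\<i> *s y)"
  by (simp add: Re_cinner[symmetric] cinner_scale_right)

lemma cinner_self: "cinner x x = complex_of_real ((norm x)\<^sup>2)"
proof -
  have "Im (cinner x x) = 0" by (simp add: cinner_def mult.commute)
  thus ?thesis by (simp add: complex_eq_iff Re_cinner power2_norm_eq_inner)
qed

lemma cinner_commute: "cinner y x = cnj (cinner x y)"
  by (simp add: cinner_def mult.commute)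

lemma norm_cinner_le: "norm (cinner x y) \<le> norm x * norm y"
proof (cases "cinner x y = 0")
  case False
  \<comment> \<open>This unimodular factor rotates the product onto the nonnegative real axis, which
    leaves the real Cauchy-Schwarz inequality.\<close>
  define c where "c = cinner x y / norm (cinner x y)"
  have c: "norm c = 1" using False by (simp add: c_def norm_divide)
  have "cnj c * cinner x y = norm (cinner x y)"
  proof -
    have "cnj c * cinner x y = complex_of_real ((norm (cinner x y))\<^sup>2) / norm (cinner x y)"
      unfolding complex_norm_square by (simp add: c_def mult.commute)
    thus ?thesis by (simp add: power2_eq_square)
  qed
  hence "norm (cinner x y) = Re (cnj c * cinner x y)" by simp
  also have "\<dots> = inner x (c *s y)" by (simp only: cinner_scale_right[symmetric] Re_cinner)
  also have "\<dots> \<le> norm x * norm (c *s y)" by (rule norm_cauchy_schwarz)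
  also have "norm (c *s y) = norm y"
    using c by (simp add: norm_vec_def norm_mult L2_set_def)
  finally show ?thesis .
qed simp

lemma cinner_matrix: "cinner (A *v x) y = cinner x (conj_transpose A *v y)"
proof -
  have "cinner (A *v x) y = (\<Sum>k\<in>UNIV. \<Sum>j\<in>UNIV. A $ k $ j * x $ j * cnj (y $ k))"
    by (simp add: cinner_def matrix_vector_mult_def sum_distrib_right)
  also have "\<dots> = (\<Sum>j\<in>UNIV. \<Sum>k\<in>UNIV. A $ k $ j * x $ j * cnj (y $ k))" by (rule sum.swap)
  also have "\<dots> = cinner x (conj_transpose A *v y)"
    by (simp add: cinner_def matrix_vector_mult_def conj_transpose_def sum_distrib_left mult_ac)
  finally show ?thesis .
qed

text \<open>Polarisation: an isometry preserves the real inner product, and replacing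
  \<open>y\<close> by \<open>\<i> *s y\<close> yields the imaginary part of the Hermitian product as
  well.\<close>

lemma unitary_matrixI_norm:
  fixes A :: "complex^'n^'n"
  assumes "\<And>x. norm (A *v x) = norm x"
  shows "unitary_matrix A"
proof -
  have o: "orthogonal_transformation ((*v) A)"
    unfolding orthogonal_transformation using assms by simp
  have re: "inner (A *v x) (A *v y) = inner x y" for x y
    using o by (simp add: orthogonal_transformation_def)
  have c: "cinner (A *v x) (A *v y) = cinner x y" for x y
    using re[of x y] re[of x "\<i> *s y"]
    by (simp add: complex_eq_iff Re_cinner Im_cinner vector_scalar_commute)
  have "(conj_transpose A ** A) $ i $ j = mat 1 $ i $ j" for i j
  proof -
    have "(conj_transpose A ** A) $ i $ j = cinner (A *v axis j 1) (A *v axis i 1)"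
      by (simp add: cinner_def conj_transpose_def matrix_matrix_mult_def matrix_vector_mult_def axis_def
          if_distrib[of "\<lambda>x. _ * x"] mult.commute cong: if_cong)
    also have "\<dots> = cinner (axis j 1) (axis i 1)" by (rule c)
    also have "\<dots> = mat 1 $ i $ j"
      by (auto simp: cinner_def axis_def mat_def if_distrib[of "\<lambda>x. _ * x"] if_distrib[of cnj] cong: if_cong)
    finally show ?thesis .
  qed
  hence "conj_transpose A ** A = mat 1" by (simp add: vec_eq_iff)
  thus ?thesis unfolding unitary_matrix_def using matrix_left_right_inverse by blast
qed

lemma tendsto_matrix_mult:
  fixes A B :: "'a \<Rightarrow> complex^'n^'n"
  assumes "(A \<longlongrightarrow> a) F" "(B \<longlongrightarrow> b) F"
  shows "((\<lambda>x. A x ** B x) \<longlongrightarrow> a ** b) F"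
  unfolding matrix_matrix_mult_def
  by (intro vec_tendstoI) (auto intro!: tendsto_intros assms)

lemma tendsto_matrix_vector_mult:
  fixes A :: "'a \<Rightarrow> complex^'n^'n"
  assumes "(A \<longlongrightarrow> a) F" "(x \<longlongrightarrow> y) F"
  shows "((\<lambda>k. A k *v x k) \<longlongrightarrow> a *v y) F"
  unfolding matrix_vector_mult_def
  by (intro vec_tendstoI) (auto intro!: tendsto_intros assms)

lemma tendsto_det:
  fixes A :: "'a \<Rightarrow> complex^'n^'n"
  assumes "(A \<longlongrightarrow> a) F"
  shows "((\<lambda>x. det (A x)) \<longlongrightarrow> det a) F"
  unfolding det_def by (intro tendsto_intros assms)

lemma norm_matrix_le:
  fixes A :: "complex^'n^'n"
  assumes "\<And>i j. norm (A $ i $ j) \<le> c"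
  shows "norm A \<le> real (CARD('n)) * (real (CARD('n)) * c)"
proof -
  have "norm A \<le> (\<Sum>i\<in>UNIV. norm (A $ i))" unfolding norm_vec_def[of A] by (rule L2_set_le_sum) auto
  also have "\<dots> \<le> (\<Sum>i\<in>(UNIV::'n set). real (CARD('n)) * c)"
  proof (rule sum_mono)
    fix i
    have "norm (A $ i) \<le> (\<Sum>j\<in>UNIV. norm (A $ i $ j))" unfolding norm_vec_def by (rule L2_set_le_sum) auto
    also have "\<dots> \<le> (\<Sum>j\<in>(UNIV::'n set). c)" by (intro sum_mono assms)
    finally show "norm (A $ i) \<le> real (CARD('n)) * c" by simp
  qed
  finally show ?thesis by simp
qed

lemma contraction_convergent_subseq:
  fixes A :: "nat \<Rightarrow> complex^'n^'n"
  assumes "\<And>k. opnorm (A k) \<le> 1"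
  obtains L r where "strict_mono (r :: nat \<Rightarrow> nat)" "(\<lambda>k. A (r k)) \<longlonglongrightarrow> L" "opnorm L \<le> 1"
proof -
  have e: "norm (A k $ i $ j) \<le> 1" for k i j
    using norm_entry_le_opnorm[of "A k" i j] assms[of k] by linarith
  have "norm (A k) \<le> real (CARD('n)) * (real (CARD('n)) * 1)" for k
    by (rule norm_matrix_le) (rule e)
  hence "bounded (range A)" unfolding bounded_iff by blast
  then obtain L r where r: "strict_mono (r :: nat \<Rightarrow> nat)" "(A \<circ> r) \<longlonglongrightarrow> L"
    using bounded_imp_convergent_subsequence by blast
  have L: "(\<lambda>k. A (r k)) \<longlonglongrightarrow> L" using r(2) by (simp add: o_def)
  have "norm (L *v x) \<le> norm x" for x
  proof (rule LIMSEQ_le_const2)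
    show "(\<lambda>k. norm (A (r k) *v x)) \<longlonglongrightarrow> norm (L *v x)"
      by (intro tendsto_norm tendsto_matrix_vector_mult L tendsto_const)
  qed (use assms opnorm_le_1_iff in blast)
  hence "opnorm L \<le> 1" by (simp add: opnorm_le_1_iff)
  thus ?thesis using that r(1) L by blast
qed

text \<open>A subsequence of the powers of \<open>A\<close> converges to an invertible matrix \<open>L\<close>; hence high powers of
  \<open>A\<close> come back close to the identity on the range of \<open>L\<close>, and \<open>A\<close> cannot shrink any vector.\<close>

lemma unitary_contraction_det:
  fixes A :: "complex^'n^'n"
  assumes A: "opnorm A \<le> 1" and det: "norm (det A) = 1"
  shows "unitary_matrix A"
proof (rule unitary_matrixI_norm)
  fix x :: "complex^'n"
  obtain L r where r: "strict_mono (r :: nat \<Rightarrow> nat)" and L: "(\<lambda>k. matrix_power A (r k)) \<longlonglongrightarrow> L"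
    by (rule contraction_convergent_subseq[of "matrix_power A", OF opnorm_matrix_power[OF A]])
  have "(\<lambda>k. norm (det (matrix_power A (r k)))) \<longlonglongrightarrow> norm (det L)"
    by (intro tendsto_norm tendsto_det L)
  moreover have "norm (det (matrix_power A (r k))) = 1" for k by (simp add: det_matrix_power norm_power det)
  ultimately have "norm (det L) = 1" by (simp add: LIMSEQ_const_iff)
  hence "det L \<noteq> 0" by auto
  hence "invertible L" by (simp add: invertible_det_nz)
  then obtain M where M: "L ** M = mat 1" unfolding invertible_def by blast
  \<comment> \<open>The preimage of \<open>x\<close> under \<open>L\<close>: the powers
    \<open>r k\<close> of \<open>A\<close> applied to \<open>w\<close> tend to
    \<open>x\<close>.\<close>
  define w where "w = M *v x"
  have x: "L *v w = x" using M by (simp add: w_def matrix_vector_mul_assoc)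
  have con: "norm (matrix_power A j *v y) \<le> norm y" for j y
    using opnorm_matrix_power[OF A] opnorm_le_1_iff by blast
  have main: "norm x \<le> norm (A *v x) + (norm (matrix_power A (r (Suc k)) *v w - x) + norm (matrix_power A (r k) *v w - x))" for k
  proof -
    \<comment> \<open>The gap \<open>m\<close> between consecutive exponents is at least 1, so one
      factor \<open>A\<close> can be split off and applied to \<open>x\<close> first.\<close>
    define m' where "m' = r (Suc k) - r k - 1"
    define m where "m = Suc m'"
    have "r k < r (Suc k)" using r by (simp add: strict_mono_Suc_iff)
    hence e: "r (Suc k) = m + r k" unfolding m_def m'_def by linarith
    have "matrix_power A m *v x = matrix_power A (r (Suc k)) *v w - matrix_power A m *v (matrix_power A (r k) *v w - x)"
      by (simp add: e matrix_power_add matrix_vector_mul_assoc[symmetric] matrix_vector_mult_diff_distrib)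
    hence "x = matrix_power A m *v x - (matrix_power A (r (Suc k)) *v w - x) + matrix_power A m *v (matrix_power A (r k) *v w - x)"
      by simp
    hence "norm x \<le> norm (matrix_power A m *v x) + norm (matrix_power A (r (Suc k)) *v w - x)
        + norm (matrix_power A m *v (matrix_power A (r k) *v w - x))"
      by (metis (no_types, lifting) add_right_mono norm_triangle_ineq norm_triangle_ineq4 order_trans)
    moreover have "matrix_power A m *v x = matrix_power A m' *v (A *v x)"
    proof -
      have "matrix_power A m = matrix_power A (m' + Suc 0)" by (simp only: m_def add_Suc_right add_0_right)
      thus ?thesis by (simp only: matrix_power_add) (simp add: matrix_vector_mul_assoc)
    qed
    hence "norm (matrix_power A m *v x) \<le> norm (A *v x)" using con by simp
    moreover have "norm (matrix_power A m *v (matrix_power A (r k) *v w - x)) \<le> norm (matrix_power A (r k) *v w - x)"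
      by (rule con)
    ultimately show ?thesis by linarith
  qed
  have t: "(\<lambda>k. norm (matrix_power A (r k) *v w - x)) \<longlonglongrightarrow> norm (L *v w - x)"
    by (intro tendsto_intros tendsto_matrix_vector_mult L)
  have t': "(\<lambda>k. norm (matrix_power A (r (Suc k)) *v w - x)) \<longlonglongrightarrow> norm (L *v w - x)"
    using LIMSEQ_Suc[OF t] by simp
  have "(\<lambda>k. norm (A *v x) + (norm (matrix_power A (r (Suc k)) *v w - x) + norm (matrix_power A (r k) *v w - x)))
      \<longlonglongrightarrow> norm (A *v x) + (norm (L *v w - x) + norm (L *v w - x))"
    by (intro tendsto_add tendsto_const t t')
  hence "norm x \<le> norm (A *v x) + (norm (L *v w - x) + norm (L *v w - x))"
    by (rule LIMSEQ_le_const) (use main in auto)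
  hence "norm x \<le> norm (A *v x)" by (simp add: x)
  moreover have "norm (A *v x) \<le> norm x" using A opnorm_le_1_iff by blast
  ultimately show "norm (A *v x) = norm x" by simp
qed

text \<open>For a projection \<open>P\<close> this map multiplies the range of \<open>P\<close> by
  \<open>c\<close> and fixes the kernel. Treating \<open>c\<close> as a free parameter gives the
  inverse of a Blaschke-Potapov factor the same form, with \<open>1 / c\<close>.\<close>

definition dilation :: "complex \<Rightarrow> complex^'n^'n \<Rightarrow> complex^'n^'n" where
  "dilation c P = mat 1 + mat (c - 1) ** P"

lemma BP_factor_dilation: "BP_factor a P z = dilation (blaschke_factor a z) P"
  by (simp add: BP_factor_def dilation_def)

lemma mat_scalar_mult_nth: "(mat c ** P) $ i $ j = c * P $ i $ j"
  by (simp add: mat_def matrix_matrix_mult_def if_distrib[of "\<lambda>x. x * _"] cong: if_cong)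

lemma dilation_nth: "dilation c P $ i $ j = (if i = j then 1 else 0) + (c - 1) * P $ i $ j"
  by (simp add: dilation_def mat_scalar_mult_nth) (simp add: mat_def)

lemma dilation_mult_vec: "dilation c P *v x = x + (c - 1) *s (P *v x)"
proof -
  have "(mat d ** P) *v x = d *s (P *v x)" for d
    unfolding vec_eq_iff matrix_vector_mult_def
    by (simp add: mat_scalar_mult_nth sum_distrib_left mult.assoc)
  thus ?thesis by (simp add: dilation_def matrix_vector_mult_add_rdistrib)
qed

lemma dilation_1 [simp]: "dilation 1 P = mat 1"
  by (simp add: vec_eq_iff dilation_nth) (simp add: mat_def)

lemma dilation_mult:
  fixes P :: "complex^'n^'n"
  assumes "P ** P = P"
  shows "dilation c P ** dilation d P = dilation (c * d) P"
proof -
  have PP: "P *v (P *v x) = P *v x" for x by (simp add: matrix_vector_mul_assoc assms)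
  have "(dilation c P ** dilation d P) *v x = dilation (c * d) P *v x" for x
  proof -
    have "(x + (c - 1) *s y) + (d - 1) *s (y + (c - 1) *s y) = x + (c * d - 1) *s y" for y :: "complex^'n"
      by (simp add: vec_eq_iff algebra_simps)
    from this[of "P *v x"] show ?thesis
      by (simp only: matrix_vector_mul_assoc[symmetric] dilation_mult_vec matrix_vector_right_distrib
          vector_scalar_commute PP)
  qed
  thus ?thesis by (simp add: matrix_eq)
qed

lemma orthogonal_projection_pythagoras:
  fixes P :: "complex^'n^'n"
  assumes P: "orthogonal_projection_matrix P"
  shows "(norm (dilation c P *v x))\<^sup>2 = (norm (x - P *v x))\<^sup>2 + (norm c)\<^sup>2 * (norm (P *v x))\<^sup>2"
proof -
  define p q where "p = P *v x" and "q = x - P *v x"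
  have PP: "P *v (P *v y) = P *v y" for y
    using P by (simp add: matrix_vector_mul_assoc orthogonal_projection_matrix_def)
  have "cinner p q = cinner x (conj_transpose P *v q)" unfolding p_def by (rule cinner_matrix)
  also have "conj_transpose P *v q = 0"
    using P PP by (simp add: orthogonal_projection_matrix_def q_def matrix_vector_mult_diff_distrib)
  finally have pq: "cinner p q = 0" by (simp add: cinner_def)
  have "inner q (c *s p) = 0"
    using pq cinner_commute[of q p] by (simp add: Re_cinner[symmetric] cinner_scale_right)
  moreover have "dilation c P *v x = q + c *s p"
  proof -
    have "x + (c - 1) *s p = (x - p) + c *s p" by (simp add: vec_eq_iff algebra_simps)
    thus ?thesis by (simp only: dilation_mult_vec p_def q_def)
  qed
  ultimately have "(norm (dilation c P *v x))\<^sup>2 = (norm q)\<^sup>2 + (norm (c *s p))\<^sup>2"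
    by (simp add: power2_norm_eq_inner inner_add_left inner_add_right inner_commute)
  also have "(norm (c *s p))\<^sup>2 = (norm c)\<^sup>2 * (norm p)\<^sup>2"
    by (simp add: norm_vec_def L2_set_def norm_mult power_mult_distrib sum_distrib_left[symmetric] sum_nonneg)
  finally show ?thesis by (simp add: p_def q_def)
qed

text \<open>Bounds the inverse of a Blaschke-Potapov factor, where \<open>c\<close> is the
  reciprocal of a Blaschke factor.\<close>

lemma norm_dilation_le:
  assumes P: "orthogonal_projection_matrix P" and c: "norm c \<ge> 1"
  shows "norm (dilation c P *v x) \<le> norm c * norm x"
proof (rule power2_le_imp_le)
  have x: "(norm x)\<^sup>2 = (norm (x - P *v x))\<^sup>2 + (norm (P *v x))\<^sup>2"
    using orthogonal_projection_pythagoras[OF P, of 1 x] by simp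
  have "1 * (norm (x - P *v x))\<^sup>2 \<le> (norm c)\<^sup>2 * (norm (x - P *v x))\<^sup>2"
    using c by (intro mult_right_mono) auto
  thus "(norm (dilation c P *v x))\<^sup>2 \<le> (norm c * norm x)\<^sup>2"
    unfolding orthogonal_projection_pythagoras[OF P] power_mult_distrib x by (simp add: distrib_left)
qed simp

lemma norm_projection_le:
  assumes P: "orthogonal_projection_matrix P"
  shows "norm (P *v x) \<le> norm x"
proof (rule power2_le_imp_le)
  show "(norm (P *v x))\<^sup>2 \<le> (norm x)\<^sup>2"
    using orthogonal_projection_pythagoras[OF P, of 1 x] by simp
qed simp

text \<open>As a function of \<open>c\<close> the determinant is a multiplicative polynomial, hence a power of \<open>c\<close>.\<close>

lemma det_dilation:
  fixes P :: "complex^'n^'n"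
  assumes PP: "P ** P = P" and nz: "P \<noteq> 0"
  obtains m where "1 \<le> m" "m \<le> CARD('n)" "\<And>c. det (dilation c P) = c ^ m"
proof -
  \<comment> \<open>The entries are linear in the parameter; evaluating \<open>M\<close> at
    \<open>c\<close> gives \<open>dilation c P\<close>.\<close>
  define M :: "complex poly^'n^'n" where "M = (\<chi> i j. [:(if i = j then 1 else 0) - P $ i $ j, P $ i $ j:])"
  define p where "p = det M"
  have ev: "poly p c = det (dilation c P)" for c
    unfolding p_def det_def M_def
    by (simp add: poly_sum poly_prod dilation_nth algebra_simps)
  have deg: "degree p \<le> CARD('n)"
    unfolding p_def det_def
  proof (rule degree_sum_le)
    fix \<pi> :: "'n \<Rightarrow> 'n"
    have "degree (\<Prod>i\<in>UNIV. M $ i $ \<pi> i) \<le> (\<Sum>i\<in>UNIV. degree (M $ i $ \<pi> i))"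
      using degree_prod_sum_le[of "UNIV :: 'n set" "\<lambda>i. M $ i $ \<pi> i"] by (simp add: o_def)
    also have "\<dots> \<le> (\<Sum>i\<in>(UNIV::'n set). 1)" by (intro sum_mono) (simp add: M_def degree_pCons_le)
    finally have "degree (\<Prod>i\<in>UNIV. M $ i $ \<pi> i) \<le> CARD('n)" by simp
    thus "degree (of_int (sign \<pi>) * (\<Prod>i\<in>UNIV. M $ i $ \<pi> i)) \<le> CARD('n)"
      by (intro order_trans[OF degree_mult_le]) (simp add: degree_of_int)
  qed simp
  have mult: "poly p c * poly p d = poly p (c * d)" for c d
    by (simp add: ev det_mul[symmetric] dilation_mult[OF PP])
  have "poly p 1 = 1" by (simp add: ev)
  \<comment> \<open>The index of any nonzero coefficient will do: comparing the coefficients of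
    index \<open>i\<close> in the multiplication law gives \<open>poly p d = d ^ i\<close>.\<close>
  then obtain i where i: "coeff p i \<noteq> 0" by (metis leading_coeff_0_iff poly_0 zero_neq_one)
  have pw: "poly p d = d ^ i" for d
  proof -
    have "poly (smult (poly p d) p) = poly (pcompose p [:0, d:])"
      by (rule ext) (simp add: poly_pcompose mult.commute mult[symmetric])
    hence "smult (poly p d) p = pcompose p [:0, d:]" by (simp add: poly_eq_poly_eq_iff)
    hence "coeff (smult (poly p d) p) i = coeff (pcompose p [:0, d:]) i" by simp
    hence "poly p d * coeff p i = d ^ i * coeff p i" by (simp add: coeff_pcompose_linear)
    thus ?thesis using i by simp
  qed
  \<comment> \<open>With exponent 0 the matrix \<open>dilation 0 P\<close> would be invertible,
    although it annihilates the range of \<open>P\<close>.\<close>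
  have "i \<noteq> 0"
  proof
    assume "i = 0"
    hence "det (dilation 0 P) \<noteq> 0" using pw[of 0] ev[of 0] by simp
    then obtain N where N: "N ** dilation 0 P = mat 1"
      using invertible_det_nz[of "dilation 0 P"] unfolding invertible_def by blast
    have "dilation 0 P *v (P *v x) = 0" for x
    proof -
      have "y + (0 - 1) *s y = 0" for y :: "complex^'n" by (simp add: vec_eq_iff)
      moreover have "P *v (P *v x) = P *v x" by (simp add: matrix_vector_mul_assoc PP)
      ultimately show ?thesis by (simp only: dilation_mult_vec)
    qed
    hence "N *v (dilation 0 P *v (P *v x)) = 0" for x by simp
    hence "P *v x = 0" for x by (simp add: matrix_vector_mul_assoc N matrix_mul_assoc)
    hence "P = 0" by (simp add: matrix_eq)
    thus False using nz by simp
  qed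
  moreover have "i \<le> CARD('n)" using le_degree[OF i] deg by simp
  ultimately show ?thesis using that[of i] pw ev by simp
qed

text \<open>The trace of an orthogonal projection is the sum of the squared moduli of its entries,
  which by Cauchy-Schwarz is at least 1 because \<open>P\<close> fixes a nonzero vector. This
  removes the trace weights from \<open>BP_summable\<close>.\<close>

lemma trace_projection_ge_1:
  fixes P :: "complex^'n^'n"
  assumes P: "orthogonal_projection_matrix P" and nz: "P \<noteq> 0"
  shows "1 \<le> Re (trace P)"
proof -
  obtain y where "P *v y \<noteq> 0" using nz by (metis matrix_eq matrix_vector_mult_0)
  define x where "x = P *v y"
  have x: "P *v x = x" "x \<noteq> 0"
    using P \<open>P *v y \<noteq> 0\<close> by (simp_all add: x_def matrix_vector_mul_assoc orthogonal_projection_matrix_def)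
  have herm: "P $ j $ i = cnj (P $ i $ j)" for i j
  proof -
    have "conj_transpose P $ j $ i = P $ j $ i" using P by (simp add: orthogonal_projection_matrix_def)
    thus ?thesis by (simp add: conj_transpose_def)
  qed
  have "trace P = (\<Sum>i\<in>UNIV. (P ** P) $ i $ i)"
    using P by (simp add: trace_def orthogonal_projection_matrix_def)
  also have "\<dots> = (\<Sum>i\<in>UNIV. \<Sum>j\<in>UNIV. P $ i $ j * P $ j $ i)" by (simp add: matrix_matrix_mult_def)
  also have "\<dots> = (\<Sum>i\<in>UNIV. \<Sum>j\<in>UNIV. complex_of_real ((norm (P $ i $ j))\<^sup>2))"
  proof (intro sum.cong refl)
    fix i j
    show "P $ i $ j * P $ j $ i = complex_of_real ((norm (P $ i $ j))\<^sup>2)"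
      unfolding complex_norm_square herm[where i=i and j=j] ..
  qed
  finally have tr: "Re (trace P) = (\<Sum>i\<in>UNIV. \<Sum>j\<in>UNIV. (norm (P $ i $ j))\<^sup>2)" by simp
  have "(norm x)\<^sup>2 = (\<Sum>i\<in>UNIV. (norm (x $ i))\<^sup>2)"
    by (simp add: norm_vec_def L2_set_def sum_nonneg)
  also have "\<dots> \<le> (\<Sum>i\<in>UNIV. (\<Sum>j\<in>UNIV. (norm (P $ i $ j))\<^sup>2) * (norm x)\<^sup>2)"
  proof (rule sum_mono)
    fix i
    have "x $ i = cinner x (\<chi> j. cnj (P $ i $ j))"
      using arg_cong[OF x(1), of "\<lambda>v. v $ i"] by (simp add: cinner_def matrix_vector_mult_def mult.commute)
    hence "norm (x $ i) \<le> norm x * norm (\<chi> j. cnj (P $ i $ j))" using norm_cinner_le by metis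
    hence "(norm (x $ i))\<^sup>2 \<le> (norm x * norm (\<chi> j. cnj (P $ i $ j)))\<^sup>2" by (intro power_mono) auto
    also have "\<dots> = (\<Sum>j\<in>UNIV. (norm (P $ i $ j))\<^sup>2) * (norm x)\<^sup>2"
      by (simp add: power_mult_distrib norm_vec_def L2_set_def sum_nonneg mult.commute)
    finally show "(norm (x $ i))\<^sup>2 \<le> (\<Sum>j\<in>UNIV. (norm (P $ i $ j))\<^sup>2) * (norm x)\<^sup>2" .
  qed
  also have "\<dots> = Re (trace P) * (norm x)\<^sup>2" by (simp add: tr sum_distrib_right)
  finally show ?thesis using x(2) by (simp add: mult_le_cancel_right1)
qed

definition rank_one :: "complex^'n \<Rightarrow> complex^'n^'n" where
  "rank_one v = (\<chi> i j. v $ i * cnj (v $ j))"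

lemma rank_one_mult_vec: "rank_one v *v x = cinner x v *s v"
  by (simp add: rank_one_def matrix_vector_mult_def cinner_def vec_eq_iff sum_distrib_left sum_distrib_right mult_ac)

lemma rank_one_projection:
  fixes v :: "complex^'n"
  assumes v: "norm v = 1"
  shows "orthogonal_projection_matrix (rank_one v)" "rank_one v \<noteq> 0" "trace (rank_one v) = 1"
proof -
  have vv: "cinner v v = 1" by (simp add: cinner_self v)
  show "orthogonal_projection_matrix (rank_one v)"
    unfolding orthogonal_projection_matrix_def
  proof
    have "(rank_one v ** rank_one v) *v x = rank_one v *v x" for x
      by (simp add: matrix_vector_mul_assoc[symmetric] rank_one_mult_vec cinner_scale_left vv)
    thus "rank_one v ** rank_one v = rank_one v" by (simp add: matrix_eq)
    show "conj_transpose (rank_one v) = rank_one v"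
      by (simp add: conj_transpose_def rank_one_def vec_eq_iff mult.commute)
  qed
  have "rank_one v *v v = v" by (simp add: rank_one_mult_vec vv)
  thus "rank_one v \<noteq> 0" using v by auto
  show "trace (rank_one v) = 1"
    using vv by (simp add: trace_def rank_one_def cinner_def)
qed

lemma singular_matrix_kernel:
  fixes A :: "complex^'n^'n"
  assumes "det A = 0"
  obtains v where "norm v = 1" "A *v v = 0"
proof -
  have "\<not> invertible A" using assms by (simp add: invertible_det_nz)
  then obtain u where u: "A *v u = 0" "u \<noteq> 0"
    using invertible_left_inverse[of A] matrix_left_invertible_ker[of A] by blast
  have "norm ((1 / norm u) *\<^sub>R u) = 1" using u by simp
  moreover have "A *v ((1 / norm u) *\<^sub>R u) = 0"
    using u by (simp add: linear_scale[OF matrix_vector_mul_linear])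
  ultimately show ?thesis by (rule that)
qed

lemma holomorphic_det:
  assumes "\<And>i j. (\<lambda>z. F z $ i $ j) holomorphic_on S"
  shows "(\<lambda>z. det (F z)) holomorphic_on S"
  unfolding det_def by (intro holomorphic_intros assms)

section \<open>Blaschke products\<close>

lemma norm_blaschke_factor:
  "norm (blaschke_factor a z) = norm (a - z) / norm (1 - cnj a * z)"
  by (simp add: blaschke_factor_def norm_mult norm_divide)

lemma blaschke_factor_eq_0_iff:
  assumes "norm a < 1" "norm z \<le> 1"
  shows "blaschke_factor a z = 0 \<longleftrightarrow> z = a"
  using one_minus_cnj_mult_nonzero[OF assms] by (auto simp: blaschke_factor_def)

lemma holomorphic_blaschke_factor [holomorphic_intros]:
  assumes "norm a < 1" "S \<subseteq> cball 0 1"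
  shows "blaschke_factor a holomorphic_on S"
proof (cases "a = 0")
  case True
  thus ?thesis by (simp add: blaschke_factor_def[abs_def])
next
  case False
  have "(\<lambda>z. complex_of_real (norm a) / a * ((a - z) / (1 - cnj a * z))) holomorphic_on S"
    using one_minus_cnj_mult_nonzero[OF assms(1)] assms(2) by (intro holomorphic_intros) auto
  thus ?thesis using False by (simp add: blaschke_factor_def[abs_def])
qed

lemma blaschke_factor_defect:
  assumes "norm a < 1" "norm z \<le> 1"
  shows "1 - (norm (blaschke_factor a z))\<^sup>2 = (1 - (norm a)\<^sup>2) * (1 - (norm z)\<^sup>2) / (norm (1 - cnj a * z))\<^sup>2"
proof -
  have "complex_of_real ((norm (1 - cnj a * z))\<^sup>2 - (norm (a - z))\<^sup>2) =
      complex_of_real ((1 - (norm a)\<^sup>2) * (1 - (norm z)\<^sup>2))"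
    unfolding of_real_diff of_real_mult of_real_1 complex_norm_square
    by (simp add: algebra_simps)
  hence "(norm (1 - cnj a * z))\<^sup>2 - (norm (a - z))\<^sup>2 = (1 - (norm a)\<^sup>2) * (1 - (norm z)\<^sup>2)"
    by (simp only: of_real_eq_iff)
  moreover have "norm (1 - cnj a * z) \<noteq> 0" using one_minus_cnj_mult_nonzero[OF assms] by simp
  ultimately show ?thesis
    by (simp add: norm_blaschke_factor power_divide field_simps)
qed

lemma norm_blaschke_factor_le_1:
  assumes "norm a < 1" "norm z \<le> 1"
  shows "norm (blaschke_factor a z) \<le> 1"
proof -
  have "0 \<le> 1 - (norm (blaschke_factor a z))\<^sup>2"
    unfolding blaschke_factor_defect[OF assms] using assms
    by (intro divide_nonneg_nonneg mult_nonneg_nonneg) (auto simp: power_le_one)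
  hence "(norm (blaschke_factor a z))\<^sup>2 \<le> 1\<^sup>2" by simp
  thus ?thesis by (rule power2_le_imp_le) simp
qed

text \<open>Turns a bound on the sum of the defects at one point into the Blaschke condition. The 8
  is the product of 4, an upper bound for the squared denominator in
  \<open>blaschke_factor_defect\<close>, and 2, from
  \<open>1 - b\<^sup>2 \<le> 2 * (1 - b)\<close>.\<close>

lemma blaschke_factor_defect_ge:
  assumes "norm a < 1" "norm z < 1"
  shows "(1 - norm a) * (1 - (norm z)\<^sup>2) / 8 \<le> 1 - norm (blaschke_factor a z)"
proof -
  define b where "b = norm (blaschke_factor a z)"
  have b: "0 \<le> b" "b \<le> 1" using norm_blaschke_factor_le_1[of a z] assms by (auto simp: b_def)
  have n: "0 < norm (1 - cnj a * z)" using one_minus_cnj_mult_nonzero[of a z] assms by simp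
  have "norm (1 - cnj a * z) \<le> norm (1::complex) + norm (cnj a * z)" by (rule norm_triangle_ineq4)
  also have "norm (cnj a * z) \<le> 1 * 1" unfolding norm_mult using assms by (intro mult_mono) auto
  finally have n2: "(norm (1 - cnj a * z))\<^sup>2 \<le> 2\<^sup>2" by (intro power_mono) auto
  have "(norm a)\<^sup>2 \<le> norm a" using assms by (simp add: power2_eq_square mult_left_le)
  moreover have z1: "(norm z)\<^sup>2 \<le> 1" using assms by (simp add: power_le_one)
  ultimately have "(1 - norm a) * (1 - (norm z)\<^sup>2) / 2\<^sup>2 \<le> (1 - (norm a)\<^sup>2) * (1 - (norm z)\<^sup>2) / (norm (1 - cnj a * z))\<^sup>2"
    using n n2 assms by (intro frac_le mult_right_mono mult_nonneg_nonneg) (auto simp: power_le_one)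
  also have "\<dots> = 1 - b\<^sup>2" unfolding b_def by (rule blaschke_factor_defect[symmetric]) (use assms in auto)
  also have "\<dots> = (1 - b) * (1 + b)" by (simp add: power2_eq_square algebra_simps)
  also have "\<dots> \<le> (1 - b) * 2" using b by (intro mult_left_mono) auto
  finally show ?thesis by (simp add: b_def)
qed

text \<open>Shows how fast the modulus tends to 1 at the circle, uniformly in the direction; this
  feeds the maximum principle in \<open>peel_BP_factor\<close>.\<close>

lemma norm_blaschke_factor_ge:
  assumes "norm a < 1" "norm z \<le> 1"
  shows "1 - (1 - (norm z)\<^sup>2) / (1 - norm a)\<^sup>2 \<le> (norm (blaschke_factor a z))\<^sup>2"
proof -
  have "norm (cnj a * z) \<le> norm a * 1" unfolding norm_mult using assms by (intro mult_mono) auto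
  hence "1 - norm a \<le> norm (1 - cnj a * z)" using norm_triangle_ineq2[of 1 "cnj a * z"] by simp
  hence "(1 - norm a)\<^sup>2 \<le> (norm (1 - cnj a * z))\<^sup>2" using assms by (intro power_mono) auto
  moreover have "(1 - (norm a)\<^sup>2) * (1 - (norm z)\<^sup>2) \<le> 1 * (1 - (norm z)\<^sup>2)"
    using assms by (intro mult_right_mono) (auto simp: power_le_one)
  ultimately have "(1 - (norm a)\<^sup>2) * (1 - (norm z)\<^sup>2) / (norm (1 - cnj a * z))\<^sup>2 \<le> 1 * (1 - (norm z)\<^sup>2) / (1 - norm a)\<^sup>2"
    using assms by (intro frac_le) (auto simp: power_le_one)
  thus ?thesis using blaschke_factor_defect[OF assms] by simp
qed

text \<open>The normalising constant \<open>norm a / a\<close> makes \<open>1 - norm a\<close> split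
  off from the difference, so under the Blaschke condition these differences are summable at each
  point.\<close>

lemma norm_one_minus_blaschke_factor:
  assumes "norm a < 1" "norm z < 1"
  shows "norm (blaschke_factor a z - 1) \<le> 2 * (1 - norm a) / (1 - norm z)"
proof (cases "a = 0")
  case True
  have "norm (z - 1) \<le> norm z + norm (1::complex)" by (rule norm_triangle_ineq4)
  also have "\<dots> \<le> 2" using assms by simp
  also have "\<dots> \<le> 2 / (1 - norm z)" using assms by (simp add: field_simps)
  finally show ?thesis using True by (simp add: blaschke_factor_def)
next
  case False
  have nz: "1 - cnj a * z \<noteq> 0" using one_minus_cnj_mult_nonzero[of a z] assms by simp
  have aa: "a * cnj a = complex_of_real (norm a) * complex_of_real (norm a)"
    using complex_norm_square[of a] by (simp add: power2_eq_square)
  have "blaschke_factor a z - 1 = (complex_of_real (norm a) * (a - z) - a * (1 - cnj a * z)) / (a * (1 - cnj a * z))"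
    using False nz by (simp add: blaschke_factor_def field_simps)
  also have "complex_of_real (norm a) * (a - z) - a * (1 - cnj a * z) =
      - (1 - complex_of_real (norm a)) * (a + complex_of_real (norm a) * z)"
  proof -
    have e: "a * (1 - cnj a * z) = a - complex_of_real (norm a) * complex_of_real (norm a) * z"
      using aa by (simp add: right_diff_distrib mult.assoc[symmetric])
    show ?thesis unfolding e by (simp add: algebra_simps)
  qed
  finally have "norm (blaschke_factor a z - 1) =
      norm (1 - complex_of_real (norm a)) * norm (a + complex_of_real (norm a) * z) / (norm a * norm (1 - cnj a * z))"
    by (simp only: norm_divide norm_mult norm_minus_cancel)
  also have "norm (1 - complex_of_real (norm a)) = 1 - norm a"
    using assms by (metis abs_of_pos diff_gt_0_iff_gt norm_of_real of_real_1 of_real_diff)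
  also have "(1 - norm a) * norm (a + complex_of_real (norm a) * z) / (norm a * norm (1 - cnj a * z)) \<le>
      (1 - norm a) * (norm a * 2) / (norm a * (1 - norm z))"
  proof (intro frac_le mult_left_mono)
    have "norm (a + complex_of_real (norm a) * z) \<le> norm a + norm a * norm z"
      using norm_triangle_ineq[of a "complex_of_real (norm a) * z"] by (simp add: norm_mult)
    also have "norm a * norm z \<le> norm a * 1" using assms by (intro mult_left_mono) auto
    finally show "norm (a + complex_of_real (norm a) * z) \<le> norm a * 2" by simp
    have "norm (cnj a * z) \<le> 1 * norm z" unfolding norm_mult using assms by (intro mult_right_mono) auto
    thus "1 - norm z \<le> norm (1 - cnj a * z)" using norm_triangle_ineq2[of 1 "cnj a * z"] by simp
  qed (use assms False in auto)
  also have "\<dots> = 2 * (1 - norm a) / (1 - norm z)" using False by simp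
  finally show ?thesis .
qed

text \<open>A point of the circle is an arc of length 0.\<close>

lemma AE_circle_neq: "AE t in circle_measure. t \<noteq> t0"
proof (cases "t0 \<in> sphere 0 1")
  case True
  define x where "x = Arg2pi t0"
  have x: "0 \<le> x" "x < 2 * pi" "t0 = cis x"
    using Arg2pi[of t0] True by (auto simp: x_def cis_conv_exp mult.commute is_Arg_def)
  have "measure circle_measure {t0} \<le> 0" using circle_arc(2)[of x x] x by simp
  hence "emeasure circle_measure {t0} = 0"
    using measure_nonneg[of circle_measure "{t0}"] by (simp add: circle.emeasure_eq_measure)
  moreover have "{t0} \<in> sets circle_measure" using True by (intro sets_circle_measureI) auto
  ultimately show ?thesis by (intro AE_I[of _ _ "{t0}"]) auto
next
  case False
  thus ?thesis by (intro AE_I2) auto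
qed

text \<open>The limiting case \<open>norm c = 1\<close> is obtained from \<open>norm c < 1\<close> by Fatou's lemma.\<close>

lemma ln_one_minus_circle:
  assumes c: "norm c \<le> 1"
  shows "integrable circle_measure (\<lambda>t. ln (norm (1 - c * t)))" "0 \<le> (LINT t|circle_measure. ln (norm (1 - c * t)))"
proof -
  define s where "s k = 1 - 1 / (real k + 2)" for k :: nat
  have s: "0 < s k" "s k < 1" for k by (auto simp: s_def field_simps)
  have slim: "s \<longlonglongrightarrow> 1" unfolding s_def by real_asymp
  \<comment> \<open>As \<open>1 - c * w\<close> has modulus at most 2 on the closed disc, the
    constant \<open>ln 2\<close> makes these functions nonnegative, as Fatou's lemma asks.\<close>
  define u where "u k t = ln 2 - ln (norm (1 - c * (complex_of_real (s k) * t)))" for k t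
  define v where "v t = ln 2 - ln (norm (1 - c * t))" for t
  have ct: "norm (c * w) < 1" if "norm w < 1" for w
  proof -
    have "norm c * norm w \<le> 1 * norm w" using c by (intro mult_right_mono) auto
    thus ?thesis using that by (simp add: norm_mult)
  qed
  have nz: "1 - c * w \<noteq> 0" if "norm w < 1" for w
    using ct[OF that] by auto
  have le2: "ln (norm (1 - c * w)) \<le> ln 2" if "norm w \<le> 1" for w
  proof (cases "1 - c * w = 0")
    case False
    have "norm (1 - c * w) \<le> norm (1::complex) + norm (c * w)" by (rule norm_triangle_ineq4)
    also have "norm (c * w) \<le> 1 * 1" unfolding norm_mult using c that by (intro mult_mono) auto
    finally show ?thesis using False by simp
  qed simp
  have st: "norm (complex_of_real (s k) * t) < 1" if "norm t = 1" for k t using s[of k] that by (simp add: norm_mult)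
  have um: "u k \<in> borel_measurable circle_measure" for k
    unfolding u_def by measurable
  have vm: "v \<in> borel_measurable circle_measure" unfolding v_def by measurable
  have v0: "0 \<le> v t" if "norm t = 1" for t using le2[of t] that by (simp add: v_def)
  have ui: "(\<integral>\<^sup>+ t. ennreal (u k t) \<partial>circle_measure) = ennreal (ln 2)" for k
  proof -
    have h: "(\<lambda>z. 1 - c * z) holomorphic_on ball 0 1" by (intro holomorphic_intros)
    have i: "integrable circle_measure (\<lambda>t. ln (norm (1 - c * (complex_of_real (s k) * t))))"
      "(LINT t|circle_measure. ln (norm (1 - c * (complex_of_real (s k) * t)))) = 0"
      using ln_norm_mean_value_dilate[OF h, of "s k"] s[of k] nz by auto
    have "(\<integral>\<^sup>+ t. ennreal (u k t) \<partial>circle_measure) = ennreal (LINT t|circle_measure. u k t)"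
    proof (rule nn_integral_eq_integral)
      show "integrable circle_measure (u k)" unfolding u_def by (intro Bochner_Integration.integrable_diff i) auto
      show "AE t in circle_measure. 0 \<le> u k t"
        using le2 st by (intro AE_I2) (auto simp: u_def less_imp_le)
    qed
    also have "(LINT t|circle_measure. u k t) = ln 2"
      unfolding u_def using circle.prob_space i by (subst Bochner_Integration.integral_diff) auto
    finally show ?thesis .
  qed
  have "(\<integral>\<^sup>+ t. ennreal (v t) \<partial>circle_measure) \<le> (\<integral>\<^sup>+ t. liminf (\<lambda>k. ennreal (u k t)) \<partial>circle_measure)"
  proof (intro nn_integral_mono_AE)
    have "AE t in circle_measure. t \<in> sphere 0 1 \<and> t \<noteq> 1 / c"
      using AE_circle_neq[of "1 / c"] AE_space[of circle_measure] by eventually_elim simp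
    thus "AE t in circle_measure. ennreal (v t) \<le> liminf (\<lambda>k. ennreal (u k t))"
    proof eventually_elim
      case (elim t)
      hence "1 - c * t \<noteq> 0" by (cases "c = 0") (auto simp: eq_divide_eq mult.commute)
      hence nz1: "norm (1 - c * t) \<noteq> 0" by simp
      have "(\<lambda>k. 1 - c * (complex_of_real (s k) * t)) \<longlonglongrightarrow> 1 - c * (complex_of_real 1 * t)"
        by (intro tendsto_intros slim)
      hence "(\<lambda>k. norm (1 - c * (complex_of_real (s k) * t))) \<longlonglongrightarrow> norm (1 - c * t)"
        by (intro tendsto_norm) simp
      from tendsto_diff[OF tendsto_const tendsto_ln[OF this nz1]]
      have "(\<lambda>k. u k t) \<longlonglongrightarrow> v t" unfolding u_def v_def .
      from tendsto_ennrealI[OF this] have "liminf (\<lambda>k. ennreal (u k t)) = ennreal (v t)"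
        by (intro lim_imp_Liminf) auto
      thus ?case by simp
    qed
  qed
  also have "\<dots> \<le> liminf (\<lambda>k. \<integral>\<^sup>+ t. ennreal (u k t) \<partial>circle_measure)"
    using um by (intro nn_integral_liminf) auto
  also have "\<dots> = ennreal (ln 2)" by (simp add: ui Liminf_const)
  finally have le: "(\<integral>\<^sup>+ t. ennreal (v t) \<partial>circle_measure) \<le> ennreal (ln 2)" .
  have vi: "integrable circle_measure v"
  proof (rule integrableI_bounded[OF vm])
    have "(\<integral>\<^sup>+ t. ennreal (norm (v t)) \<partial>circle_measure) = (\<integral>\<^sup>+ t. ennreal (v t) \<partial>circle_measure)"
      using v0 by (intro nn_integral_cong) auto
    also have "\<dots> < \<infinity>" using le by (simp add: order_le_less_trans)
    finally show "(\<integral>\<^sup>+ t. ennreal (norm (v t)) \<partial>circle_measure) < \<infinity>" .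
  qed
  have eq: "(\<lambda>t. ln (norm (1 - c * t))) = (\<lambda>t. ln 2 - v t)" by (simp add: v_def)
  show "integrable circle_measure (\<lambda>t. ln (norm (1 - c * t)))"
    unfolding eq by (intro Bochner_Integration.integrable_diff vi) auto
  have "ennreal (LINT t|circle_measure. v t) = (\<integral>\<^sup>+ t. ennreal (v t) \<partial>circle_measure)"
    using v0 by (intro nn_integral_eq_integral[symmetric] vi AE_I2) auto
  hence "ennreal (LINT t|circle_measure. v t) \<le> ennreal (ln 2)" using le by simp
  hence "(LINT t|circle_measure. v t) \<le> ln 2" by (subst (asm) ennreal_le_iff) auto
  thus "0 \<le> (LINT t|circle_measure. ln (norm (1 - c * t)))"
    unfolding eq using circle.prob_space vi by (subst Bochner_Integration.integral_diff) auto
qed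

text \<open>The Jensen lower bound for one factor. On the circle the numerator has the modulus of a
  constant times \<open>1 - c * t\<close> with \<open>norm c \<le> 1\<close>, while the denominator
  has no zeros in the disc and contributes mean 0.\<close>

lemma ln_blaschke_factor_circle:
  assumes a: "norm a < 1" and s: "0 < s" "s < 1"
  shows "integrable circle_measure (\<lambda>t. ln (norm (blaschke_factor a (complex_of_real s * t))))" (is "integrable _ ?f")
    and "ln (max (norm a) s) \<le> (LINT t|circle_measure. ln (norm (blaschke_factor a (complex_of_real s * t))))"
proof -
  \<comment> \<open>If \<open>a\<close> lies inside the circle of radius \<open>s\<close>,
    conjugation on \<open>norm t = 1\<close> reflects the zero to the outside; otherwise
    \<open>a\<close> itself is factored out.\<close>
  define c where "c = (if norm a \<le> s then cnj a / s else s / a)"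
  define d where "d = cnj a * s"
  have d1: "norm d < 1"
  proof -
    have "norm a * s \<le> norm a * 1" using s by (intro mult_left_mono) auto
    thus ?thesis using a s by (simp add: d_def norm_mult)
  qed
  have c: "norm c \<le> 1" using s by (auto simp: c_def norm_divide divide_simps)
  have h: "(\<lambda>z. 1 - cnj a * z) holomorphic_on ball 0 1" by (intro holomorphic_intros)
  have dI: "(LINT t|circle_measure. ln (norm (1 - d * t))) = 0"
    using ln_norm_mean_value_dilate(1)[OF h, of s] s one_minus_cnj_mult_nonzero[OF a] by (auto simp: d_def mult.assoc)
  define g where "g t = ln (max (norm a) s) + ln (norm (1 - c * t)) - ln (norm (1 - d * t))" for t
  have gi: "integrable circle_measure g"
    unfolding g_def using c d1
    by (intro Bochner_Integration.integrable_diff Bochner_Integration.integrable_add ln_one_minus_circle) auto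
  have fm: "?f \<in> borel_measurable circle_measure"
    unfolding norm_blaschke_factor by measurable
  have ae: "AE t in circle_measure. ?f t = g t"
  proof -
    have "AE t in circle_measure. t \<in> sphere 0 1 \<and> t \<noteq> a / s"
      using AE_circle_neq[of "a / s"] AE_space[of circle_measure] by eventually_elim simp
    thus ?thesis
    proof eventually_elim
      case (elim t)
      hence t: "norm t = 1" by simp
      have nz: "a - complex_of_real s * t \<noteq> 0" using elim s by (auto simp: field_simps)
      have "norm (complex_of_real s * t) \<le> 1" using s t by (simp add: norm_mult)
      from one_minus_cnj_mult_nonzero[OF a this] have dz: "1 - d * t \<noteq> 0" by (simp add: d_def mult.assoc)
      have key: "norm (a - complex_of_real s * t) = max (norm a) s * norm (1 - c * t)"
      proof (cases "norm a \<le> s")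
        case True
        have "1 - c * t = cnj (complex_of_real s * t - a) * t / s"
        proof -
          have "cnj t * t = 1" using t complex_norm_square[of t] by (simp add: mult.commute)
          hence "cnj (complex_of_real s * t - a) * t = complex_of_real s - cnj a * t"
            by (simp add: algebra_simps mult.assoc)
          thus ?thesis using True s by (simp add: c_def divide_simps)
        qed
        hence "norm (1 - c * t) = norm (complex_of_real s * t - a) / s"
          using t s by (simp add: norm_mult norm_divide del: complex_cnj_diff complex_cnj_mult)
        thus ?thesis using True s by (simp add: norm_minus_commute max_def)
      next
        case False
        hence "a \<noteq> 0" using s by auto
        hence "a - complex_of_real s * t = a * (1 - c * t)" using False by (simp add: c_def algebra_simps)
        thus ?thesis using False by (simp add: norm_mult max_def)
      qed
      have m0: "max (norm a) s > 0" using s by (simp add: less_max_iff_disj)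
      have "norm (1 - c * t) > 0" using key nz m0 by (metis mult_zero_right norm_eq_zero zero_less_norm_iff)
      hence "ln (norm (a - complex_of_real s * t)) = ln (max (norm a) s) + ln (norm (1 - c * t))"
        unfolding key using m0 by (simp add: ln_mult)
      thus ?case using nz dz
        by (simp add: g_def norm_blaschke_factor ln_div d_def mult.assoc)
    qed
  qed
  show "integrable circle_measure ?f"
    using integrable_cong_AE[OF fm borel_measurable_integrable[OF gi] ae] gi by simp
  have "(LINT t|circle_measure. ?f t) = (LINT t|circle_measure. g t)"
    by (rule integral_cong_AE[OF fm borel_measurable_integrable[OF gi] ae])
  also have "\<dots> = ln (max (norm a) s) + (LINT t|circle_measure. ln (norm (1 - c * t))) - 0"
    unfolding g_def using c d1 circle.prob_space ln_one_minus_circle(1)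
    by (subst Bochner_Integration.integral_diff, simp, simp, subst Bochner_Integration.integral_add) (auto simp: dI)
  finally show "ln (max (norm a) s) \<le> (LINT t|circle_measure. ?f t)"
    using ln_one_minus_circle(2)[OF c] by simp
qed

text \<open>The exponents \<open>m k\<close> stand for those occurring in the determinants of
  Blaschke-Potapov factors.\<close>

lemma ln_blaschke_product_circle:
  fixes a :: "nat \<Rightarrow> complex" and m :: "nat \<Rightarrow> nat"
  assumes a: "\<And>k. k < N \<Longrightarrow> norm (a k) < 1" and s: "0 < s" "s < 1"
  defines "B \<equiv> \<lambda>z. \<Prod>k<N. norm (blaschke_factor (a k) z) ^ m k"
  shows "AE t in circle_measure. \<forall>k<N. blaschke_factor (a k) (complex_of_real s * t) \<noteq> 0"
    and "AE t in circle_measure. ln (B (complex_of_real s * t)) = (\<Sum>k<N. real (m k) * ln (norm (blaschke_factor (a k) (complex_of_real s * t))))"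
    and "integrable circle_measure (\<lambda>t. \<Sum>k<N. real (m k) * ln (norm (blaschke_factor (a k) (complex_of_real s * t))))"
    and "(\<Sum>k<N. real (m k) * ln (max (norm (a k)) s)) \<le>
      (LINT t|circle_measure. (\<Sum>k<N. real (m k) * ln (norm (blaschke_factor (a k) (complex_of_real s * t)))))"
proof -
  have "AE t in circle_measure. t \<noteq> a k / s" for k by (rule AE_circle_neq)
  hence "AE t in circle_measure. \<forall>k. t \<noteq> a k / s" by (simp add: AE_all_countable)
  with AE_space[of circle_measure]
  show ae: "AE t in circle_measure. \<forall>k<N. blaschke_factor (a k) (complex_of_real s * t) \<noteq> 0"
  proof eventually_elim
    case (elim t)
    show ?case
    proof (intro allI impI)
      fix k assume k: "k < N"
      have "norm (complex_of_real s * t) \<le> 1" using s elim by (simp add: norm_mult)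
      moreover have "complex_of_real s * t \<noteq> a k" using elim s by (auto simp: field_simps)
      ultimately show "blaschke_factor (a k) (complex_of_real s * t) \<noteq> 0"
        using blaschke_factor_eq_0_iff[OF a[OF k]] by blast
    qed
  qed
  show "AE t in circle_measure. ln (B (complex_of_real s * t)) = (\<Sum>k<N. real (m k) * ln (norm (blaschke_factor (a k) (complex_of_real s * t))))"
    using ae
  proof eventually_elim
    case (elim t)
    thus ?case unfolding B_def by (subst ln_prod) (auto intro!: sum.cong simp: ln_realpow)
  qed
  show i: "integrable circle_measure (\<lambda>t. \<Sum>k<N. real (m k) * ln (norm (blaschke_factor (a k) (complex_of_real s * t))))"
    by (intro Bochner_Integration.integrable_sum integrable_mult_right ln_blaschke_factor_circle a s) auto
  have "(LINT t|circle_measure. (\<Sum>k<N. real (m k) * ln (norm (blaschke_factor (a k) (complex_of_real s * t))))) =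
      (\<Sum>k<N. real (m k) * (LINT t|circle_measure. ln (norm (blaschke_factor (a k) (complex_of_real s * t)))))"
    by (subst Bochner_Integration.integral_sum)
      (auto intro!: integrable_mult_right ln_blaschke_factor_circle a s)
  thus "(\<Sum>k<N. real (m k) * ln (max (norm (a k)) s)) \<le>
      (LINT t|circle_measure. (\<Sum>k<N. real (m k) * ln (norm (blaschke_factor (a k) (complex_of_real s * t)))))"
    by (auto intro!: sum_mono mult_left_mono ln_blaschke_factor_circle a s)
qed

lemma minus_ln_le:
  assumes "1 / 2 \<le> x" "x \<le> (1::real)"
  shows "- ln x \<le> 2 * (1 - x)"
proof -
  have "- ln x = ln (1 / x)" using assms by (simp add: ln_div)
  also have "\<dots> \<le> 1 / x - 1" using assms by (intro ln_le_minus_one) auto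
  also have "\<dots> = (1 - x) / x" using assms by (simp add: field_simps)
  also have "\<dots> \<le> (1 - x) / (1 / 2)" using assms by (intro divide_left_mono) auto
  finally show ?thesis by simp
qed

text \<open>The mean is at most 0 because the product is bounded by 1. From below, factor
  \<open>k\<close> costs at most \<open>- m k * ln (max (norm (a k)) s)\<close>; Fatou's lemma
  passes this cost to the infinite product, and by Tannery's theorem the total cost vanishes as
  \<open>s\<close> tends to 1.\<close>

theorem blaschke_product_mean_tendsto_0:
  fixes a :: "nat \<Rightarrow> complex" and m :: "nat \<Rightarrow> nat" and \<theta> :: "complex \<Rightarrow> complex"
  assumes a: "\<And>k. norm (a k) < 1" and summ: "summable (\<lambda>k. real (m k) * (1 - norm (a k)))"
    and hol: "\<theta> holomorphic_on ball 0 1"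
    and lim: "\<And>z. z \<in> ball 0 1 \<Longrightarrow> (\<lambda>N. \<Prod>k<N. norm (blaschke_factor (a k) z) ^ m k) \<longlonglongrightarrow> norm (\<theta> z)"
  shows "((\<lambda>s. LINT t|circle_measure. ln (norm (\<theta> (complex_of_real s * t)))) \<longlongrightarrow> 0) (at_left 1)"
proof -
  \<comment> \<open>The largest possible loss caused by factor \<open>k\<close>. For
    \<open>s > 1/2\<close> it is at most twice the corresponding Blaschke term, a majorant that does
    not depend on \<open>s\<close>.\<close>
  define w where "w s k = real (m k) * - ln (max (norm (a k)) s)" for s k
  have w: "0 \<le> w s k" "w s k \<le> 2 * (real (m k) * (1 - norm (a k)))" if "1/2 < s" "s < 1" for s k
  proof -
    define x where "x = max (norm (a k)) s"
    have x: "1/2 \<le> x" "x \<le> 1" "norm (a k) \<le> x" using that a[of k] by (auto simp: x_def)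
    have "0 \<le> - ln x" using x by simp
    thus "0 \<le> w s k" unfolding w_def x_def[symmetric] by (intro mult_nonneg_nonneg) auto
    have "- ln x \<le> 2 * (1 - norm (a k))" using minus_ln_le[OF x(1,2)] x(3) by simp
    hence "real (m k) * - ln x \<le> real (m k) * (2 * (1 - norm (a k)))" by (intro mult_left_mono) auto
    thus "w s k \<le> 2 * (real (m k) * (1 - norm (a k)))"
      unfolding w_def x_def[symmetric] by (simp add: algebra_simps)
  qed
  have ws: "summable (w s)" if "1/2 < s" "s < 1" for s
    by (rule summable_comparison_test'[OF summable_mult[OF summ, of 2]]) (use w[OF that] in auto)
  define G where "G s = (\<Sum>k. w s k)" for s
  have near: "\<forall>\<^sub>F s in at_left 1. (s::real) \<in> {1/2<..<1}" by (rule eventually_at_leftI[of "1/2"]) auto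
  have G0: "(G \<longlongrightarrow> 0) (at_left 1)"
  proof -
    have "\<forall>\<^sub>F s in at_left 1. summable (\<lambda>k. norm (w s k))"
      "summable (\<lambda>k::nat. norm (0::real))"
      "((\<lambda>s. \<Sum>k. w s k) \<longlongrightarrow> (\<Sum>k. 0)) (at_left 1)"
    proof (atomize (full), rule tannerys_theorem[where M="\<lambda>k. 2 * (real (m k) * (1 - norm (a k)))"])
      show "((\<lambda>s. w s k) \<longlongrightarrow> 0) (at_left 1)" for k
      proof -
        have "((\<lambda>s. w s k) \<longlongrightarrow> real (m k) * - ln (max (norm (a k)) 1)) (at_left 1)"
          unfolding w_def using a[of k] by (intro tendsto_intros) (simp add: max_def)
        moreover have "max (norm (a k)) 1 = 1" using a[of k] by simp
        ultimately show ?thesis by simp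
      qed
      show "\<forall>\<^sub>F (k, s) in at_top \<times>\<^sub>F at_left 1. norm (w s k) \<le> 2 * (real (m k) * (1 - norm (a k)))"
      proof -
        have "\<forall>\<^sub>F p in (at_top :: nat filter) \<times>\<^sub>F at_left (1::real). snd p \<in> {1/2<..<1}"
          by (rule eventually_compose_filterlim[OF near filterlim_snd])
        thus ?thesis by eventually_elim (use w in \<open>auto split: prod.splits\<close>)
      qed
      show "summable (\<lambda>k. 2 * (real (m k) * (1 - norm (a k))))" by (rule summable_mult[OF summ])
    qed simp
    thus ?thesis by (simp add: G_def[abs_def])
  qed
  have \<theta>1: "norm (\<theta> z) \<le> 1" if "z \<in> ball 0 1" for z
    by (rule LIMSEQ_le_const2[OF lim[OF that]])
      (use that norm_blaschke_factor_le_1[OF a] in \<open>auto intro!: prod_le_1 power_le_one\<close>)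
  have bound: "- G s \<le> (LINT t|circle_measure. ln (norm (\<theta> (complex_of_real s * t))))"
     "(LINT t|circle_measure. ln (norm (\<theta> (complex_of_real s * t)))) \<le> 0" if s: "1/2 < s" "s < 1" for s
  proof -
    define f where "f t = - ln (norm (\<theta> (complex_of_real s * t)))" for t
    have s0: "0 < s" using s by simp
    have inb: "complex_of_real s * t \<in> ball 0 1" if "t \<in> sphere 0 1" for t using s that by (simp add: norm_mult)
    have f0: "0 \<le> f t" if "t \<in> sphere 0 1" for t
      using \<theta>1[OF inb[OF that]] by (cases "\<theta> (complex_of_real s * t) = 0") (auto simp: f_def)
    have fm: "f \<in> borel_measurable circle_measure"
    proof -
      have [measurable]: "(\<lambda>t. \<theta> (complex_of_real s * t)) \<in> borel_measurable circle_measure"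
        by (intro circle_borel_measurable_continuous continuous_on_dilate hol) (use s in auto)
      show ?thesis unfolding f_def by measurable
    qed
    define S where "S N t = (\<Sum>k<N. real (m k) * ln (norm (blaschke_factor (a k) (complex_of_real s * t))))" for N t
    note prod_ln = ln_blaschke_product_circle(2)[where a=a and m=m, OF a s0 s(2), folded S_def]
    note prod_int = ln_blaschke_product_circle(3)[where a=a and m=m, OF a s0 s(2), folded S_def]
    note prod_le = ln_blaschke_product_circle(4)[where a=a and m=m, OF a s0 s(2), folded S_def]
    have S0: "S N t \<le> 0" if "t \<in> sphere 0 1" for N t
      unfolding S_def
    proof (intro sum_nonpos mult_nonneg_nonpos)
      fix k
      have "norm (blaschke_factor (a k) (complex_of_real s * t)) \<le> 1"
        using inb[OF that] by (intro norm_blaschke_factor_le_1 a) auto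
      thus "ln (norm (blaschke_factor (a k) (complex_of_real s * t))) \<le> 0"
        by (cases "blaschke_factor (a k) (complex_of_real s * t) = 0") auto
    qed auto
    have SI: "(\<integral>\<^sup>+ t. ennreal (- S N t) \<partial>circle_measure) \<le> ennreal (G s)" for N
    proof -
      have "(\<integral>\<^sup>+ t. ennreal (- S N t) \<partial>circle_measure) = ennreal (LINT t|circle_measure. - S N t)"
        using S0 prod_int[of N] by (intro nn_integral_eq_integral) (auto simp: S_def)
      also have "(LINT t|circle_measure. - S N t) \<le> (\<Sum>k<N. w s k)"
        using prod_le[of N] by (simp add: w_def sum_negf)
      also have "\<dots> \<le> G s" unfolding G_def using w[OF s] by (intro sum_le_suminf ws s) auto
      finally show ?thesis by (simp add: ennreal_leI)
    qed
    have "(\<integral>\<^sup>+ t. ennreal (f t) \<partial>circle_measure) \<le> (\<integral>\<^sup>+ t. liminf (\<lambda>N. ennreal (- S N t)) \<partial>circle_measure)"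
    proof (intro nn_integral_mono_AE)
      have "AE t in circle_measure. \<forall>N. ln (\<Prod>k<N. norm (blaschke_factor (a k) (complex_of_real s * t)) ^ m k) = S N t"
        using prod_ln by (simp add: AE_all_countable)
      with AE_space[of circle_measure]
      show "AE t in circle_measure. ennreal (f t) \<le> liminf (\<lambda>N. ennreal (- S N t))"
      proof eventually_elim
        case (elim t)
        show ?case
        proof (cases "\<theta> (complex_of_real s * t) = 0")
          \<comment> \<open>At a zero of \<open>\<theta>\<close> the convention
            \<open>ln 0 = 0\<close> gives \<open>f t = 0\<close>, so the inequality is
            trivial.\<close>
          case True
          thus ?thesis by (simp add: f_def)
        next
          case False
          have "(\<lambda>N. ln (\<Prod>k<N. norm (blaschke_factor (a k) (complex_of_real s * t)) ^ m k))
              \<longlonglongrightarrow> ln (norm (\<theta> (complex_of_real s * t)))"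
            using False elim inb by (intro tendsto_ln lim) auto
          hence "(\<lambda>N. - S N t) \<longlonglongrightarrow> f t"
            using elim(2) unfolding f_def by (intro tendsto_minus) simp
          from tendsto_ennrealI[OF this] have "liminf (\<lambda>N. ennreal (- S N t)) = ennreal (f t)"
            by (intro lim_imp_Liminf) auto
          thus ?thesis by simp
        qed
      qed
    qed
    also have "\<dots> \<le> liminf (\<lambda>N. \<integral>\<^sup>+ t. ennreal (- S N t) \<partial>circle_measure)"
      using prod_int by (intro nn_integral_liminf) (auto simp: S_def)
    also have "\<dots> \<le> liminf (\<lambda>N. ennreal (G s))"
      by (intro Liminf_mono always_eventually allI SI)
    finally have le: "(\<integral>\<^sup>+ t. ennreal (f t) \<partial>circle_measure) \<le> ennreal (G s)" by (simp add: Liminf_const)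
    have fi: "integrable circle_measure f"
    proof (rule integrableI_bounded[OF fm])
      have "(\<integral>\<^sup>+ t. ennreal (norm (f t)) \<partial>circle_measure) = (\<integral>\<^sup>+ t. ennreal (f t) \<partial>circle_measure)"
        using f0 by (intro nn_integral_cong) auto
      also have "\<dots> < \<infinity>" using le by (simp add: order_le_less_trans)
      finally show "(\<integral>\<^sup>+ t. ennreal (norm (f t)) \<partial>circle_measure) < \<infinity>" .
    qed
    have "ennreal (LINT t|circle_measure. f t) = (\<integral>\<^sup>+ t. ennreal (f t) \<partial>circle_measure)"
      using f0 by (intro nn_integral_eq_integral[symmetric] fi AE_I2) auto
    hence "ennreal (LINT t|circle_measure. f t) \<le> ennreal (G s)" using le by simp
    moreover have "G s \<ge> 0" unfolding G_def using w[OF s] ws[OF s] by (intro suminf_nonneg) auto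
    ultimately have "(LINT t|circle_measure. f t) \<le> G s" by (simp add: ennreal_le_iff)
    moreover have "(LINT t|circle_measure. f t) \<ge> 0" using f0 by (intro Bochner_Integration.integral_nonneg) auto
    ultimately show "- G s \<le> (LINT t|circle_measure. ln (norm (\<theta> (complex_of_real s * t))))"
      "(LINT t|circle_measure. ln (norm (\<theta> (complex_of_real s * t)))) \<le> 0"
      by (simp_all add: f_def)
  qed
  show ?thesis
  proof (rule tendsto_sandwich)
    show "\<forall>\<^sub>F s in at_left 1. - G s \<le> (LINT t|circle_measure. ln (norm (\<theta> (complex_of_real s * t))))"
      using near by eventually_elim (use bound in auto)
    show "\<forall>\<^sub>F s in at_left 1. (LINT t|circle_measure. ln (norm (\<theta> (complex_of_real s * t)))) \<le> 0"
      using near by eventually_elim (use bound in auto)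
    show "((\<lambda>s. - G s) \<longlongrightarrow> 0) (at_left 1)" using tendsto_minus[OF G0] by simp
  qed simp
qed

section \<open>Blaschke-Potapov products\<close>

text \<open>Splitting off a Blaschke-Potapov factor, multiplying by a unitary constant and
  transposing all stay in this class, so the factorisation is carried out here.\<close>

definition schur_class :: "(complex \<Rightarrow> complex^'n^'n) set" where
  "schur_class = {\<Theta>. \<Theta> matrix_holomorphic_on ball 0 1 \<and> (\<forall>z\<in>ball 0 1. opnorm (\<Theta> z) \<le> 1)}"

lemma schur_class_entry: "\<Theta> \<in> schur_class \<Longrightarrow> (\<lambda>z. \<Theta> z $ i $ j) holomorphic_on ball 0 1"
  by (simp add: schur_class_def matrix_holomorphic_on_def)

lemma schur_class_det: "\<Theta> \<in> schur_class \<Longrightarrow> (\<lambda>z. det (\<Theta> z)) holomorphic_on ball 0 1"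
  by (intro holomorphic_det schur_class_entry)

lemma schur_class_opnorm: "\<Theta> \<in> schur_class \<Longrightarrow> z \<in> ball 0 1 \<Longrightarrow> opnorm (\<Theta> z) \<le> 1"
  by (simp add: schur_class_def)

lemma schur_class_norm_det: "\<Theta> \<in> schur_class \<Longrightarrow> z \<in> ball 0 1 \<Longrightarrow> norm (det (\<Theta> z)) \<le> 1"
  by (intro norm_det_contraction schur_class_opnorm)

lemma inner_class_schur: "\<Theta> \<in> inner_class \<Longrightarrow> \<Theta> \<in> schur_class"
  by (simp add: inner_class_def schur_class_def)

lemma matrix_mult_nth: "(A ** B) $ i $ j = (\<Sum>k\<in>UNIV. A $ i $ k * B $ k $ j)"
  by (simp add: matrix_matrix_mult_def)

lemma tendsto_matrix_entry: "(f \<longlongrightarrow> l) F \<Longrightarrow> ((\<lambda>x. f x $ i $ j) \<longlongrightarrow> l $ i $ j) F"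
  by (intro tendsto_vec_nth)

lemma holomorphic_BP_factor_nth:
  assumes "norm a < 1"
  shows "(\<lambda>z. BP_factor a P z $ i $ j) holomorphic_on ball 0 1"
  unfolding BP_factor_dilation dilation_nth using assms
  by (intro holomorphic_intros) auto

text \<open>Dividing by the factor \<open>BP_factor a P\<close> leaves a pole at \<open>a\<close> that is cancelled because \<open>P\<close> projects
  into the kernel of \<open>\<Theta> a\<close>; the quotient is a contraction by the maximum principle, since
  \<open>norm (blaschke_factor a z)\<close> tends to \<open>1\<close> at the circle.\<close>

lemma peel_BP_factor:
  fixes \<Theta> :: "complex \<Rightarrow> complex^'n^'n"
  assumes \<Theta>: "\<Theta> \<in> schur_class" and a: "a \<in> ball 0 1" and det0: "det (\<Theta> a) = 0"
  obtains P T where "orthogonal_projection_matrix P" "P \<noteq> 0" "trace P = 1" "T \<in> schur_class"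
    "\<And>z. z \<in> ball 0 1 \<Longrightarrow> \<Theta> z = T z ** BP_factor a P z"
proof -
  have a1: "norm a < 1" using a by simp
  obtain v where v: "norm v = 1" "\<Theta> a *v v = 0" by (rule singular_matrix_kernel[OF det0])
  define P where "P = rank_one v"
  have P: "orthogonal_projection_matrix P" "P \<noteq> 0" "trace P = 1"
    using rank_one_projection[OF v(1)] by (simp_all add: P_def)
  have PP: "P ** P = P" using P(1) by (simp add: orthogonal_projection_matrix_def)
  define q where "q i j z = (\<Theta> z ** P) $ i $ j" for i j z
  have qh: "q i j holomorphic_on ball 0 1" for i j
    unfolding q_def matrix_mult_nth by (intro holomorphic_intros schur_class_entry \<Theta>)
  have qa: "q i j a = 0" for i j
  proof -
    have "(\<Theta> a ** P) *v x = 0 *v x" for x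
      by (simp add: matrix_vector_mul_assoc[symmetric] P_def rank_one_mult_vec vector_scalar_commute v(2))
    hence "\<Theta> a ** P = 0" using matrix_eq by blast
    thus ?thesis by (simp add: q_def)
  qed
  \<comment> \<open>The difference quotient of \<open>q\<close> at its zero \<open>a\<close>, with
    the removable singularity filled in; its product with \<open>1 / \<kappa> z\<close> replaces the
    singular \<open>q i j z / blaschke_factor a z\<close>.\<close>
  define q1 where "q1 i j z = (if z = a then deriv (q i j) a else (q i j z - q i j a) / (z - a))" for i j z
  have q1h: "q1 i j holomorphic_on ball 0 1" for i j
    unfolding q1_def[abs_def] using a by (intro pole_lemma qh) simp
  define \<kappa> where "\<kappa> z = (if a = 0 then 1 else - (complex_of_real (norm a) / (a * (1 - cnj a * z))))" for z
  have \<kappa>h: "\<kappa> holomorphic_on ball 0 1"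
  proof (cases "a = 0")
    case False
    have "(\<lambda>z. - (complex_of_real (norm a) / (a * (1 - cnj a * z)))) holomorphic_on ball 0 1"
      using one_minus_cnj_mult_nonzero[OF a1] False by (intro holomorphic_intros) auto
    thus ?thesis using False by (simp add: \<kappa>_def[abs_def])
  qed (simp add: \<kappa>_def[abs_def])
  have \<kappa>0: "\<kappa> z \<noteq> 0" if "z \<in> ball 0 1" for z
    using one_minus_cnj_mult_nonzero[OF a1, of z] that by (auto simp: \<kappa>_def)
  have b\<kappa>: "blaschke_factor a z = (z - a) * \<kappa> z" for z
    by (simp add: \<kappa>_def blaschke_factor_def divide_simps) (simp add: algebra_simps)
  \<comment> \<open>This is \<open>\<Theta> z ** dilation (1 / blaschke_factor a z) P\<close> with
    the pole at \<open>a\<close> already cancelled.\<close>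
  define T where "T z = (\<chi> i j. \<Theta> z $ i $ j - q i j z + q1 i j z / \<kappa> z)" for z
  have Th: "(\<lambda>z. T z $ i $ j) holomorphic_on ball 0 1" for i j
    unfolding T_def using \<kappa>0 by (simp, intro holomorphic_intros schur_class_entry \<Theta> qh q1h \<kappa>h) auto
  have b0: "blaschke_factor a z \<noteq> 0" if "z \<in> ball 0 1" "z \<noteq> a" for z
    using blaschke_factor_eq_0_iff[OF a1, of z] that by simp
  have Teq: "T z = \<Theta> z ** dilation (1 / blaschke_factor a z) P" if z: "z \<in> ball 0 1" "z \<noteq> a" for z
  proof -
    have "(\<Theta> z ** dilation c P) $ i $ j = \<Theta> z $ i $ j + (c - 1) * q i j z" for c i j
      by (simp add: matrix_mult_nth dilation_nth q_def distrib_left sum.distrib sum_distrib_left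
          if_distrib[of "\<lambda>x. _ * x"] mult.left_commute cong: if_cong)
    moreover have "q1 i j z / \<kappa> z = q i j z / blaschke_factor a z" for i j
      using z by (simp add: q1_def qa b\<kappa>)
    ultimately show ?thesis by (simp add: vec_eq_iff T_def left_diff_distrib)
  qed
  have fac: "\<Theta> z = T z ** BP_factor a P z" if z: "z \<in> ball 0 1" for z
  proof -
    have ne: "\<Theta> w = T w ** BP_factor a P w" if "w \<in> ball 0 1" "w \<noteq> a" for w
      using b0[OF that] by (simp add: Teq[OF that] BP_factor_dilation matrix_mul_assoc[symmetric] dilation_mult[OF PP])
    show ?thesis
    proof (cases "z = a")
      case False thus ?thesis using ne z by simp
    next
      case True
      have "\<Theta> a $ i $ j = (T a ** BP_factor a P a) $ i $ j" for i j
      proof -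
        \<comment> \<open>At \<open>a\<close> itself the factor is not invertible; there the
          factorisation follows by continuity from neighbouring points.\<close>
        define D where "D w = \<Theta> w $ i $ j - (T w ** BP_factor a P w) $ i $ j" for w
        have "D holomorphic_on ball 0 1"
          unfolding D_def matrix_mult_nth by (intro holomorphic_intros schur_class_entry \<Theta> Th holomorphic_BP_factor_nth a1)
        hence "isCont D a"
          using a by (metis holomorphic_on_imp_continuous_on continuous_on_eq_continuous_at open_ball)
        hence "(D \<longlongrightarrow> D a) (at a)" by (simp add: isCont_def)
        moreover have "(D \<longlongrightarrow> 0) (at a)"
        proof (rule tendsto_eventually)
          have "\<forall>\<^sub>F w in at a. w \<in> ball 0 1" using a by (intro eventually_at_in_open') auto
          moreover have "\<forall>\<^sub>F w in at a. w \<noteq> a" by (simp add: eventually_at_filter)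
          ultimately show "\<forall>\<^sub>F w in at a. D w = 0"
            by eventually_elim (use ne in \<open>auto simp: D_def\<close>)
        qed
        ultimately have "D a = 0" by (rule tendsto_unique[rotated]) simp
        thus ?thesis by (simp add: D_def)
      qed
      thus ?thesis using True by (simp add: vec_eq_iff)
    qed
  qed
  have "opnorm (T z) \<le> 1" if z: "z \<in> ball 0 1" for z
    unfolding opnorm_le_1_iff
  proof
    fix x
    \<comment> \<open>Fixing the value at \<open>z\<close> and pairing with it reduces the
      contraction estimate to the maximum principle for the scalar function \<open>\<phi>\<close>,
      since \<open>\<phi> z\<close> is the square of the norm of \<open>y\<close>.\<close>
    define y where "y = T z *v x"
    define \<phi> where "\<phi> w = cinner (T w *v x) y" for w
    have \<phi>h: "\<phi> holomorphic_on ball 0 1"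
      unfolding \<phi>_def cinner_def matrix_vector_mult_def by (simp, intro holomorphic_intros Th)
    \<comment> \<open>The lower bound for the squared modulus of the Blaschke factor on the circle
      of radius \<open>\<rho>\<close>; its limit 1 makes the estimate \<open>est\<close>
      sharp.\<close>
    define \<beta> where "\<beta> \<rho> = 1 - (1 - \<rho>\<^sup>2) / (1 - norm a)\<^sup>2" for \<rho> :: real
    have est: "norm y ^ 2 * sqrt (\<beta> \<rho>) \<le> norm x * norm y"
      if \<rho>: "norm z < \<rho>" "norm a < \<rho>" "\<rho> < 1" "0 < \<beta> \<rho>" for \<rho>
    proof -
      have \<rho>0: "0 < \<rho>" using \<rho>(1) by (rule le_less_trans[OF norm_ge_zero])
      obtain R where R: "R > 1" "(\<lambda>w. \<phi> (complex_of_real \<rho> * w)) holomorphic_on ball 0 R"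
        using holomorphic_dilate[OF \<phi>h, of \<rho>] \<rho>0 \<rho>(3) by (metis less_imp_le)
      have "norm (\<phi> (complex_of_real \<rho> * (z / complex_of_real \<rho>))) \<le> norm x * norm y / sqrt (\<beta> \<rho>)"
      proof (rule ball_max_modulus[OF R(2,1)])
        show "norm (z / complex_of_real \<rho>) < 1" using \<rho>(1) \<rho>0 by (simp add: norm_divide)
        fix t :: complex assume t: "norm t = 1"
        define w where "w = complex_of_real \<rho> * t"
        have w: "norm w = \<rho>" "w \<in> ball 0 1" "w \<noteq> a" using \<rho> \<rho>0 t by (auto simp: w_def norm_mult)
        have "\<beta> \<rho> \<le> (norm (blaschke_factor a w))\<^sup>2"
          using norm_blaschke_factor_ge[OF a1, of w] w \<rho>(3) by (simp add: \<beta>_def)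
        hence bl: "sqrt (\<beta> \<rho>) \<le> norm (blaschke_factor a w)" by (intro real_le_lsqrt) auto
        have sb: "0 < sqrt (\<beta> \<rho>)" using \<rho>(4) by simp
        have bp: "0 < norm (blaschke_factor a w)" using bl sb by linarith
        have "norm (T w *v x) \<le> norm (dilation (1 / blaschke_factor a w) P *v x)"
          using schur_class_opnorm[OF \<Theta> w(2)]
          by (simp add: Teq[OF w(2,3)] matrix_vector_mul_assoc[symmetric] opnorm_le_1_iff)
        also have "\<dots> \<le> norm (1 / blaschke_factor a w) * norm x"
        proof (rule norm_dilation_le[OF P(1)])
          have "norm (blaschke_factor a w) \<le> 1" using w by (intro norm_blaschke_factor_le_1 a1) auto
          thus "1 \<le> norm (1 / blaschke_factor a w)" using bp by (simp add: norm_divide divide_simps)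
        qed
        also have "\<dots> \<le> norm x / sqrt (\<beta> \<rho>)"
          using bl sb bp by (simp add: norm_divide) (intro divide_left_mono mult_pos_pos, auto)
        finally have "norm (T w *v x) * norm y \<le> norm x / sqrt (\<beta> \<rho>) * norm y" by (intro mult_right_mono) auto
        thus "norm (\<phi> (complex_of_real \<rho> * t)) \<le> norm x * norm y / sqrt (\<beta> \<rho>)"
          using norm_cinner_le[of "T w *v x" y] by (simp add: \<phi>_def w_def)
      qed
      hence "norm (\<phi> z) \<le> norm x * norm y / sqrt (\<beta> \<rho>)" using \<rho>0 by simp
      moreover have "norm (\<phi> z) = (norm y)\<^sup>2"
        unfolding \<phi>_def y_def[symmetric] cinner_self norm_of_real by simp
      ultimately show ?thesis using \<rho>(4) by (simp add: field_simps)
    qed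
    have \<beta>1: "(\<beta> \<longlongrightarrow> 1) (at_left 1)"
    proof -
      have "(\<beta> \<longlongrightarrow> 1 - (1 - 1\<^sup>2) / (1 - norm a)\<^sup>2) (at_left 1)"
        unfolding \<beta>_def[abs_def] using a1 by (intro tendsto_intros) auto
      thus ?thesis by simp
    qed
    have "norm y ^ 2 * sqrt 1 \<le> norm x * norm y"
    proof (rule tendsto_upperbound)
      show "((\<lambda>\<rho>. norm y ^ 2 * sqrt (\<beta> \<rho>)) \<longlongrightarrow> norm y ^ 2 * sqrt 1) (at_left 1)"
        by (intro tendsto_intros \<beta>1)
      have "\<forall>\<^sub>F \<rho> in at_left 1. \<rho> \<in> {max (norm z) (norm a)<..<1}"
        using z a1 by (intro eventually_at_leftI[of "max (norm z) (norm a)"]) auto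
      moreover have "\<forall>\<^sub>F \<rho> in at_left 1. 0 < \<beta> \<rho>" by (rule order_tendstoD(1)[OF \<beta>1]) simp
      ultimately show "\<forall>\<^sub>F \<rho> in at_left 1. norm y ^ 2 * sqrt (\<beta> \<rho>) \<le> norm x * norm y"
        by eventually_elim (use est in auto)
    qed simp
    thus "norm (T z *v x) \<le> norm x"
      unfolding y_def[symmetric] by (cases "norm y = 0") (simp_all add: power2_eq_square)
  qed
  hence "T \<in> schur_class" using Th by (simp add: schur_class_def matrix_holomorphic_on_def)
  thus ?thesis using that P fac by blast
qed

definition has_det_zero :: "(complex \<Rightarrow> complex^'n^'n) \<Rightarrow> bool" where
  "has_det_zero \<Theta> \<longleftrightarrow> (\<exists>z\<in>ball 0 1. det (\<Theta> z) = 0)"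

lemma minimal_det_zero:
  assumes \<Theta>: "\<Theta> \<in> schur_class" and "has_det_zero \<Theta>"
  obtains a where "a \<in> ball 0 1" "det (\<Theta> a) = 0" "\<And>z. z \<in> ball 0 1 \<Longrightarrow> det (\<Theta> z) = 0 \<Longrightarrow> norm a \<le> norm z"
proof -
  obtain z0 where z0: "z0 \<in> ball 0 1" "det (\<Theta> z0) = 0" using assms(2) unfolding has_det_zero_def by blast
  define S where "S = {z \<in> cball 0 (norm z0). det (\<Theta> z) = 0}"
  have sub: "cball 0 (norm z0) \<subseteq> ball 0 1" using z0 by auto
  have "continuous_on (cball 0 (norm z0)) (\<lambda>z. det (\<Theta> z))"
    using holomorphic_on_imp_continuous_on[OF schur_class_det[OF \<Theta>]] sub by (rule continuous_on_subset)
  hence "closed (cball 0 (norm z0) \<inter> (\<lambda>z. det (\<Theta> z)) -` {0})"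
    by (intro continuous_closed_preimage) auto
  moreover have "S = cball 0 (norm z0) \<inter> (\<lambda>z. det (\<Theta> z)) -` {0}" by (auto simp: S_def)
  ultimately have "closed S" by simp
  moreover have "bounded S" by (rule bounded_subset[of "cball 0 (norm z0)"]) (auto simp: S_def)
  ultimately have "compact S" by (simp add: compact_eq_bounded_closed)
  moreover have "S \<noteq> {}" using z0 by (auto simp: S_def)
  ultimately obtain a where a: "a \<in> S" "\<And>z. z \<in> S \<Longrightarrow> norm a \<le> norm z"
    using continuous_attains_inf[of S norm] by (auto intro: continuous_intros)
  show ?thesis
  proof (rule that[of a])
    show "a \<in> ball 0 1" "det (\<Theta> a) = 0" using a(1) sub unfolding S_def by blast+
    fix z :: complex assume z: "z \<in> ball 0 1" "det (\<Theta> z) = 0"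
    show "norm a \<le> norm z"
    proof (cases "norm z \<le> norm z0")
      case True
      thus ?thesis using z by (intro a(2)) (auto simp: S_def)
    next
      case False
      moreover have "norm a \<le> norm z0" using a(1) by (auto simp: S_def)
      ultimately show ?thesis by simp
    qed
  qed
qed

lemma det_BP_factor:
  assumes "BP_parameter a (P :: complex^'n^'n)"
  obtains m where "1 \<le> m" "m \<le> CARD('n)" "\<And>z. det (BP_factor a P z) = blaschke_factor a z ^ m"
  using assms det_dilation[of P]
  unfolding BP_parameter_def orthogonal_projection_matrix_def BP_factor_dilation by metis

lemma BP_multiplicities:
  fixes P :: "nat \<Rightarrow> complex^'n^'n"
  obtains m where "\<And>k. BP_parameter (a k) (P k) \<Longrightarrow> 1 \<le> m k" "\<And>k. BP_parameter (a k) (P k) \<Longrightarrow> m k \<le> CARD('n)"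
    "\<And>k z. BP_parameter (a k) (P k) \<Longrightarrow> det (BP_factor (a k) (P k) z) = blaschke_factor (a k) z ^ m k"
proof -
  have "\<exists>m. BP_parameter (a k) (P k) \<longrightarrow> 1 \<le> m \<and> m \<le> CARD('n) \<and>
      (\<forall>z. det (BP_factor (a k) (P k) z) = blaschke_factor (a k) z ^ m)" for k
    using det_BP_factor[of "a k" "P k"] by metis
  then obtain m where "\<And>k. BP_parameter (a k) (P k) \<longrightarrow> 1 \<le> m k \<and> m k \<le> CARD('n) \<and>
      (\<forall>z. det (BP_factor (a k) (P k) z) = blaschke_factor (a k) z ^ m k)" by metis
  thus ?thesis by (intro that[of m]) auto
qed

lemma norm_det_right_BP_partial:
  assumes "\<And>k. k < N \<Longrightarrow> det (BP_factor (a k) (P k) z) = blaschke_factor (a k) z ^ m k"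
  shows "norm (det (right_BP_partial a P N z)) = (\<Prod>k<N. norm (blaschke_factor (a k) z) ^ m k)"
  using assms by (induction N) (simp_all add: det_mul norm_mult norm_power mult.commute)

text \<open>The determinant splits into the zero-free \<open>det (T z)\<close>, whose logarithmic
  mean is its value at 0, and a Blaschke product of modulus at most 1, which can only lower the
  mean. So a mean near 0 forces \<open>det (T 0)\<close> to have modulus near 1.\<close>

lemma ln_det_mean_le:
  fixes \<Theta> :: "complex \<Rightarrow> complex^'n^'n"
  assumes T: "T \<in> schur_class" and nz: "\<And>z. norm z \<le> s \<Longrightarrow> det (T z) \<noteq> 0"
    and BP: "\<And>k. k < N \<Longrightarrow> BP_parameter (a k) (P k)" and s: "0 < s" "s < 1"
    and fac: "\<And>z. z \<in> ball 0 1 \<Longrightarrow> \<Theta> z = T z ** right_BP_partial a P N z"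
    and hol: "\<Theta> \<in> schur_class"
  shows "integrable circle_measure (\<lambda>t. ln (norm (det (\<Theta> (complex_of_real s * t)))))"
    and "(LINT t|circle_measure. ln (norm (det (\<Theta> (complex_of_real s * t))))) \<le> ln (norm (det (T 0)))"
    and "AE t in circle_measure. det (\<Theta> (complex_of_real s * t)) \<noteq> 0"
proof -
  obtain m where m: "\<And>k z. BP_parameter (a k) (P k) \<Longrightarrow> det (BP_factor (a k) (P k) z) = blaschke_factor (a k) z ^ m k"
    using BP_multiplicities[of a P] by metis
  have a: "norm (a k) < 1" if "k < N" for k using BP[OF that] by (simp add: BP_parameter_def)
  define S where "S t = (\<Sum>k<N. real (m k) * ln (norm (blaschke_factor (a k) (complex_of_real s * t))))" for t
  define u where "u t = ln (norm (det (T (complex_of_real s * t))))" for t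
  define f where "f t = ln (norm (det (\<Theta> (complex_of_real s * t))))" for t
  have inb: "complex_of_real s * t \<in> ball 0 1" if "t \<in> sphere 0 1" for t using s that by (simp add: norm_mult)
  have inc: "norm (complex_of_real s * t) \<le> s" if "t \<in> sphere 0 1" for t using s that by (simp add: norm_mult)
  have prod: "norm (det (\<Theta> z)) = norm (det (T z)) * (\<Prod>k<N. norm (blaschke_factor (a k) z) ^ m k)" if "z \<in> ball 0 1" for z
    using fac[OF that] norm_det_right_BP_partial[of N a P z m] m BP by (simp add: det_mul norm_mult)
  have ui: "integrable circle_measure u" "(LINT t|circle_measure. u t) = ln (norm (det (T 0)))"
    unfolding u_def using ln_norm_mean_value_dilate[OF schur_class_det[OF T], of s] s nz by auto
  have Si: "integrable circle_measure S"
    unfolding S_def using a s by (intro ln_blaschke_product_circle(3)) auto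
  have ae0: "AE t in circle_measure. \<forall>k<N. blaschke_factor (a k) (complex_of_real s * t) \<noteq> 0"
    by (rule ln_blaschke_product_circle(1)[OF a s])
  show "AE t in circle_measure. det (\<Theta> (complex_of_real s * t)) \<noteq> 0"
    using ae0 AE_space[of circle_measure]
  proof eventually_elim
    case (elim t)
    have "norm (det (\<Theta> (complex_of_real s * t))) \<noteq> 0"
      using elim nz[OF inc, of t] inb[of t] by (subst prod) auto
    thus ?case by simp
  qed
  have aeS: "AE t in circle_measure. ln (\<Prod>k<N. norm (blaschke_factor (a k) (complex_of_real s * t)) ^ m k) = S t"
    unfolding S_def by (rule ln_blaschke_product_circle(2)[OF a s])
  have ae: "AE t in circle_measure. f t = u t + S t"
    using ae0 aeS AE_space[of circle_measure]
  proof eventually_elim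
    case (elim t)
    have t: "t \<in> sphere 0 1" using elim by simp
    have "f t = ln (norm (det (T (complex_of_real s * t))) * (\<Prod>k<N. norm (blaschke_factor (a k) (complex_of_real s * t)) ^ m k))"
      unfolding f_def prod[OF inb[OF t]] ..
    also have "\<dots> = u t + ln (\<Prod>k<N. norm (blaschke_factor (a k) (complex_of_real s * t)) ^ m k)"
      unfolding u_def using elim(1) nz[OF inc[OF t]] by (subst ln_mult) (auto simp: prod_zero_iff)
    also have "\<dots> = u t + S t" using elim(2) by simp
    finally show ?case .
  qed
  have fm: "f \<in> borel_measurable circle_measure"
  proof -
    have [measurable]: "(\<lambda>t. det (\<Theta> (complex_of_real s * t))) \<in> borel_measurable circle_measure"
      using s by (intro circle_borel_measurable_continuous continuous_on_dilate schur_class_det hol) auto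
    show ?thesis unfolding f_def by measurable
  qed
  have usi: "integrable circle_measure (\<lambda>t. u t + S t)" by (intro Bochner_Integration.integrable_add ui Si)
  show "integrable circle_measure (\<lambda>t. ln (norm (det (\<Theta> (complex_of_real s * t)))))"
    using integrable_cong_AE[OF fm borel_measurable_integrable[OF usi] ae] usi by (simp add: f_def)
  have "(LINT t|circle_measure. f t) = (LINT t|circle_measure. u t + S t)"
    by (rule integral_cong_AE[OF fm borel_measurable_integrable[OF usi] ae])
  also have "\<dots> \<le> (LINT t|circle_measure. u t)"
  proof (intro integral_mono usi ui)
    fix t assume "t \<in> space circle_measure"
    hence t: "t \<in> sphere 0 1" by simp
    have "S t \<le> 0" unfolding S_def
    proof (intro sum_nonpos mult_nonneg_nonpos)
      fix k assume "k \<in> {..<N}"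
      hence "norm (blaschke_factor (a k) (complex_of_real s * t)) \<le> 1"
        using inb[OF t] by (intro norm_blaschke_factor_le_1 a) auto
      thus "ln (norm (blaschke_factor (a k) (complex_of_real s * t))) \<le> 0"
        by (cases "blaschke_factor (a k) (complex_of_real s * t) = 0") auto
    qed auto
    thus "u t + S t \<le> u t" by simp
  qed
  finally show "(LINT t|circle_measure. ln (norm (det (\<Theta> (complex_of_real s * t))))) \<le> ln (norm (det (T 0)))"
    using ui(2) by (simp add: f_def)
qed

text \<open>Peeling off a zero of minimal modulus at every step, the Blaschke condition forces the moduli of the
  zeros to tend to \<open>1\<close>; hence no zero is missed and no bookkeeping of multiplicities is needed.\<close>

theorem potapov_peeling:
  fixes \<Theta> :: "complex \<Rightarrow> complex^'n^'n"
  assumes \<Theta>: "\<Theta> \<in> schur_class" and z0: "z0 \<in> ball 0 1" "det (\<Theta> z0) \<noteq> 0"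
  obtains
    (finite) N a P T where "\<And>k. k < N \<Longrightarrow> BP_parameter (a k) (P k)" "T \<in> schur_class"
      "\<And>z. z \<in> ball 0 1 \<Longrightarrow> det (T z) \<noteq> 0" "\<And>z. z \<in> ball 0 1 \<Longrightarrow> \<Theta> z = T z ** right_BP_partial a P N z"
  | (infinite) a P T where "\<And>k. BP_parameter (a k) (P k)" "\<And>k. trace (P k) = 1" "summable (\<lambda>k. 1 - norm (a k))"
      "\<And>N. T N \<in> schur_class" "\<And>N z. z \<in> ball 0 1 \<Longrightarrow> \<Theta> z = T N z ** right_BP_partial a P N z"
      "\<And>s. s < 1 \<Longrightarrow> \<exists>N0. \<forall>N\<ge>N0. \<forall>z. norm z \<le> s \<longrightarrow> det (T N z) \<noteq> 0"
proof -
  \<comment> \<open>One peeling step as a relation between a function and its remainder; choice then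
    gives maps \<open>A\<close>, \<open>Pr\<close> and \<open>Y\<close>, and iterating
    \<open>Y\<close> produces the remainders.\<close>
  define good where "good X a P Y \<longleftrightarrow> a \<in> ball 0 1 \<and> (\<forall>z\<in>ball 0 1. det (X z) = 0 \<longrightarrow> norm a \<le> norm z) \<and>
      orthogonal_projection_matrix P \<and> P \<noteq> 0 \<and> trace P = 1 \<and> Y \<in> schur_class \<and>
      (\<forall>z\<in>ball 0 1. X z = Y z ** BP_factor a P z)" for X Y :: "complex \<Rightarrow> complex^'n^'n" and a P
  have "\<exists>a P Y. X \<in> schur_class \<and> has_det_zero X \<longrightarrow> good X a P Y" for X :: "complex \<Rightarrow> complex^'n^'n"
  proof (cases "X \<in> schur_class \<and> has_det_zero X")
    case True
    obtain a where a: "a \<in> ball 0 1" "det (X a) = 0" "\<And>z. z \<in> ball 0 1 \<Longrightarrow> det (X z) = 0 \<Longrightarrow> norm a \<le> norm z"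
      using minimal_det_zero[of X] True by blast
    obtain P Y where "orthogonal_projection_matrix P" "P \<noteq> 0" "trace P = 1" "Y \<in> schur_class"
      "\<And>z. z \<in> ball 0 1 \<Longrightarrow> X z = Y z ** BP_factor a P z"
      using peel_BP_factor[of X a] True a by blast
    thus ?thesis unfolding good_def using a by blast
  qed blast
  then obtain A Pr Y where good: "\<And>X. X \<in> schur_class \<Longrightarrow> has_det_zero X \<Longrightarrow> good X (A X) (Pr X) (Y X)"
    by metis
  define T where "T N = (Y ^^ N) \<Theta>" for N
  define a where "a N = A (T N)" for N
  define P where "P N = Pr (T N)" for N
  have TS: "T (Suc N) = Y (T N)" for N by (simp add: T_def)
  \<comment> \<open>The chosen maps are specified only at functions whose determinant has a zero, so
    the invariant presupposes that the process has not stopped before \<open>N\<close>.\<close>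
  have step: "T N \<in> schur_class \<and> (\<forall>z\<in>ball 0 1. \<Theta> z = T N z ** right_BP_partial a P N z) \<and>
      (\<forall>k<N. good (T k) (a k) (P k) (T (Suc k)))"
    if "\<forall>k<N. has_det_zero (T k)" for N
    using that
  proof (induction N)
    case 0
    show ?case using \<Theta> by (simp add: T_def)
  next
    case (Suc N)
    hence IH: "T N \<in> schur_class" "\<And>z. z \<in> ball 0 1 \<Longrightarrow> \<Theta> z = T N z ** right_BP_partial a P N z"
      "\<forall>k<N. good (T k) (a k) (P k) (T (Suc k))" by auto
    have g: "good (T N) (a N) (P N) (T (Suc N))"
      using good[OF IH(1)] Suc.prems by (simp add: a_def P_def TS)
    hence "\<Theta> z = T (Suc N) z ** right_BP_partial a P (Suc N) z" if "z \<in> ball 0 1" for z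
      using IH(2)[OF that] that by (simp add: good_def matrix_mul_assoc)
    thus ?case using g IH(3) by (auto simp: good_def less_Suc_eq)
  qed
  have gBP: "BP_parameter (a k) (P k)" if "good (T k) (a k) (P k) (T (Suc k))" for k
    using that by (simp add: good_def BP_parameter_def)
  show ?thesis
  proof (cases "\<exists>N. \<not> has_det_zero (T N)")
    case True
    define N where "N = (LEAST N. \<not> has_det_zero (T N))"
    have N: "\<not> has_det_zero (T N)" unfolding N_def using True by (rule LeastI_ex)
    have "\<forall>k<N. has_det_zero (T k)" unfolding N_def using not_less_Least by blast
    from step[OF this] N gBP show ?thesis
      by (intro finite[of N a P "T N"]) (auto simp: has_det_zero_def)
  next
    case False
    hence st: "T N \<in> schur_class" "\<And>z. z \<in> ball 0 1 \<Longrightarrow> \<Theta> z = T N z ** right_BP_partial a P N z"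
      "good (T N) (a N) (P N) (T (Suc N))" for N
      using step[of N] step[of "Suc N"] by auto
    have BP: "BP_parameter (a k) (P k)" for k by (rule gBP[OF st(3)])
    have a1: "norm (a k) < 1" for k using BP[of k] by (simp add: BP_parameter_def)
    obtain m where m: "\<And>k. 1 \<le> m k" "\<And>k z. det (BP_factor (a k) (P k) z) = blaschke_factor (a k) z ^ m k"
      using BP_multiplicities[of a P] BP by metis
    \<comment> \<open>The defects at \<open>z0\<close>. Since
      \<open>1 - \<delta> k \<le> exp (- \<delta> k)\<close>, their partial sums are bounded by
      \<open>- ln (norm (det (\<Theta> z0)))\<close>; the determinant is nonzero at
      \<open>z0\<close>.\<close>
    define \<delta> where "\<delta> k = 1 - norm (blaschke_factor (a k) z0)" for k
    have \<delta>: "0 \<le> \<delta> k" "(1 - norm (a k)) * ((1 - (norm z0)\<^sup>2) / 8) \<le> \<delta> k" for k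
      using norm_blaschke_factor_le_1[OF a1, of z0 k] blaschke_factor_defect_ge[OF a1, of z0 k] z0 by (auto simp: \<delta>_def)
    have psum: "(\<Sum>k<N. \<delta> k) \<le> - ln (norm (det (\<Theta> z0)))" for N
    proof -
      have "norm (det (\<Theta> z0)) = norm (det (T N z0)) * (\<Prod>k<N. norm (blaschke_factor (a k) z0) ^ m k)"
        using st(2)[OF z0(1), of N] norm_det_right_BP_partial[of N a P z0 m] m by (simp add: det_mul norm_mult)
      also have "\<dots> \<le> 1 * (\<Prod>k<N. norm (blaschke_factor (a k) z0) ^ m k)"
        by (intro mult_right_mono schur_class_norm_det st z0 prod_nonneg) auto
      also have "(\<Prod>k<N. norm (blaschke_factor (a k) z0) ^ m k) \<le> (\<Prod>k<N. exp (- \<delta> k))"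
      proof (intro prod_mono conjI)
        fix k
        have "norm (blaschke_factor (a k) z0) \<le> 1" using norm_blaschke_factor_le_1[OF a1, of z0 k] z0 by auto
        hence "norm (blaschke_factor (a k) z0) ^ m k \<le> norm (blaschke_factor (a k) z0) ^ 1"
          using m(1) by (intro power_decreasing) auto
        also have "\<dots> \<le> exp (- \<delta> k)" using exp_ge_add_one_self[of "- \<delta> k"] by (simp add: \<delta>_def)
        finally show "norm (blaschke_factor (a k) z0) ^ m k \<le> exp (- \<delta> k)" .
      qed auto
      also have "\<dots> = exp (- (\<Sum>k<N. \<delta> k))" by (simp add: exp_sum[symmetric] sum_negf)
      finally have "norm (det (\<Theta> z0)) \<le> exp (- (\<Sum>k<N. \<delta> k))" by simp
      hence "ln (norm (det (\<Theta> z0))) \<le> ln (exp (- (\<Sum>k<N. \<delta> k)))"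
        using z0(2) by (subst ln_le_cancel_iff) auto
      thus ?thesis by simp
    qed
    have "summable \<delta>" using \<delta>(1) psum by (rule summableI_nonneg_bounded)
    hence "summable (\<lambda>k. (1 - (norm z0)\<^sup>2) / 8 * (1 - norm (a k)))"
      unfolding mult.commute[of "(1 - (norm z0)\<^sup>2) / 8"]
      by (rule summable_comparison_test') (use \<delta> a1 z0 in \<open>auto simp: abs_mult less_imp_le power_le_one\<close>)
    moreover have "(1 - (norm z0)\<^sup>2) / 8 \<noteq> 0"
      using z0(1) power_less_one_iff[of "norm z0" 2] by simp
    ultimately have summ: "summable (\<lambda>k. 1 - norm (a k))" by (rule summable_mult_D)
    show ?thesis
    proof (rule infinite[of a P T])
      fix s :: real assume s: "s < 1"
      have "(\<lambda>k. 1 - norm (a k)) \<longlonglongrightarrow> 0" by (rule summable_LIMSEQ_zero[OF summ])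
      from order_tendstoD(2)[OF this, of "1 - s"] s
      obtain N0 where N0: "\<And>N. N \<ge> N0 \<Longrightarrow> 1 - norm (a N) < 1 - s" by (auto simp: eventually_sequentially)
      \<comment> \<open>\<open>a N\<close> is a zero of least modulus of \<open>det (T N z)\<close>,
        and for large \<open>N\<close> it lies outside the disc of radius \<open>s\<close>.\<close>
      show "\<exists>N0. \<forall>N\<ge>N0. \<forall>z. norm z \<le> s \<longrightarrow> det (T N z) \<noteq> 0"
      proof (intro exI allI impI notI)
        fix N z assume N: "N0 \<le> N" "norm z \<le> s" "det (T N z) = 0"
        have "norm (a N) \<le> norm z" using st(3)[of N] N s by (simp add: good_def)
        thus False using N0[OF N(1)] N(2) by simp
      qed
    next
      show "trace (P k) = 1" for k using st(3)[of k] by (simp add: good_def)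
      show "\<Theta> z = T N z ** right_BP_partial a P N z" if "z \<in> ball 0 1" for N z by (rule st(2)[OF that])
    qed (rule BP summ st(1))+
  qed
qed

section \<open>Unitary limits and convergence of infinite products\<close>

lemma conj_transpose_conj_transpose [simp]: "conj_transpose (conj_transpose A) = A"
  by (simp add: conj_transpose_def vec_eq_iff)

lemma unitary_conj_transpose: "unitary_matrix V \<Longrightarrow> unitary_matrix (conj_transpose V)"
  by (simp add: unitary_matrix_def)

lemma opnorm_unitary:
  assumes "unitary_matrix V"
  shows "opnorm V \<le> 1"
  unfolding opnorm_le_1_iff
proof
  fix x
  have "cinner (V *v x) (V *v x) = cinner x (conj_transpose V *v (V *v x))" by (rule cinner_matrix)
  also have "\<dots> = cinner x x" using assms by (simp add: matrix_vector_mul_assoc unitary_matrix_def)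
  finally have "(norm (V *v x))\<^sup>2 = (norm x)\<^sup>2" unfolding cinner_self of_real_eq_iff .
  thus "norm (V *v x) \<le> norm x" by (metis norm_ge_zero order_refl power2_eq_imp_eq)
qed

lemma norm_det_unitary:
  assumes V: "unitary_matrix V"
  shows "norm (det V) = 1"
proof -
  have "det (conj_transpose V) * det V = 1"
    using V by (simp add: unitary_matrix_def det_mul[symmetric])
  hence e: "norm (det (conj_transpose V)) * norm (det V) = 1" by (simp add: norm_mult[symmetric])
  have le: "norm (det V) \<le> 1" "norm (det (conj_transpose V)) \<le> 1"
    using V unitary_conj_transpose[OF V] by (auto intro: norm_det_contraction opnorm_unitary)
  have "norm (det (conj_transpose V)) * norm (det V) \<le> 1 * norm (det V)"
    by (intro mult_right_mono le) auto
  thus ?thesis using e le by simp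
qed

lemma schur_class_unitary_mult:
  assumes V: "unitary_matrix V" and T: "T \<in> schur_class"
  shows "(\<lambda>z. V ** T z) \<in> schur_class"
proof -
  have "(\<lambda>z. (V ** T z) $ i $ j) holomorphic_on ball 0 1" for i j
    unfolding matrix_mult_nth by (intro holomorphic_intros schur_class_entry T)
  thus ?thesis
    using opnorm_mult_le_1[OF opnorm_unitary[OF V]] schur_class_opnorm[OF T]
    by (simp add: schur_class_def matrix_holomorphic_on_def)
qed

lemma contraction_column:
  fixes A :: "complex^'n^'n"
  assumes "opnorm A \<le> 1" "i \<noteq> j"
  shows "(norm (A $ i $ j))\<^sup>2 \<le> 1 - (norm (A $ j $ j))\<^sup>2"
proof -
  have e: "(A *v axis j 1) $ k = A $ k $ j" for k
    by (simp add: matrix_vector_mult_def axis_def if_distrib[of "\<lambda>x. _ * x"] cong: if_cong)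
  have "norm (A *v axis j 1) \<le> norm (axis j (1::complex))" using assms opnorm_le_1_iff by blast
  hence "(norm (A *v axis j 1))\<^sup>2 \<le> 1" by (simp add: power_le_one)
  moreover have "(norm (A *v axis j 1))\<^sup>2 = (\<Sum>k\<in>UNIV. (norm (A $ k $ j))\<^sup>2)"
    by (simp add: norm_vec_def[of "A *v axis j 1"] L2_set_def sum_nonneg e)
  moreover have "(\<Sum>k\<in>{i, j}. (norm (A $ k $ j))\<^sup>2) \<le> (\<Sum>k\<in>UNIV. (norm (A $ k $ j))\<^sup>2)"
    by (rule sum_mono2) auto
  ultimately show ?thesis using assms(2) by simp
qed

text \<open>After multiplication by the adjoint of a limit at \<open>0\<close>, the diagonal entries tend to \<open>1\<close> at \<open>0\<close>,
  hence everywhere, and the columns have norm at most one.\<close>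

lemma schur_sequence_unitary_limit:
  fixes T :: "nat \<Rightarrow> complex \<Rightarrow> complex^'n^'n"
  assumes T: "\<And>k. T k \<in> schur_class" and det: "(\<lambda>k. norm (det (T k 0))) \<longlonglongrightarrow> 1"
  obtains V r where "unitary_matrix V" "strict_mono (r :: nat \<Rightarrow> nat)"
    "\<And>z. z \<in> ball 0 1 \<Longrightarrow> (\<lambda>k. T (r k) z) \<longlonglongrightarrow> V"
proof -
  have c0: "opnorm (T k 0) \<le> 1" for k by (rule schur_class_opnorm[OF T]) simp
  obtain V r where r: "strict_mono (r :: nat \<Rightarrow> nat)" and lim: "(\<lambda>k. T (r k) 0) \<longlonglongrightarrow> V" and V1: "opnorm V \<le> 1"
    by (rule contraction_convergent_subseq[of "\<lambda>k. T k 0", OF c0])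
  have "(\<lambda>k. norm (det (T (r k) 0))) \<longlonglongrightarrow> norm (det V)" by (intro tendsto_norm tendsto_det lim)
  moreover have "(\<lambda>k. norm (det (T (r k) 0))) \<longlonglongrightarrow> 1"
    using LIMSEQ_subseq_LIMSEQ[OF det r] by (simp add: o_def)
  ultimately have "norm (det V) = 1" by (rule LIMSEQ_unique)
  hence V: "unitary_matrix V" by (rule unitary_contraction_det[OF V1])
  define W where "W = conj_transpose V"
  have W: "unitary_matrix W" unfolding W_def by (rule unitary_conj_transpose[OF V])
  define D where "D k z = W ** T (r k) z" for k z
  have D: "D k \<in> schur_class" for k unfolding D_def by (rule schur_class_unitary_mult[OF W T])
  have D0: "(\<lambda>k. D k 0) \<longlonglongrightarrow> mat 1"
  proof -
    have "(\<lambda>k. D k 0) \<longlonglongrightarrow> W ** V" unfolding D_def by (intro tendsto_matrix_mult tendsto_const lim)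
    thus ?thesis using V by (simp add: W_def unitary_matrix_def)
  qed
  have "(\<lambda>k. T (r k) z) \<longlonglongrightarrow> V" if z: "z \<in> ball 0 1" for z
  proof -
    have d0: "(\<lambda>k. D k 0 $ i $ i) \<longlonglongrightarrow> 1" for i
      using tendsto_matrix_entry[OF D0, of i i] by (simp add: mat_def)
    \<comment> \<open>\<open>norm_diff_le_of_bounded\<close> bounds the distance from the value at 0
      by a quantity that vanishes as that value tends to 1.\<close>
    have diag: "(\<lambda>k. D k z $ i $ i) \<longlonglongrightarrow> 1" for i
    proof -
      have b: "norm (D k z $ i $ i - D k 0 $ i $ i) \<le> sqrt (1 - (norm (D k 0 $ i $ i))\<^sup>2) / (1 - norm z)" for k
      proof (rule norm_diff_le_of_bounded)
        show "norm (D k w $ i $ i) \<le> 1" if "w \<in> ball 0 1" for w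
          using norm_entry_le_opnorm[of "D k w" i i] schur_class_opnorm[OF D that, of k] by linarith
      qed (use z schur_class_entry[OF D] in auto)
      have "(\<lambda>k. sqrt (1 - (norm (D k 0 $ i $ i))\<^sup>2) / (1 - norm z)) \<longlonglongrightarrow> sqrt (1 - (norm (1::complex))\<^sup>2) / (1 - norm z)"
        using z by (intro tendsto_intros d0) auto
      hence l0: "(\<lambda>k. sqrt (1 - (norm (D k 0 $ i $ i))\<^sup>2) / (1 - norm z)) \<longlonglongrightarrow> 0" by simp
      have "(\<lambda>k. D k z $ i $ i - D k 0 $ i $ i) \<longlonglongrightarrow> 0"
        by (rule Lim_null_comparison[OF _ l0]) (use b in auto)
      from tendsto_add[OF this d0[of i]] show ?thesis by simp
    qed
    have off: "(\<lambda>k. D k z $ i $ j) \<longlonglongrightarrow> 0" if ij: "i \<noteq> j" for i j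
    proof -
      have b: "norm (D k z $ i $ j) \<le> sqrt (1 - (norm (D k z $ j $ j))\<^sup>2)" for k
        by (rule real_le_rsqrt) (rule contraction_column[OF schur_class_opnorm[OF D z] ij])
      have "(\<lambda>k. sqrt (1 - (norm (D k z $ j $ j))\<^sup>2)) \<longlonglongrightarrow> sqrt (1 - (norm (1::complex))\<^sup>2)"
        by (intro tendsto_intros diag)
      hence l0: "(\<lambda>k. sqrt (1 - (norm (D k z $ j $ j))\<^sup>2)) \<longlonglongrightarrow> 0" by simp
      show ?thesis by (rule Lim_null_comparison[OF _ l0]) (use b in auto)
    qed
    have "(\<lambda>k. D k z) \<longlonglongrightarrow> mat 1"
    proof (intro vec_tendstoI)
      fix i j
      show "(\<lambda>k. D k z $ i $ j) \<longlonglongrightarrow> mat 1 $ i $ j"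
        using diag[of i] off[of i j] by (cases "i = j") (auto simp: mat_def)
    qed
    hence "(\<lambda>k. V ** D k z) \<longlonglongrightarrow> V ** mat 1" by (intro tendsto_matrix_mult tendsto_const)
    moreover have "V ** D k z = T (r k) z" for k
    proof -
      have "V ** D k z = (V ** W) ** T (r k) z" unfolding D_def by (simp only: matrix_mul_assoc)
      also have "V ** W = mat 1" using V by (simp add: W_def unitary_matrix_def)
      finally show ?thesis by simp
    qed
    ultimately show ?thesis by simp
  qed
  thus ?thesis using that V r by blast
qed

lemma opnorm_dilation_le_1:
  assumes P: "orthogonal_projection_matrix P" and c: "norm c \<le> 1"
  shows "opnorm (dilation c P) \<le> 1"
  unfolding opnorm_le_1_iff
proof
  fix x
  have "(norm c)\<^sup>2 * (norm (P *v x))\<^sup>2 \<le> 1 * (norm (P *v x))\<^sup>2"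
    using c by (intro mult_right_mono) (auto simp: power_le_one)
  hence "(norm (dilation c P *v x))\<^sup>2 \<le> (norm (dilation 1 P *v x))\<^sup>2"
    unfolding orthogonal_projection_pythagoras[OF P] by simp
  hence "(norm (dilation c P *v x))\<^sup>2 \<le> (norm x)\<^sup>2" by simp
  thus "norm (dilation c P *v x) \<le> norm x" by (rule power2_le_imp_le) simp
qed

text \<open>All partial products are contractions, so an increment is bounded by the distance of the
  next Blaschke factor from 1, and these distances are summable.\<close>

lemma right_BP_partial_convergent:
  fixes P :: "nat \<Rightarrow> complex^'n^'n"
  assumes BP: "\<And>k. BP_parameter (a k) (P k)" and summ: "summable (\<lambda>k. 1 - norm (a k))" and z: "z \<in> ball 0 1"
  obtains R where "(\<lambda>N. right_BP_partial a P N z) \<longlonglongrightarrow> R"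
proof -
  have a: "norm (a k) < 1" and P: "orthogonal_projection_matrix (P k)" for k
    using BP[of k] by (auto simp: BP_parameter_def)
  define R where "R N = right_BP_partial a P N z" for N
  define b where "b k = blaschke_factor (a k) z" for k
  have b1: "norm (b k) \<le> 1" for k unfolding b_def using z by (intro norm_blaschke_factor_le_1 a) auto
  have R1: "opnorm (R N) \<le> 1" for N
    unfolding R_def
    by (induction N) (auto simp: opnorm_mat_1 BP_factor_dilation b_def[symmetric] intro!: opnorm_mult_le_1 opnorm_dilation_le_1 P b1)
  have "convergent (\<lambda>N. R N $ i $ j)" for i j
  proof -
    define d where "d k = R (Suc k) $ i $ j - R k $ i $ j" for k
    have "norm (d k) \<le> 2 / (1 - norm z) * (1 - norm (a k))" for k
    proof -
      have "R (Suc k) $ i $ j = R k $ i $ j + (b k - 1) * (P k ** R k) $ i $ j"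
        by (simp add: R_def BP_factor_dilation matrix_mult_nth dilation_nth b_def distrib_right sum.distrib
            sum_distrib_left mult.assoc if_distrib[of "\<lambda>x. x * _"] cong: if_cong)
      hence "norm (d k) = norm (b k - 1) * norm ((P k ** R k) $ i $ j)" by (simp add: d_def norm_mult)
      also have "opnorm (P k) \<le> 1" using norm_projection_le[OF P] by (simp add: opnorm_le_1_iff)
      hence "norm ((P k ** R k) $ i $ j) \<le> 1"
        using norm_entry_le_opnorm[of "P k ** R k" i j] opnorm_mult_le_1[OF _ R1, of "P k" k] by linarith
      hence "norm (b k - 1) * norm ((P k ** R k) $ i $ j) \<le> norm (b k - 1) * 1" by (intro mult_left_mono) auto
      also have "\<dots> \<le> 2 / (1 - norm z) * (1 - norm (a k))"
        using norm_one_minus_blaschke_factor[OF a, of z k] z by (simp add: b_def mult.commute)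
      finally show ?thesis .
    qed
    hence "summable d" by (intro summable_comparison_test'[OF summable_mult[OF summ]])
    hence "convergent (\<lambda>N. \<Sum>k<N. d k)" by (simp add: summable_iff_convergent)
    moreover have "(\<Sum>k<N. d k) = R N $ i $ j - R 0 $ i $ j" for N
      unfolding d_def by (rule sum_lessThan_telescope)
    ultimately have "convergent (\<lambda>N. R N $ i $ j - R 0 $ i $ j)" by simp
    thus ?thesis by (simp only: convergent_diff_const_right_iff)
  qed
  hence "\<exists>l. (\<lambda>N. R N $ i $ j) \<longlonglongrightarrow> l" for i j by (simp add: convergent_def)
  then obtain l where "\<And>i j. (\<lambda>N. R N $ i $ j) \<longlonglongrightarrow> l i j" by metis
  hence "R \<longlonglongrightarrow> (\<chi> i j. l i j)" by (intro vec_tendstoI) simp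
  thus ?thesis using that unfolding R_def by blast
qed

lemma BP_summable_imp_summable:
  fixes P :: "nat \<Rightarrow> complex^'n^'n"
  assumes BP: "\<And>k. BP_parameter (a k) (P k)" and "BP_summable a P"
  shows "summable (\<lambda>k. 1 - norm (a k))"
proof -
  have le: "norm (1 - norm (a k)) \<le> (1 - norm (a k)) * Re (trace (P k))" for k
  proof -
    have "norm (a k) < 1" "1 \<le> Re (trace (P k))"
      using BP[of k] trace_projection_ge_1 by (auto simp: BP_parameter_def)
    thus ?thesis by simp
  qed
  show ?thesis by (rule summable_comparison_test'[OF assms(2)[unfolded BP_summable_def] le])
qed

lemma right_BP_product_mean_tendsto_0:
  fixes \<Theta> :: "complex \<Rightarrow> complex^'n^'n"
  assumes \<Theta>: "\<Theta> \<in> schur_class" and BP: "\<Theta> \<in> right_BP_products"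
  shows "((\<lambda>s. LINT t|circle_measure. ln (norm (det (\<Theta> (complex_of_real s * t))))) \<longlongrightarrow> 0) (at_left 1)"
proof -
  obtain V a P where V: "unitary_matrix V" and alt:
    "(\<exists>N. (\<forall>k<N. BP_parameter (a k) (P k)) \<and> (\<forall>z\<in>ball 0 1. \<Theta> z = V ** right_BP_partial a P N z)) \<or>
      ((\<forall>k. BP_parameter (a k) (P k)) \<and> BP_summable a P \<and>
       (\<forall>z\<in>ball 0 1. \<exists>B. (\<lambda>N. right_BP_partial a P N z) \<longlonglongrightarrow> B \<and> \<Theta> z = V ** B))"
    using BP unfolding right_BP_products_def by blast
  obtain m where m: "\<And>k. BP_parameter (a k) (P k) \<Longrightarrow> m k \<le> CARD('n)"
    "\<And>k z. BP_parameter (a k) (P k) \<Longrightarrow> det (BP_factor (a k) (P k) z) = blaschke_factor (a k) z ^ m k"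
    using BP_multiplicities[of a P] by metis
  note dV = norm_det_unitary[OF V]
  from alt show ?thesis
  proof (elim disjE exE conjE)
    fix N assume BPk: "\<forall>k<N. BP_parameter (a k) (P k)" and eq: "\<forall>z\<in>ball 0 1. \<Theta> z = V ** right_BP_partial a P N z"
    \<comment> \<open>Padding with exponent 0 makes the finite product an instance of the infinite
      one.\<close>
    define a' where "a' k = (if k < N then a k else 0)" for k
    define m' where "m' k = (if k < N then m k else 0)" for k
    show ?thesis
    proof (rule blaschke_product_mean_tendsto_0[where a=a' and m=m'])
      show "norm (a' k) < 1" for k using BPk by (auto simp: a'_def BP_parameter_def)
      show "summable (\<lambda>k. real (m' k) * (1 - norm (a' k)))"
        by (rule summable_finite[of "{..<N}"]) (auto simp: m'_def)
      show "(\<lambda>z. det (\<Theta> z)) holomorphic_on ball 0 1" by (rule schur_class_det[OF \<Theta>])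
      fix z :: complex assume z: "z \<in> ball 0 1"
      have "norm (det (\<Theta> z)) = (\<Prod>k<N. norm (blaschke_factor (a k) z) ^ m k)"
        using norm_det_right_BP_partial[of N a P z m] m(2) BPk eq z by (simp add: det_mul norm_mult dV)
      also have "\<dots> = (\<Prod>k<n. norm (blaschke_factor (a' k) z) ^ m' k)" if "n \<ge> N" for n
        using that by (intro prod.mono_neutral_cong_left) (auto simp: a'_def m'_def)
      finally show "(\<lambda>n. \<Prod>k<n. norm (blaschke_factor (a' k) z) ^ m' k) \<longlonglongrightarrow> norm (det (\<Theta> z))"
        by (intro tendsto_eventually eventually_sequentiallyI[of N]) auto
    qed
  next
    assume BPk: "\<forall>k. BP_parameter (a k) (P k)" and bs: "BP_summable a P"
      and eq: "\<forall>z\<in>ball 0 1. \<exists>B. (\<lambda>N. right_BP_partial a P N z) \<longlonglongrightarrow> B \<and> \<Theta> z = V ** B"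
    have summ: "summable (\<lambda>k. 1 - norm (a k))" using BP_summable_imp_summable[OF _ bs] BPk by blast
    show ?thesis
    proof (rule blaschke_product_mean_tendsto_0[where a=a and m=m])
      show a1: "norm (a k) < 1" for k using BPk by (auto simp: BP_parameter_def)
      \<comment> \<open>The exponents are at most the size of the matrices, so they do not affect
        the Blaschke condition.\<close>
      show "summable (\<lambda>k. real (m k) * (1 - norm (a k)))"
      proof (rule summable_comparison_test'[OF summable_mult[OF summ, of "real (CARD('n))"]])
        fix k
        show "norm (real (m k) * (1 - norm (a k))) \<le> real (CARD('n)) * (1 - norm (a k))"
          using m(1)[of k] BPk a1[of k] by (auto simp: abs_mult intro!: mult_right_mono)
      qed
      show "(\<lambda>z. det (\<Theta> z)) holomorphic_on ball 0 1" by (rule schur_class_det[OF \<Theta>])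
      fix z :: complex assume z: "z \<in> ball 0 1"
      then obtain B where B: "(\<lambda>N. right_BP_partial a P N z) \<longlonglongrightarrow> B" "\<Theta> z = V ** B" using eq by blast
      have "(\<lambda>N. norm (det (right_BP_partial a P N z))) \<longlonglongrightarrow> norm (det B)"
        by (intro tendsto_norm tendsto_det B)
      moreover have "norm (det (right_BP_partial a P N z)) = (\<Prod>k<N. norm (blaschke_factor (a k) z) ^ m k)" for N
        by (rule norm_det_right_BP_partial) (use m(2) BPk in blast)
      moreover have "norm (det (\<Theta> z)) = norm (det B)" by (simp add: B(2) det_mul norm_mult dV)
      ultimately show "(\<lambda>n. \<Prod>k<n. norm (blaschke_factor (a k) z) ^ m k) \<longlonglongrightarrow> norm (det (\<Theta> z))" by simp
    qed
  qed
qed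

section \<open>Characterising Blaschke-Potapov products by logarithmic means\<close>

lemma eventually_at_left_1: "\<forall>\<^sub>F s in at_left 1. (s::real) \<in> {0<..<1}"
  by (rule eventually_at_leftI[of 0]) auto

text \<open>Finitely many peelings leave a remainder without determinant zeros in the closed disc of
  radius \<open>s\<close>, so only finitely many logarithmic singularities can meet the
  circle.\<close>

lemma schur_class_ln_det_integrable:
  fixes \<Theta> :: "complex \<Rightarrow> complex^'n^'n"
  assumes \<Theta>: "\<Theta> \<in> schur_class" and z0: "z0 \<in> ball 0 1" "det (\<Theta> z0) \<noteq> 0" and s: "0 < s" "s < 1"
  shows "integrable circle_measure (\<lambda>t. ln (norm (det (\<Theta> (complex_of_real s * t)))))"
    and "AE t in circle_measure. det (\<Theta> (complex_of_real s * t)) \<noteq> 0"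
proof -
  have "\<exists>N a P T. (\<forall>k<N. BP_parameter (a k) (P k)) \<and> T \<in> schur_class \<and> (\<forall>z. norm z \<le> s \<longrightarrow> det (T z) \<noteq> 0) \<and>
      (\<forall>z\<in>ball 0 1. \<Theta> z = T z ** right_BP_partial a P N z)"
  proof (rule potapov_peeling[OF \<Theta> z0], goal_cases)
    case (1 N a P T)
    have "\<forall>z. norm z \<le> s \<longrightarrow> det (T z) \<noteq> 0" using 1(3) s by auto
    thus ?case using 1 by blast
  next
    case (2 a P T)
    from 2(6)[OF s(2)] obtain N where "\<forall>z. norm z \<le> s \<longrightarrow> det (T N z) \<noteq> 0" by blast
    thus ?case using 2(1,4,5) by blast
  qed
  then obtain N a P T where *: "\<And>k. k < N \<Longrightarrow> BP_parameter (a k) (P k)" "T \<in> schur_class"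
    "\<And>z. norm z \<le> s \<Longrightarrow> det (T z) \<noteq> 0" "\<And>z. z \<in> ball 0 1 \<Longrightarrow> \<Theta> z = T z ** right_BP_partial a P N z"
    by blast
  show "integrable circle_measure (\<lambda>t. ln (norm (det (\<Theta> (complex_of_real s * t)))))"
    by (rule ln_det_mean_le(1)[OF *(2) *(3) *(1) s *(4) \<Theta>])
  show "AE t in circle_measure. det (\<Theta> (complex_of_real s * t)) \<noteq> 0"
    by (rule ln_det_mean_le(3)[OF *(2) *(3) *(1) s *(4) \<Theta>])
qed

theorem right_BP_product_iff:
  fixes \<Theta> :: "complex \<Rightarrow> complex^'n^'n"
  assumes \<Theta>: "\<Theta> \<in> schur_class" and z0: "z0 \<in> ball 0 1" "det (\<Theta> z0) \<noteq> 0"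
  shows "\<Theta> \<in> right_BP_products \<longleftrightarrow>
    ((\<lambda>s. LINT t|circle_measure. ln (norm (det (\<Theta> (complex_of_real s * t))))) \<longlongrightarrow> 0) (at_left 1)"
    (is "_ \<longleftrightarrow> (?I \<longlongrightarrow> 0) (at_left 1)")
proof
  assume "\<Theta> \<in> right_BP_products"
  thus "(?I \<longlongrightarrow> 0) (at_left 1)" by (rule right_BP_product_mean_tendsto_0[OF \<Theta>])
next
  assume lim: "(?I \<longlongrightarrow> 0) (at_left 1)"
  show "\<Theta> \<in> right_BP_products"
  proof (rule potapov_peeling[OF \<Theta> z0], goal_cases)
    case (1 N a P T)
    have "0 \<le> ln (norm (det (T 0)))"
    proof (rule tendsto_upperbound[OF lim])
      show "\<forall>\<^sub>F s in at_left 1. ?I s \<le> ln (norm (det (T 0)))"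
        using eventually_at_left_1
      proof eventually_elim
        case (elim s)
        show ?case
          by (rule ln_det_mean_le(2)[OF 1(2) _ 1(1) _ _ 1(4) \<Theta>]) (use elim 1(3) in auto)
      qed
    qed simp
    moreover have "norm (det (T 0)) \<le> 1" by (rule schur_class_norm_det[OF 1(2)]) simp
    moreover have "det (T 0) \<noteq> 0" by (rule 1(3)) simp
    ultimately have "norm (det (T 0)) = 1" by (auto simp: ln_ge_zero_iff)
    \<comment> \<open>The constant sequence: a contractive function whose determinant has modulus 1
      at 0 is a unitary constant.\<close>
    then obtain V r where V: "unitary_matrix V" "\<And>z. z \<in> ball 0 1 \<Longrightarrow> (\<lambda>k::nat. T z) \<longlonglongrightarrow> V"
      using schur_sequence_unitary_limit[of "\<lambda>_. T"] 1(2) by auto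
    have "T z = V" if "z \<in> ball 0 1" for z using V(2)[OF that] by (simp add: LIMSEQ_const_iff)
    hence "\<forall>z\<in>ball 0 1. \<Theta> z = V ** right_BP_partial a P N z" using 1(4) by simp
    thus ?case unfolding right_BP_products_def using V(1) 1(1) by blast
  next
    case (2 a P T)
    \<comment> \<open>Fix a radius at which the mean exceeds \<open>- \<epsilon>\<close>. Once
      \<open>T N\<close> has no determinant zeros up to that radius, its logarithm at 0 is squeezed
      between this mean and 0.\<close>
    have "(\<lambda>N. ln (norm (det (T N 0)))) \<longlonglongrightarrow> 0"
    proof (rule LIMSEQ_I)
      fix \<epsilon> :: real assume "\<epsilon> > 0"
      hence "\<forall>\<^sub>F s in at_left 1. - \<epsilon> < ?I s" by (intro order_tendstoD(1)[OF lim]) simp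
      from eventually_happens'[OF _ eventually_conj[OF this eventually_at_left_1]]
      obtain s where s: "- \<epsilon> < ?I s" "0 < s" "s < 1" by (auto simp: trivial_limit_at_left_real)
      obtain N0 where N0: "\<And>N z. N \<ge> N0 \<Longrightarrow> norm z \<le> s \<Longrightarrow> det (T N z) \<noteq> 0" using 2(6)[OF s(3)] by blast
      have "norm (ln (norm (det (T N 0))) - 0) < \<epsilon>" if N: "N \<ge> N0" for N
      proof -
        have "?I s \<le> ln (norm (det (T N 0)))"
          by (rule ln_det_mean_le(2)[OF 2(4) N0[OF N] 2(1) s(2,3) 2(5) \<Theta>])
        moreover have "norm (det (T N 0)) \<le> 1" by (rule schur_class_norm_det[OF 2(4)]) simp
        hence "ln (norm (det (T N 0))) \<le> 0" by (cases "det (T N 0) = 0") auto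
        ultimately show ?thesis using s(1) by simp
      qed
      thus "\<exists>N0. \<forall>N\<ge>N0. norm (ln (norm (det (T N 0))) - 0) < \<epsilon>" by blast
    qed
    hence "(\<lambda>N. exp (ln (norm (det (T N 0))))) \<longlonglongrightarrow> exp 0" by (intro tendsto_exp)
    moreover obtain N0 where N0: "\<And>N. N \<ge> N0 \<Longrightarrow> det (T N 0) \<noteq> 0" using 2(6)[of 0] by auto
    hence "\<forall>\<^sub>F N in sequentially. exp (ln (norm (det (T N 0)))) = norm (det (T N 0))"
      by (intro eventually_sequentiallyI[of N0]) simp
    ultimately have "(\<lambda>N. norm (det (T N 0))) \<longlonglongrightarrow> 1" using Lim_transform_eventually by fastforce
    then obtain V r where V: "unitary_matrix V" "strict_mono (r :: nat \<Rightarrow> nat)"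
      "\<And>z. z \<in> ball 0 1 \<Longrightarrow> (\<lambda>k. T (r k) z) \<longlonglongrightarrow> V"
      using schur_sequence_unitary_limit[of T] 2(4) by blast
    have "\<exists>B. (\<lambda>N. right_BP_partial a P N z) \<longlonglongrightarrow> B \<and> \<Theta> z = V ** B" if z: "z \<in> ball 0 1" for z
    proof -
      obtain B where B: "(\<lambda>N. right_BP_partial a P N z) \<longlonglongrightarrow> B"
        by (rule right_BP_partial_convergent[OF 2(1) 2(3) z])
      \<comment> \<open>The partial products converge along the whole sequence and the remainders
        along \<open>r\<close>. A subsequence is enough because every product of the two equals
        \<open>\<Theta> z\<close>.\<close>
      have "(\<lambda>k. T (r k) z ** right_BP_partial a P (r k) z) \<longlonglongrightarrow> V ** B"
        using LIMSEQ_subseq_LIMSEQ[OF B V(2)] by (intro tendsto_matrix_mult V(3)[OF z]) (simp add: o_def)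
      moreover have "T (r k) z ** right_BP_partial a P (r k) z = \<Theta> z" for k using 2(5)[OF z] by simp
      ultimately have "\<Theta> z = V ** B" by (simp add: LIMSEQ_const_iff)
      thus ?thesis using B by blast
    qed
    moreover have "BP_summable a P" unfolding BP_summable_def using 2(2,3) by simp
    ultimately show ?case unfolding right_BP_products_def using V(1) 2(1) by blast
  qed
qed

section \<open>Transposition between right and left products\<close>

lemma transpose_nth: "transpose A $ i $ j = A $ j $ i"
  by (simp add: transpose_def)

lemma unitary_matrix_transpose:
  fixes V :: "complex^'n^'n"
  assumes "unitary_matrix V"
  shows "unitary_matrix (transpose V)"
proof -
  have ct: "conj_transpose (transpose V) = transpose (conj_transpose V)"
    by (simp add: conj_transpose_def transpose_def)
  show ?thesis using assms unfolding unitary_matrix_def ct matrix_transpose_mul[symmetric]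
    by (simp add: transpose_mat)
qed

lemma BP_parameter_transpose:
  fixes P :: "complex^'n^'n"
  assumes "BP_parameter a P"
  shows "BP_parameter a (transpose P)"
proof -
  have ct: "conj_transpose (transpose P) = transpose (conj_transpose P)"
    by (simp add: conj_transpose_def transpose_def)
  have "transpose P \<noteq> 0"
  proof
    assume "transpose P = 0"
    hence "transpose (transpose P) = transpose 0" by simp
    moreover have "transpose 0 = (0 :: complex^'n^'n)" by (simp add: transpose_def vec_eq_iff)
    ultimately show False using assms by (simp add: BP_parameter_def transpose_transpose)
  qed
  thus ?thesis using assms
    unfolding BP_parameter_def orthogonal_projection_matrix_def ct matrix_transpose_mul[symmetric] by simp
qed

lemma transpose_BP_factor: "transpose (BP_factor a P z) = BP_factor a (transpose P) z"
  by (simp add: vec_eq_iff BP_factor_dilation dilation_nth transpose_nth)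

lemma transpose_left_BP_partial:
  "transpose (left_BP_partial a P N z) = right_BP_partial a (\<lambda>k. transpose (P k)) N z"
  by (induction N) (simp_all add: matrix_transpose_mul transpose_BP_factor transpose_mat)

lemma trace_transpose: "trace (transpose A) = trace A"
  by (simp add: trace_def transpose_nth)

lemma tendsto_transpose:
  fixes A :: "'a \<Rightarrow> complex^'n^'n"
  assumes "(A \<longlongrightarrow> a) F"
  shows "((\<lambda>x. transpose (A x)) \<longlongrightarrow> transpose a) F"
  unfolding transpose_def by (intro vec_tendstoI) (auto intro!: tendsto_intros assms)

lemma left_BP_products_transpose:
  fixes \<Theta> :: "complex \<Rightarrow> complex^'n^'n"
  shows "\<Theta> \<in> left_BP_products \<longleftrightarrow> (\<lambda>z. transpose (\<Theta> z)) \<in> right_BP_products"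
proof
  assume "\<Theta> \<in> left_BP_products"
  then obtain V a P where V: "unitary_matrix V" and alt:
    "(\<exists>N. (\<forall>k<N. BP_parameter (a k) (P k)) \<and> (\<forall>z\<in>ball 0 1. \<Theta> z = left_BP_partial a P N z ** V)) \<or>
      ((\<forall>k. BP_parameter (a k) (P k)) \<and> BP_summable a P \<and>
       (\<forall>z\<in>ball 0 1. \<exists>B. (\<lambda>N. left_BP_partial a P N z) \<longlonglongrightarrow> B \<and> \<Theta> z = B ** V))"
    unfolding left_BP_products_def by blast
  define Q where "Q = (\<lambda>k. transpose (P k))"
  have L: "transpose (left_BP_partial a P N z) = right_BP_partial a Q N z" for N z
    by (simp add: transpose_left_BP_partial Q_def)
  have Q: "BP_parameter (a k) (Q k)" if "BP_parameter (a k) (P k)" for k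
    unfolding Q_def using that by (rule BP_parameter_transpose)
  from alt show "(\<lambda>z. transpose (\<Theta> z)) \<in> right_BP_products"
  proof (elim disjE exE conjE)
    fix N assume *: "\<forall>k<N. BP_parameter (a k) (P k)" "\<forall>z\<in>ball 0 1. \<Theta> z = left_BP_partial a P N z ** V"
    have "\<forall>k<N. BP_parameter (a k) (Q k)" using *(1) Q by blast
    moreover have "\<forall>z\<in>ball 0 1. transpose (\<Theta> z) = transpose V ** right_BP_partial a Q N z"
      using *(2) by (simp add: matrix_transpose_mul L)
    ultimately show ?thesis unfolding right_BP_products_def using unitary_matrix_transpose[OF V] by blast
  next
    assume *: "\<forall>k. BP_parameter (a k) (P k)" "BP_summable a P"
      "\<forall>z\<in>ball 0 1. \<exists>B. (\<lambda>N. left_BP_partial a P N z) \<longlonglongrightarrow> B \<and> \<Theta> z = B ** V"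
    have "\<exists>B. (\<lambda>N. right_BP_partial a Q N z) \<longlonglongrightarrow> B \<and> transpose (\<Theta> z) = transpose V ** B"
      if z: "z \<in> ball 0 1" for z
    proof -
      obtain B where B: "(\<lambda>N. left_BP_partial a P N z) \<longlonglongrightarrow> B" "\<Theta> z = B ** V" using *(3) z by blast
      from tendsto_transpose[OF B(1)] have "(\<lambda>N. right_BP_partial a Q N z) \<longlonglongrightarrow> transpose B" unfolding L .
      moreover have "transpose (\<Theta> z) = transpose V ** transpose B" unfolding B(2) by (rule matrix_transpose_mul)
      ultimately show ?thesis by blast
    qed
    moreover have "BP_summable a Q" using *(2) by (simp add: BP_summable_def trace_transpose Q_def)
    moreover have "\<forall>k. BP_parameter (a k) (Q k)" using *(1) Q by blast
    ultimately show ?thesis unfolding right_BP_products_def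
      using unitary_matrix_transpose[OF V] by blast
  qed
next
  assume "(\<lambda>z. transpose (\<Theta> z)) \<in> right_BP_products"
  then obtain V a P where V: "unitary_matrix V" and alt:
    "(\<exists>N. (\<forall>k<N. BP_parameter (a k) (P k)) \<and> (\<forall>z\<in>ball 0 1. transpose (\<Theta> z) = V ** right_BP_partial a P N z)) \<or>
      ((\<forall>k. BP_parameter (a k) (P k)) \<and> BP_summable a P \<and>
       (\<forall>z\<in>ball 0 1. \<exists>B. (\<lambda>N. right_BP_partial a P N z) \<longlonglongrightarrow> B \<and> transpose (\<Theta> z) = V ** B))"
    unfolding right_BP_products_def by blast
  define Q where "Q = (\<lambda>k. transpose (P k))"
  have R: "right_BP_partial a P N z = transpose (left_BP_partial a Q N z)" for N z
    by (simp add: transpose_left_BP_partial Q_def transpose_transpose)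
  have flip: "A = B ** transpose V" if "transpose A = V ** transpose B" for A B :: "complex^'n^'n"
  proof -
    have "transpose (transpose A) = transpose (V ** transpose B)" using that by simp
    thus ?thesis by (simp add: matrix_transpose_mul transpose_transpose)
  qed
  from alt show "\<Theta> \<in> left_BP_products"
  proof (elim disjE exE conjE)
    fix N assume *: "\<forall>k<N. BP_parameter (a k) (P k)" "\<forall>z\<in>ball 0 1. transpose (\<Theta> z) = V ** right_BP_partial a P N z"
    have "\<forall>k<N. BP_parameter (a k) (Q k)" using *(1) BP_parameter_transpose by (auto simp: Q_def)
    moreover have "\<forall>z\<in>ball 0 1. \<Theta> z = left_BP_partial a Q N z ** transpose V" using *(2) R flip by auto
    ultimately show ?thesis unfolding left_BP_products_def using unitary_matrix_transpose[OF V] by blast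
  next
    assume *: "\<forall>k. BP_parameter (a k) (P k)" "BP_summable a P"
      "\<forall>z\<in>ball 0 1. \<exists>B. (\<lambda>N. right_BP_partial a P N z) \<longlonglongrightarrow> B \<and> transpose (\<Theta> z) = V ** B"
    have "\<exists>B. (\<lambda>N. left_BP_partial a Q N z) \<longlonglongrightarrow> B \<and> \<Theta> z = B ** transpose V" if z: "z \<in> ball 0 1" for z
    proof -
      obtain B where B: "(\<lambda>N. right_BP_partial a P N z) \<longlonglongrightarrow> B" "transpose (\<Theta> z) = V ** B" using *(3) z by blast
      have "(\<lambda>N. left_BP_partial a Q N z) \<longlonglongrightarrow> transpose B"
        using tendsto_transpose[OF B(1)] by (simp add: R transpose_transpose)
      moreover have "\<Theta> z = transpose B ** transpose V" using B(2) by (intro flip) (simp add: transpose_transpose)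
      ultimately show ?thesis by blast
    qed
    moreover have "BP_summable a Q" using *(2) by (simp add: BP_summable_def trace_transpose Q_def)
    moreover have "\<forall>k. BP_parameter (a k) (Q k)" using *(1) BP_parameter_transpose by (auto simp: Q_def)
    ultimately show ?thesis unfolding left_BP_products_def
      using unitary_matrix_transpose[OF V] by blast
  qed
qed

text \<open>The adjoint of a contraction is a contraction by Cauchy-Schwarz, and the transpose is
  the adjoint conjugated with entrywise complex conjugation, which preserves norms.\<close>

lemma opnorm_transpose_le_1:
  fixes A :: "complex^'n^'n"
  assumes A: "opnorm A \<le> 1"
  shows "opnorm (transpose A) \<le> 1"
proof -
  have ct: "norm (conj_transpose A *v x) \<le> norm x" for x
  proof -
    define y where "y = conj_transpose A *v x"
    have "(norm y)\<^sup>2 = norm (cinner y (conj_transpose A *v x))"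
      unfolding y_def[symmetric] cinner_self norm_of_real by simp
    also have "cinner y (conj_transpose A *v x) = cinner (A *v y) x" by (rule cinner_matrix[symmetric])
    also have "norm \<dots> \<le> norm (A *v y) * norm x" by (rule norm_cinner_le)
    also have "\<dots> \<le> norm y * norm x" using A opnorm_le_1_iff by (intro mult_right_mono) auto
    finally show ?thesis unfolding y_def[symmetric]
      by (cases "norm y = 0") (simp_all add: power2_eq_square)
  qed
  define c where "c x = (\<chi> i. cnj (x $ i))" for x :: "complex^'n"
  have nc: "norm (c x) = norm x" for x by (simp add: c_def norm_vec_def)
  have "transpose A *v x = c (conj_transpose A *v c x)" for x
    by (simp add: vec_eq_iff c_def matrix_vector_mult_def conj_transpose_def transpose_def)
  thus ?thesis unfolding opnorm_le_1_iff using ct nc by metis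
qed

lemma schur_class_transpose:
  fixes \<Theta> :: "complex \<Rightarrow> complex^'n^'n"
  shows "\<Theta> \<in> schur_class \<Longrightarrow> (\<lambda>z. transpose (\<Theta> z)) \<in> schur_class"
  by (auto simp: schur_class_def matrix_holomorphic_on_def transpose_nth opnorm_transpose_le_1)

corollary left_BP_product_iff:
  fixes \<Theta> :: "complex \<Rightarrow> complex^'n^'n"
  assumes \<Theta>: "\<Theta> \<in> schur_class" and z0: "z0 \<in> ball 0 1" "det (\<Theta> z0) \<noteq> 0"
  shows "\<Theta> \<in> left_BP_products \<longleftrightarrow>
    ((\<lambda>s. LINT t|circle_measure. ln (norm (det (\<Theta> (complex_of_real s * t))))) \<longlongrightarrow> 0) (at_left 1)"
  using right_BP_product_iff[OF schur_class_transpose[OF \<Theta>] z0(1)] z0(2)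
  by (simp add: left_BP_products_transpose det_transpose)

text \<open>The mean of \<open>ln \<bar>det E\<bar>\<close> over every circle, and over the boundary, is its value at \<open>0\<close>; hence only the
  inner factor contributes to a possible gap in the limit.\<close>

theorem mean_limit_iff_inner_factor:
  fixes F \<Theta> E :: "complex \<Rightarrow> complex^'n^'n"
  assumes F: "F \<in> Smirnov_class" and z0: "z0 \<in> ball 0 1" "det (F z0) \<noteq> 0"
    and \<Theta>: "\<Theta> \<in> inner_class" and E: "E \<in> outer_class"
    and fac: "\<And>z. z \<in> ball 0 1 \<Longrightarrow> det (F z) = det (\<Theta> z) * det (E z)"
  shows "((\<lambda>s. LINT t|circle_measure. ln (norm (det (F (complex_of_real s * t))))) \<longlongrightarrow>
        (LINT t|circle_measure. ln (norm (det (boundary_value F t))))) (at_left 1) \<longleftrightarrow>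
    ((\<lambda>s. LINT t|circle_measure. ln (norm (det (\<Theta> (complex_of_real s * t))))) \<longlongrightarrow> 0) (at_left 1)"
proof -
  define e where "e z = det (E z)" for z
  have eh: "e holomorphic_on ball 0 1"
    using E unfolding e_def outer_class_def by (intro holomorphic_det Smirnov_class_holomorphic) auto
  have eo: "outer_function e" using E by (simp add: outer_class_def e_def[abs_def])
  obtain v where e0: "\<And>z. z \<in> ball 0 1 \<Longrightarrow> e z \<noteq> 0"
    by (rule outer_function_ln_norm[OF eo]) blast
  have \<Theta>s: "\<Theta> \<in> schur_class" by (rule inner_class_schur[OF \<Theta>])
  have d0: "det (\<Theta> z0) \<noteq> 0" using fac[OF z0(1)] z0(2) by auto
  define c where "c = ln (norm (e 0))"
  have boundary: "(LINT t|circle_measure. ln (norm (det (boundary_value F t)))) = c"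
    unfolding c_def
  proof (rule outer_function_boundary_mean[OF eh eo])
    have "AE t in circle_measure. has_boundary_value \<Theta> t \<and> unitary_matrix (boundary_value \<Theta> t)"
      using \<Theta> by (simp add: inner_class_def)
    with Smirnov_class_boundary_value[OF F] AE_space[of circle_measure]
    show "AE t in circle_measure. ((\<lambda>r. norm (e (complex_of_real r * t))) \<longlongrightarrow> norm (det (boundary_value F t))) (at_left 1)"
    proof eventually_elim
      case (elim t)
      have f: "((\<lambda>r. norm (det (F (complex_of_real r * t)))) \<longlongrightarrow> norm (det (boundary_value F t))) (at_left 1)"
        using elim by (intro tendsto_norm tendsto_det) (simp add: has_boundary_value_def)
      \<comment> \<open>Unitary boundary values make the modulus of \<open>det \<Theta>\<close> tend
        to 1, so the outer determinant has the same boundary modulus as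
        \<open>det F\<close>.\<close>
      have h: "((\<lambda>r. norm (det (\<Theta> (complex_of_real r * t)))) \<longlongrightarrow> 1) (at_left 1)"
      proof -
        have "((\<lambda>r. norm (det (\<Theta> (complex_of_real r * t)))) \<longlongrightarrow> norm (det (boundary_value \<Theta> t))) (at_left 1)"
          using elim by (intro tendsto_norm tendsto_det) (simp add: has_boundary_value_def)
        thus ?thesis using elim by (simp add: norm_det_unitary)
      qed
      have "((\<lambda>r. norm (det (F (complex_of_real r * t))) / norm (det (\<Theta> (complex_of_real r * t)))) \<longlongrightarrow>
          norm (det (boundary_value F t)) / 1) (at_left 1)"
        by (intro tendsto_divide f h) simp
      moreover have "\<forall>\<^sub>F r in at_left 1. norm (det (F (complex_of_real r * t))) / norm (det (\<Theta> (complex_of_real r * t))) =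
          norm (e (complex_of_real r * t))"
        using eventually_at_left_1 order_tendstoD(1)[OF h zero_less_one]
      proof eventually_elim
        case (elim r)
        have "complex_of_real r * t \<in> ball 0 1"
          using elim(1) \<open>t \<in> space circle_measure\<close> by (simp add: norm_mult)
        from fac[OF this] elim(2) show ?case by (simp add: e_def norm_mult)
      qed
      ultimately show ?case using Lim_transform_eventually by fastforce
    qed
    have [measurable]: "boundary_value F \<in> borel_measurable circle_measure"
      by (rule boundary_value_measurable) (rule Smirnov_class_holomorphic[OF F])
    have "continuous_on UNIV (\<lambda>A :: complex^'n^'n. norm (det A))"
      unfolding continuous_on_def by (intro ballI tendsto_norm tendsto_det tendsto_ident_at)
    hence "(\<lambda>A :: complex^'n^'n. norm (det A)) \<in> borel_measurable borel" by (rule borel_measurable_continuous_onI)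
    thus "(\<lambda>t. norm (det (boundary_value F t))) \<in> borel_measurable circle_measure"
      by (rule measurable_compose[rotated]) measurable
  qed
  define J where "J s = (LINT t|circle_measure. ln (norm (det (\<Theta> (complex_of_real s * t)))))" for s
  have inside: "(LINT t|circle_measure. ln (norm (det (F (complex_of_real s * t))))) = J s + c" if s: "0 < s" "s < 1" for s
  proof -
    have inb: "complex_of_real s * t \<in> ball 0 1" if "t \<in> sphere 0 1" for t using s that by (simp add: norm_mult)
    have ei: "(LINT t|circle_measure. ln (norm (e (complex_of_real s * t)))) = c"
      "integrable circle_measure (\<lambda>t. ln (norm (e (complex_of_real s * t))))"
      unfolding c_def using ln_norm_mean_value_dilate[OF eh, of s] s e0 by auto
    note \<Theta>i = schur_class_ln_det_integrable[OF \<Theta>s z0(1) d0 s]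
    have "(LINT t|circle_measure. ln (norm (det (F (complex_of_real s * t))))) =
        (LINT t|circle_measure. ln (norm (det (\<Theta> (complex_of_real s * t)))) + ln (norm (e (complex_of_real s * t))))"
    proof (rule integral_cong_AE)
      have [measurable]: "(\<lambda>t. det (F (complex_of_real s * t))) \<in> borel_measurable circle_measure"
        using s by (intro circle_borel_measurable_continuous continuous_on_dilate holomorphic_det Smirnov_class_holomorphic F) auto
      show "(\<lambda>t. ln (norm (det (F (complex_of_real s * t))))) \<in> borel_measurable circle_measure" by measurable
      show "(\<lambda>t. ln (norm (det (\<Theta> (complex_of_real s * t)))) + ln (norm (e (complex_of_real s * t)))) \<in> borel_measurable circle_measure"
        by (intro borel_measurable_add borel_measurable_integrable \<Theta>i ei)
      \<comment> \<open>The logarithm of a product splits only where both factors are nonzero: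
        everywhere for the outer factor, almost everywhere for the inner one.\<close>
      show "AE t in circle_measure. ln (norm (det (F (complex_of_real s * t)))) =
          ln (norm (det (\<Theta> (complex_of_real s * t)))) + ln (norm (e (complex_of_real s * t)))"
        using \<Theta>i(2) AE_space[of circle_measure]
      proof eventually_elim
        case (elim t)
        have t: "complex_of_real s * t \<in> ball 0 1" using elim inb by simp
        show ?case using elim(1) e0[OF t] unfolding fac[OF t] e_def[symmetric] norm_mult
          by (simp add: ln_mult)
      qed
    qed
    also have "\<dots> = J s + c" unfolding J_def ei(1)[symmetric]
      by (intro Bochner_Integration.integral_add \<Theta>i ei)
    finally show ?thesis .
  qed
  have ev: "\<forall>\<^sub>F s in at_left 1. (LINT t|circle_measure. ln (norm (det (F (complex_of_real s * t))))) = J s + c"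
    using eventually_at_left_1 by eventually_elim (use inside in auto)
  have "((\<lambda>s. LINT t|circle_measure. ln (norm (det (F (complex_of_real s * t))))) \<longlongrightarrow> c) (at_left 1) \<longleftrightarrow>
      ((\<lambda>s. J s + c) \<longlongrightarrow> c) (at_left 1)"
    by (rule tendsto_cong[OF ev])
  also have "\<dots> \<longleftrightarrow> (J \<longlongrightarrow> 0) (at_left 1)"
  proof
    assume "((\<lambda>s. J s + c) \<longlongrightarrow> c) (at_left 1)"
    from tendsto_diff[OF this tendsto_const[of c]] show "(J \<longlongrightarrow> 0) (at_left 1)" by simp
  next
    assume "(J \<longlongrightarrow> 0) (at_left 1)"
    from tendsto_add[OF this tendsto_const[of c]] show "((\<lambda>s. J s + c) \<longlongrightarrow> c) (at_left 1)" by simp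
  qed
  finally show ?thesis unfolding boundary J_def[abs_def] .
qed

theorem theorem5p5:
  fixes F \<Theta>\<^sub>r \<Theta>\<^sub>l E\<^sub>r E\<^sub>l :: "complex \<Rightarrow> complex^'n^'n"
  assumes "F \<in> Smirnov_class"
    and "\<exists>z\<in>ball 0 1. det (F z) \<noteq> 0"
    and "\<Theta>\<^sub>r \<in> inner_class" and "\<Theta>\<^sub>l \<in> inner_class"
    and "E\<^sub>r \<in> outer_class" and "E\<^sub>l \<in> outer_class"
    and "\<And>z. z \<in> ball 0 1 \<Longrightarrow> \<Theta>\<^sub>r z ** E\<^sub>r z = F z"
    and "\<And>z. z \<in> ball 0 1 \<Longrightarrow> E\<^sub>l z ** \<Theta>\<^sub>l z = F z"
  shows "(\<Theta>\<^sub>r \<in> right_BP_products \<longleftrightarrow> \<Theta>\<^sub>l \<in> left_BP_products) \<and>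
    (\<Theta>\<^sub>l \<in> left_BP_products \<longleftrightarrow>
      ((\<lambda>s. LINT t|circle_measure. ln (norm (det (F (complex_of_real s * t))))) \<longlongrightarrow>
        (LINT t|circle_measure. ln (norm (det (boundary_value F t))))) (at_left 1))"
proof -
  obtain z0 where z0: "z0 \<in> ball 0 1" "det (F z0) \<noteq> 0" using assms(2) by blast
  have r: "det (F z) = det (\<Theta>\<^sub>r z) * det (E\<^sub>r z)" if "z \<in> ball 0 1" for z
    using assms(7)[OF that, symmetric] by (simp add: det_mul)
  have l: "det (F z) = det (\<Theta>\<^sub>l z) * det (E\<^sub>l z)" if "z \<in> ball 0 1" for z
    using assms(8)[OF that, symmetric] by (simp add: det_mul mult.commute)
  have "det (\<Theta>\<^sub>r z0) \<noteq> 0" "det (\<Theta>\<^sub>l z0) \<noteq> 0" using r[OF z0(1)] l[OF z0(1)] z0(2) by auto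
  thus ?thesis
    using right_BP_product_iff[OF inner_class_schur[OF assms(3)] z0(1)]
      left_BP_product_iff[OF inner_class_schur[OF assms(4)] z0(1)]
      mean_limit_iff_inner_factor[OF assms(1) z0 assms(3,5) r]
      mean_limit_iff_inner_factor[OF assms(1) z0 assms(4,6) l]
    by simp
qed

end
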